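(* Let $d,p,q\in\mathbb{N}$ and consider $d$-dimensional VARMA($p,q$) processes $S$ with instantaneous effects such that $A_0$ is lower triangular with zero diagonal and $\varepsilon_t\overset{\text{i.i.d.}}{\sim}\mathcal{N}(0,\Gamma)$ with $\Gamma=\mathrm{diag}(\sigma_1^2,\ldots,\sigma_d^2)$ diagonal. Let $\mathcal{G}_S$ denote the full-time marginalized ADMG of the process. Define $$\mathcal{D}:=\{(\mathrm{vech}(A_0),\mathrm{vec}(A_1|\ldots|A_p|B_1|\ldots|B_q))\in\mathbb{R}^{(p+q)d^2+d(d-1)/2}:\ \det((I_d-A_0)\lambda^p-A_1\lambda^{p-1}-\ldots-A_p)=0\Rightarrow|\lambda|<1\}$$ and let $\overset{\circ}{\mathcal{D}}$ be its interior. Assume that $(\mathrm{vech}(A_0),\mathrm{vec}(A_1|\ldots|A_p|B_1|\ldots|B_q),\sigma_1^2,\ldots,\sigma_d^2)$ is sampled from a probability distribution $\mathbb{P}$ on $\overset{\circ}{\mathcal{D}}\times(0,\infty)^d$ which is absolutely continuous with respect to Lebesgue measure. Then the distribution of the process is $\mathbb{P}$-almost surely faithful to $\mathcal{G}_S$. More precisely, the set of coefficients and variances for which there exist finite pairwise disjoint sets of nodes $A,B,C$ of $\mathcal{G}_S$ such that $A\perp\!\!\!\perp C\mid B$ (under the distribution of the process) but $A$ and $C$ are not $m$-separated by $B$ in $\mathcal{G}_S$ has $\mathbb{P}$-probability zero.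
   Context: VARMA process with instantaneous effects. $S=(S_t)_{t\in\mathbb{Z}}$ satisfies, for all $t\in\mathbb{Z}$, $S_t=A_0S_t+A_1S_{t-1}+\ldots+A_pS_{t-p}+\varepsilon_t+B_1\varepsilon_{t-1}+\ldots+B_q\varepsilon_{t-q}$ with $A_0,\ldots,A_p,B_1,\ldots,B_q\in\mathbb{R}^{d\times d}$, $\mathrm{diag}(A_0)=0$, where $\det((I_d-A_0)\lambda^p-A_1\lambda^{p-1}-\ldots-A_p)=0$ implies $|\lambda|<1$ and $(\varepsilon_t)$ is i.i.d. with finite second moments and jointly independent components. $S$ is understood to be the stationary solution, and the distribution of the process is its stationary distribution (given the coefficients and variances). Here $\sigma_i^2$ is the variance of $\varepsilon_t^i$. Full-time DAG $\mathcal{G}_{full}$. Nodes $\{S_t^i,\varepsilon_t^i: i\in\{1,\ldots,d\},t\in\mathbb{Z}\}$; edges $S_{t-k}^j\to S_t^i$ if $(A_k)_{i,j}\neq0$ ($k\in\{0,\ldots,p\}$); $\varepsilon_{t-l}^j\to S_t^i$ if $(B_l)_{i,j}\neq0$ ($l\in\{1,\ldots,q\}$); and $\varepsilon_t^i\to S_t^i$, for all $t$ and $i$. Full-time marginalized ADMG $\mathcal{G}_S$. An acyclic directed mixed graph (ADMG) has directed edges $\to$ and bi-directed edges $\leftrightarrow$ and no directed cycles; a directed and a bi-directed edge may both join the same two nodes. $\mathcal{G}_S$ is the latent projection of $\mathcal{G}_{full}$ onto the endogenous nodes (computed on a window of $\max(p,q)+2$ consecutive times and repeated along the time axis). Explicitly: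 nodes $\{S_t^i\}$; directed edges are those of $\mathcal{G}_{full}$ between endogenous nodes; and for distinct endogenous $v,w$, $v\leftrightarrow w$ exists if and only if some innovation node has edges in $\mathcal{G}_{full}$ to both $v$ and $w$. The graph depends on the sampled coefficients. Notation. $\mathrm{vec}(M)$ stacks the columns of $M$; $\mathrm{vech}(M)$, for an $n\times n$ matrix $M$, is the vector in $\mathbb{R}^{n(n-1)/2}$ obtained by stacking column-wise the elements strictly below the diagonal; $(\cdot|\cdots|\cdot)$ is horizontal concatenation. Faithfulness. A distribution over the nodes of a graph is faithful to the graph if for all finite pairwise disjoint sets of nodes $A,B,C$, $A\perp\!\!\!\perp C\mid B$ implies that $A$ and $C$ are separated (here $m$-separated) by $B$. $m$-separation. Paths have distinct vertices. A vertex is a collider in a path if both the preceding and succeeding edges of the path have an arrowhead at it. $DE(v)$ is the set of nodes reachable from $v$ via directed edges, including $v$. A path between $v$ and $w$ is blocked by $B\subset V\setminus\{v,w\}$ if some non-collider of the path other than its endpoints is in $B$, or some collider $u$ in it has $DE(u)\cap B=\emptyset$. $A$ and $C$ are $m$-separated by $B$ if every path from a node in $A$ to a node in $C$ is blocked by $B$. *)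

theory Defs
  imports "HOL-Probability.Probability" "Jordan_Normal_Form.Determinant"
begin

section \<open>Acyclic directed mixed graphs and m-separation\<close>

text \<open>The bi-directed edge relation is understood to be symmetric.\<close>

record 'v mixed_graph =
  nodes :: "'v set"
  directed :: "('v \<times> 'v) set"
  bidirected :: "('v \<times> 'v) set"

text \<open>Two nodes may be joined by several edges, so a path records which edge it uses in each step:
  \<open>Fwd\<close> is \<open>v \<rightarrow> w\<close>, \<open>Bwd\<close> is \<open>v \<leftarrow> w\<close>, \<open>Bi\<close> is \<open>v \<leftrightarrow> w\<close>, when stepping from \<open>v\<close> to \<open>w\<close>.\<close>

datatype edge_kind = Fwd | Bwd | Bi

fun joined :: "'v mixed_graph \<Rightarrow> 'v \<Rightarrow> edge_kind \<Rightarrow> 'v \<Rightarrow> bool" where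
  "joined G v Fwd w \<longleftrightarrow> (v, w) \<in> directed G"
| "joined G v Bwd w \<longleftrightarrow> (w, v) \<in> directed G"
| "joined G v Bi w \<longleftrightarrow> (v, w) \<in> bidirected G"

definition head_at_target :: "edge_kind \<Rightarrow> bool" where
  "head_at_target k \<longleftrightarrow> k = Fwd \<or> k = Bi"

definition head_at_source :: "edge_kind \<Rightarrow> bool" where
  "head_at_source k \<longleftrightarrow> k = Bwd \<or> k = Bi"

definition is_path :: "'v mixed_graph \<Rightarrow> 'v list \<Rightarrow> edge_kind list \<Rightarrow> bool" where
  "is_path G vs ks \<longleftrightarrow>
     length vs = Suc (length ks) \<and> distinct vs \<and> set vs \<subseteq> nodes G \<and>
     (\<forall>n<length ks. joined G (vs ! n) (ks ! n) (vs ! Suc n))"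

text \<open>Only used for inner positions \<open>0 < n < length ks\<close>.\<close>

definition collider_at :: "edge_kind list \<Rightarrow> nat \<Rightarrow> bool" where
  "collider_at ks n \<longleftrightarrow> head_at_target (ks ! (n - 1)) \<and> head_at_source (ks ! n)"

definition DE :: "'v mixed_graph \<Rightarrow> 'v \<Rightarrow> 'v set" where
  "DE G v = {w. (v, w) \<in> (directed G)\<^sup>*}"

definition blocked :: "'v mixed_graph \<Rightarrow> 'v list \<Rightarrow> edge_kind list \<Rightarrow> 'v set \<Rightarrow> bool" where
  "blocked G vs ks B \<longleftrightarrow>
     (\<exists>n. 0 < n \<and> n < length ks \<and>
        ((\<not> collider_at ks n \<and> vs ! n \<in> B) \<or>
         (collider_at ks n \<and> DE G (vs ! n) \<inter> B = {})))"

definition m_separated :: "'v mixed_graph \<Rightarrow> 'v set \<Rightarrow> 'v set \<Rightarrow> 'v set \<Rightarrow> bool" where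
  "m_separated G A C B \<longleftrightarrow>
     (\<forall>vs ks. is_path G vs ks \<and> hd vs \<in> A \<and> last vs \<in> C \<longrightarrow> blocked G vs ks B)"

section \<open>Conditional independence and faithfulness\<close>

definition cond_indep_algebras ::
  "'a measure \<Rightarrow> 'a measure \<Rightarrow> 'a measure \<Rightarrow> 'a measure \<Rightarrow> bool" where
  "cond_indep_algebras M F G H \<longleftrightarrow>
     (\<forall>X\<in>sets F. \<forall>Y\<in>sets G. AE \<omega> in M.
        real_cond_exp M H (indicator (X \<inter> Y)) \<omega> =
        real_cond_exp M H (indicator X) \<omega> * real_cond_exp M H (indicator Y) \<omega>)"

definition coordinate_algebra :: "('v \<Rightarrow> real) measure \<Rightarrow> 'v set \<Rightarrow> ('v \<Rightarrow> real) measure" where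
  "coordinate_algebra \<mu> A =
     vimage_algebra (space \<mu>) (\<lambda>x. restrict x A) (\<Pi>\<^sub>M v\<in>A. (borel :: real measure))"

text \<open>\<open>cond_indep \<mu> A C B\<close>: the coordinates in \<open>A\<close> and those in \<open>C\<close> are independent given
  those in \<open>B\<close>.\<close>

definition cond_indep :: "('v \<Rightarrow> real) measure \<Rightarrow> 'v set \<Rightarrow> 'v set \<Rightarrow> 'v set \<Rightarrow> bool" where
  "cond_indep \<mu> A C B \<longleftrightarrow>
     cond_indep_algebras \<mu>
       (coordinate_algebra \<mu> A) (coordinate_algebra \<mu> C) (coordinate_algebra \<mu> B)"

definition faithful :: "('v \<Rightarrow> real) measure \<Rightarrow> 'v mixed_graph \<Rightarrow> bool" where
  "faithful \<mu> G \<longleftrightarrow>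
     (\<forall>A B C. finite A \<and> finite B \<and> finite C \<and>
        A \<subseteq> nodes G \<and> B \<subseteq> nodes G \<and> C \<subseteq> nodes G \<and>
        A \<inter> B = {} \<and> A \<inter> C = {} \<and> B \<inter> C = {} \<and>
        cond_indep \<mu> A C B \<longrightarrow> m_separated G A C B)"

section \<open>VARMA processes with instantaneous effects\<close>

text \<open>Components are numbered \<open>0, \<dots>, d - 1\<close>. The coefficients are \<open>A 0, \<dots>, A p\<close> and
  \<open>B 1, \<dots>, B q\<close>; the values of \<open>A\<close> and \<open>B\<close> at other indices are irrelevant.\<close>

definition varma_coeffs ::
  "nat \<Rightarrow> nat \<Rightarrow> nat \<Rightarrow> (nat \<Rightarrow> real mat) \<Rightarrow> (nat \<Rightarrow> real mat) \<Rightarrow> bool" where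
  "varma_coeffs d p q A B \<longleftrightarrow>
     (\<forall>k\<le>p. A k \<in> carrier_mat d d) \<and> (\<forall>l\<in>{1..q}. B l \<in> carrier_mat d d) \<and>
     (\<forall>i<d. \<forall>j<d. i \<le> j \<longrightarrow> A 0 $$ (i, j) = 0)"

definition root_condition :: "nat \<Rightarrow> nat \<Rightarrow> (nat \<Rightarrow> real mat) \<Rightarrow> bool" where
  "root_condition d p A \<longleftrightarrow>
     (\<forall>z::complex.
        Determinant.det (Matrix.mat d d (\<lambda>(i, j).
          complex_of_real ((1\<^sub>m d - A 0) $$ (i, j)) * z ^ p
          - (\<Sum>k=1..p. complex_of_real (A k $$ (i, j)) * z ^ (p - k)))) = 0
        \<longrightarrow> cmod z < 1)"

definition normal_diag :: "nat \<Rightarrow> (nat \<Rightarrow> real) \<Rightarrow> (nat \<Rightarrow> real) measure" where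
  "normal_diag d s2 = (\<Pi>\<^sub>M i\<in>{..<d}. density lborel (normal_density 0 (sqrt (s2 i))))"

definition path_law ::
  "nat \<Rightarrow> 'w measure \<Rightarrow> (int \<Rightarrow> nat \<Rightarrow> 'w \<Rightarrow> real) \<Rightarrow> (int \<times> nat \<Rightarrow> real) measure" where
  "path_law d M S =
     distr M (\<Pi>\<^sub>M v\<in>UNIV \<times> {..<d}. borel) (\<lambda>\<omega>. \<lambda>(t, i)\<in>UNIV \<times> {..<d}. S t i \<omega>)"

text \<open>\<open>S\<close> is a (strictly) stationary solution of the VARMA equations on the probability space \<open>M\<close>,
  driven by the i.i.d. Gaussian innovations \<open>\<epsilon>\<close>; \<open>s2 i\<close> is the variance of \<open>\<epsilon> t i\<close>.\<close>

definition stationary_varma ::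
  "nat \<Rightarrow> nat \<Rightarrow> nat \<Rightarrow> (nat \<Rightarrow> real mat) \<Rightarrow> (nat \<Rightarrow> real mat) \<Rightarrow> (nat \<Rightarrow> real) \<Rightarrow>
   'w measure \<Rightarrow> (int \<Rightarrow> nat \<Rightarrow> 'w \<Rightarrow> real) \<Rightarrow> (int \<Rightarrow> nat \<Rightarrow> 'w \<Rightarrow> real) \<Rightarrow> bool" where
  "stationary_varma d p q A B s2 M \<epsilon> S \<longleftrightarrow>
     prob_space M \<and>
     prob_space.indep_vars M (\<lambda>_. \<Pi>\<^sub>M i\<in>{..<d}. borel) (\<lambda>t \<omega>. \<lambda>i\<in>{..<d}. \<epsilon> t i \<omega>) UNIV \<and>
     (\<forall>t. distr M (\<Pi>\<^sub>M i\<in>{..<d}. borel) (\<lambda>\<omega>. \<lambda>i\<in>{..<d}. \<epsilon> t i \<omega>) = normal_diag d s2) \<and>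
     (\<forall>t. \<forall>i<d. S t i \<in> borel_measurable M) \<and>
     (\<forall>h. path_law d M (\<lambda>t. S (t + h)) = path_law d M S) \<and>
     (\<forall>t. \<forall>i<d. AE \<omega> in M.
        S t i \<omega> = (\<Sum>k\<le>p. \<Sum>j<d. A k $$ (i, j) * S (t - int k) j \<omega>)
          + \<epsilon> t i \<omega> + (\<Sum>l=1..q. \<Sum>j<d. B l $$ (i, j) * \<epsilon> (t - int l) j \<omega>))"

section \<open>The full-time graphs\<close>

datatype full_node = Endo int nat | Innov int nat

definition full_edges ::
  "nat \<Rightarrow> nat \<Rightarrow> nat \<Rightarrow> (nat \<Rightarrow> real mat) \<Rightarrow> (nat \<Rightarrow> real mat) \<Rightarrow> (full_node \<times> full_node) set" where
  "full_edges d p q A B =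
     {(Endo (t - int k) j, Endo t i) | t k i j. k \<le> p \<and> i < d \<and> j < d \<and> A k $$ (i, j) \<noteq> 0} \<union>
     {(Innov (t - int l) j, Endo t i) | t l i j.
        1 \<le> l \<and> l \<le> q \<and> i < d \<and> j < d \<and> B l $$ (i, j) \<noteq> 0} \<union>
     {(Innov t i, Endo t i) | t i. i < d}"

text \<open>The latent projection of the full-time DAG onto the endogenous nodes, with \<open>(t, i)\<close>
  standing for \<open>Endo t i\<close>. Innovations have no parents, so marginalizing them creates
  no new directed edges and a bi-directed edge exactly between their distinct common children.\<close>

definition full_time_admg ::
  "nat \<Rightarrow> nat \<Rightarrow> nat \<Rightarrow> (nat \<Rightarrow> real mat) \<Rightarrow> (nat \<Rightarrow> real mat) \<Rightarrow> (int \<times> nat) mixed_graph" where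
  "full_time_admg d p q A B =
     \<lparr> nodes = UNIV \<times> {..<d},
       directed = {((s, j), (t, i)) | s j t i. (Endo s j, Endo t i) \<in> full_edges d p q A B},
       bidirected = {((s, j), (t, i)) | s j t i. (s, j) \<noteq> (t, i) \<and>
         (\<exists>r m. (Innov r m, Endo s j) \<in> full_edges d p q A B \<and>
                (Innov r m, Endo t i) \<in> full_edges d p q A B)} \<rparr>"

section \<open>The parameter space\<close>

definition vec_entries :: "real mat \<Rightarrow> real list" where
  "vec_entries M = concat (map (\<lambda>j. map (\<lambda>i. M $$ (i, j)) [0..<dim_row M]) [0..<dim_col M])"

definition vech_entries :: "real mat \<Rightarrow> real list" where
  "vech_entries M = concat (map (\<lambda>j. map (\<lambda>i. M $$ (i, j)) [Suc j..<dim_row M]) [0..<dim_col M])"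

definition hconcat :: "nat \<Rightarrow> real mat list \<Rightarrow> real mat" where
  "hconcat d Ms = Matrix.mat d (d * length Ms) (\<lambda>(i, j). (Ms ! (j div d)) $$ (i, j mod d))"

definition param_dim :: "nat \<Rightarrow> nat \<Rightarrow> nat \<Rightarrow> nat" where
  "param_dim d p q = (p + q) * d\<^sup>2 + d * (d - 1) div 2"

text \<open>A vector in \<open>\<real>\<^sup>n\<close> is an extensional function on \<open>{..<n}\<close>, i.e. an element of
  \<open>{..<n} \<rightarrow>\<^sub>E UNIV\<close>.\<close>

definition coeff_vector ::
  "nat \<Rightarrow> nat \<Rightarrow> nat \<Rightarrow> (nat \<Rightarrow> real mat) \<Rightarrow> (nat \<Rightarrow> real mat) \<Rightarrow> nat \<Rightarrow> real" where
  "coeff_vector d p q A B =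
     (\<lambda>n\<in>{..<param_dim d p q}.
        (vech_entries (A 0) @ vec_entries (hconcat d (map A [1..<Suc p] @ map B [1..<Suc q]))) ! n)"

definition coeff_domain :: "nat \<Rightarrow> nat \<Rightarrow> nat \<Rightarrow> (nat \<Rightarrow> real) set" where
  "coeff_domain d p q =
     {coeff_vector d p q A B | A B. varma_coeffs d p q A B \<and> root_condition d p A}"

definition coeff_domain_interior :: "nat \<Rightarrow> nat \<Rightarrow> nat \<Rightarrow> (nat \<Rightarrow> real) set" where
  "coeff_domain_interior d p q =
     product_topology (\<lambda>_. euclideanreal) {..<param_dim d p q} interior_of coeff_domain d p q"

text \<open>Lebesgue measure on the set of pairs of a coefficient vector in the interior
  of the domain and a vector of positive variances.\<close>

definition param_lebesgue ::
  "nat \<Rightarrow> nat \<Rightarrow> nat \<Rightarrow> ((nat \<Rightarrow> real) \<times> (nat \<Rightarrow> real)) measure" where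
  "param_lebesgue d p q =
     restrict_space ((\<Pi>\<^sub>M n\<in>{..<param_dim d p q}. lborel) \<Otimes>\<^sub>M (\<Pi>\<^sub>M i\<in>{..<d}. lborel))
       (coeff_domain_interior d p q \<times> ({..<d} \<rightarrow>\<^sub>E {0<..}))"

end

theory Submission
  imports Defs "Jordan_Normal_Form.Spectral_Radius" "Jordan_Normal_Form.Jordan_Normal_Form_Existence"
begin

text \<open>In companion form the stationary solution is a linear filter of the innovations with geometrically
  decaying coefficients, and its state covariance solves a Lyapunov equation. By Cramer's rule every minor
  of the covariance matrix is, up to a nonvanishing factor, polynomial in the parameters. If \<open>A\<close> and \<open>C\<close>
  are independent given \<open>B\<close>, the minor with rows \<open>{c} \<union> B\<close> and columns \<open>{a} \<union> B\<close> vanishes for all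
  \<open>a \<in> A\<close> and \<open>c \<in> C\<close>. There are only countably many triples \<open>(a, c, B)\<close> and a nonzero polynomial has a
  null set of zeros, so it suffices to find, whenever some path from \<open>a\<close> to \<open>c\<close> can be open given \<open>B\<close>, a single
  parameter at which the minor is not zero.

  For \<open>p, q \<ge> 1\<close> this is possible for all \<open>B\<close>. For \<open>p = 0\<close> an open path forces every \<open>q\<close> consecutive times
  between \<open>a\<close> and \<open>c\<close> to meet \<open>B\<close>, and for \<open>q = 0\<close> it forces every \<open>p\<close> consecutive times to contain a
  node outside \<open>B\<close>. The parameters are chosen such that the covariance matrix (respectively, for \<open>q = 0\<close>, the
  precision matrix) is a diagonally dominant Z-matrix, and the maximum principle for Z-matrices along a
  chain of nodes from \<open>a\<close> to \<open>c\<close> shows that the minor is not zero.\<close>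

subsection \<open>Polynomial functions\<close>

text \<open>The graph depends on the sampled coefficients, so the relevant triples cannot be read
  off it. What an open path provides is therefore weakened to \<open>linked\<close>, which mentions
  only \<open>p\<close>, \<open>q\<close> and the positions of the nodes: whatever the coefficients,
  directed edges span at most \<open>p\<close> and bi-directed edges at most \<open>q\<close> time
  steps. The restriction cannot be avoided, since elsewhere the minor is identically zero. With
  \<open>p = 0\<close> covariances vanish beyond lag \<open>q\<close>, so a stretch of
  \<open>q\<close> times free of \<open>B\<close> decouples both sides; with \<open>q = 0\<close>
  the process is Markov of order \<open>p\<close>, so \<open>p\<close> consecutive times entirely in
  \<open>B\<close> do.

  A minor whose row and column sets differ has no definite sign in general. The witnesses are
  designed backwards: moving average coefficients or a precision matrix with the wanted signs are
  prescribed, and \<open>A\<close> and \<open>B\<close> are solved for.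

  The law of the process is reached through characteristic functions, because the solution is only
  known to be strictly stationary.\<close>

inductive polyfun :: "(('i \<Rightarrow> real) \<Rightarrow> real) \<Rightarrow> bool" where
  const: "polyfun (\<lambda>x. c)"
| coord: "polyfun (\<lambda>x. x i)"
| add: "polyfun f \<Longrightarrow> polyfun g \<Longrightarrow> polyfun (\<lambda>x. f x + g x)"
| mult: "polyfun f \<Longrightarrow> polyfun g \<Longrightarrow> polyfun (\<lambda>x. f x * g x)"

lemma polyfun_uminus: "polyfun f \<Longrightarrow> polyfun (\<lambda>x. - f x)"
  using polyfun.mult[OF polyfun.const[of "-1"], of f] by simp

lemma polyfun_diff: "polyfun f \<Longrightarrow> polyfun g \<Longrightarrow> polyfun (\<lambda>x. f x - g x)"
  using polyfun.add[OF _ polyfun_uminus, of f g] by simp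

lemma polyfun_sum: "(\<And>a. a \<in> A \<Longrightarrow> polyfun (f a)) \<Longrightarrow> polyfun (\<lambda>x. \<Sum>a\<in>A. f a x)"
  by (induction A rule: infinite_finite_induct)
    (simp_all add: polyfun.const polyfun.add polyfun.mult)

lemma polyfun_prod: "(\<And>a. a \<in> A \<Longrightarrow> polyfun (f a)) \<Longrightarrow> polyfun (\<lambda>x. \<Prod>a\<in>A. f a x)"
  by (induction A rule: infinite_finite_induct)
    (simp_all add: polyfun.const polyfun.add polyfun.mult)

lemma polyfun_det:
  assumes "\<And>i j. i < n \<Longrightarrow> j < n \<Longrightarrow> polyfun (\<lambda>x. f x i j)"
  shows "polyfun (\<lambda>x. Determinant.det (Matrix.mat n n (\<lambda>(i, j). f x i j)))"
proof -
  have less: "\<pi> i < n" if "\<pi> permutes {0..<n}" "i < n" for \<pi> and i :: nat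
    using permutes_in_image[OF that(1), of i] that(2) by simp
  have eq: "Determinant.det (Matrix.mat n n (\<lambda>(i, j). f x i j)) =
      (\<Sum>\<pi> | \<pi> permutes {0..<n}. signof \<pi> * (\<Prod>i = 0..<n. f x i (\<pi> i)))" for x
    by (auto simp: Determinant.det_def less intro!: sum.cong prod.cong)
  show ?thesis
    unfolding eq using assms less
    by (intro polyfun_sum polyfun.mult polyfun.const polyfun_prod) auto
qed

lemma polyfun_upd: "polyfun f \<Longrightarrow> polyfun (\<lambda>x. f (x(i := c)))"
proof (induction rule: polyfun.induct)
  case (coord j)
  then show ?case by (cases "j = i") (simp_all add: polyfun.const polyfun.coord)
qed (simp_all add: polyfun.const polyfun.add polyfun.mult)

text \<open>On a line parallel to an axis only finitely many zeros remain unless the section is the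
  zero polynomial; this is how algebra enters the Fubini argument below.\<close>

lemma polyfun_poly: "polyfun f \<Longrightarrow> \<exists>P. \<forall>y. f (x(i := y)) = poly P y"
proof (induction rule: polyfun.induct)
  case (const c)
  then show ?case by (intro exI[of _ "[:c:]"]) simp
next
  case (coord j)
  then show ?case
    by (cases "j = i") (auto intro: exI[of _ "[:0, 1:]"] exI[of _ "[:x j:]"])
next
  case (add f g)
  then obtain P Q where "\<forall>y. f (x(i := y)) = poly P y" "\<forall>y. g (x(i := y)) = poly Q y" by blast
  then show ?case by (intro exI[of _ "P + Q"]) (simp del: fun_upd_apply)
next
  case (mult f g)
  then obtain P Q where "\<forall>y. f (x(i := y)) = poly P y" "\<forall>y. g (x(i := y)) = poly Q y" by blast
  then show ?case by (intro exI[of _ "P * Q"]) (simp del: fun_upd_apply)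
qed

lemma polyfun_case_sum:
  "polyfun g \<Longrightarrow> polyfun (\<lambda>x. g (case_sum x y)) \<and> polyfun (\<lambda>y. g (case_sum x y))"
proof (induction rule: polyfun.induct)
  case (coord j)
  then show ?case by (cases j) (simp_all add: polyfun.const polyfun.coord)
qed (simp_all add: polyfun.const polyfun.add polyfun.mult)

section \<open>Zero sets of polynomial functions are null sets\<close>

lemma measurable_coordinate:
  "(\<lambda>x. x i) \<in> borel_measurable (\<Pi>\<^sub>M j\<in>I. (lborel :: real measure))"
proof (cases "i \<in> I")
  case True
  from measurable_component_singleton[OF this, of "\<lambda>_. lborel :: real measure"]
  show ?thesis 
    by (simp add: measurable_cong_sets[OF refl sets_lborel])
next
  case False
  \<comment> \<open>Points of the product space are extensional, so a coordinate outside
    \<open>I\<close> is constantly \<open>undefined\<close>.\<close>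
  then have "(\<lambda>x. x i) \<in> borel_measurable (\<Pi>\<^sub>M j\<in>I. (lborel :: real measure)) \<longleftrightarrow>
     (\<lambda>x. undefined :: real) \<in> borel_measurable (\<Pi>\<^sub>M j\<in>I. (lborel :: real measure))"
    by (intro measurable_cong) (auto simp: space_PiM PiE_def extensional_def)
  then show ?thesis by simp
qed

lemma polyfun_measurable:
  "polyfun f \<Longrightarrow> f \<in> borel_measurable (\<Pi>\<^sub>M j\<in>I. (lborel :: real measure))"
  by (induction rule: polyfun.induct)
    (simp_all add: measurable_coordinate borel_measurable_add borel_measurable_times)

lemma polyfun_pair_measurable:
  "polyfun g \<Longrightarrow> (\<lambda>z. g (case_sum (fst z) (snd z))) \<in>
     borel_measurable ((\<Pi>\<^sub>M j\<in>I. (lborel :: real measure)) \<Otimes>\<^sub>M (\<Pi>\<^sub>M j\<in>J. (lborel :: real measure)))"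
proof (induction rule: polyfun.induct)
  case (coord j)
  show ?case
  proof (cases j)
    case (Inl i)
    then show ?thesis by (simp only: sum.case) (rule measurable_compose[OF measurable_fst measurable_coordinate])
  next
    case (Inr i)
    then show ?thesis by (simp only: sum.case) (rule measurable_compose[OF measurable_snd measurable_coordinate])
  qed
qed (simp_all add: borel_measurable_add borel_measurable_times)

text \<open>Fubini, one coordinate at a time. Freezing coordinate \<open>i\<close> at its value in
  \<open>x0\<close> leaves a polynomial function of the others that is not identically zero; hence
  for almost every \<open>x\<close> the section in direction \<open>i\<close> is a nonzero
  univariate polynomial and has finitely many roots.\<close>

lemma polyfun_AE_nonzero:
  fixes f :: "('i \<Rightarrow> real) \<Rightarrow> real"
  assumes "finite I" "polyfun f" "x0 \<in> extensional I" "f x0 \<noteq> 0"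
  shows "AE x in (\<Pi>\<^sub>M j\<in>I. lborel). f x \<noteq> 0"
  using assms
proof (induction I arbitrary: f x0 rule: finite_induct)
  case empty
  then have "x0 = (\<lambda>_. undefined)" by (auto simp: extensional_def)
  with empty show ?case by (intro AE_I2) (auto simp: space_PiM_empty)
next
  case (insert i I)
  interpret product_sigma_finite "\<lambda>_ :: 'i. (lborel :: real measure)" by standard
  note [measurable] = polyfun_measurable[OF insert.prems(1)]
  have AEI: "AE x in (\<Pi>\<^sub>M j\<in>I. lborel). f (x(i := x0 i)) \<noteq> 0"
  proof (rule insert.IH[OF polyfun_upd[OF insert.prems(1)]])
    \<comment> \<open>Erasing coordinate \<open>i\<close> makes \<open>x0\<close> a point of the
      smaller space; the update with \<open>x0 i\<close> restores it.\<close>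
    show "x0(i := undefined) \<in> extensional I"
      using insert.prems(2) by (auto simp: extensional_def)
    show "f ((x0(i := undefined))(i := x0 i)) \<noteq> 0" using insert.prems(3) by simp
  qed
  let ?Z = "\<lambda>x. indicator {x. f x = 0} x :: ennreal"
  have [measurable]: "?Z \<in> borel_measurable (\<Pi>\<^sub>M j\<in>insert i I. lborel)"
    by measurable
  have "(\<integral>\<^sup>+ x. ?Z x \<partial>(\<Pi>\<^sub>M j\<in>insert i I. lborel)) =
     (\<integral>\<^sup>+ x. (\<integral>\<^sup>+ y. ?Z (x(i := y)) \<partial>lborel) \<partial>(\<Pi>\<^sub>M j\<in>I. lborel))"
    by (rule product_nn_integral_insert) (use insert.hyps in auto)
  also have "\<dots> = (\<integral>\<^sup>+ x. 0 \<partial>(\<Pi>\<^sub>M j\<in>I. (lborel :: real measure)))"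
  proof (rule nn_integral_cong_AE, use AEI in eventually_elim)
    fix x assume x: "f (x(i := x0 i)) \<noteq> 0"
    obtain P where P: "\<And>y. f (x(i := y)) = poly P y"
      using polyfun_poly[OF insert.prems(1)] by blast
    have "P \<noteq> 0" using P x by auto
    then have fin: "finite {y. poly P y = 0}" by (rule poly_roots_finite)
    have "(\<integral>\<^sup>+ y. ?Z (x(i := y)) \<partial>lborel) = (\<integral>\<^sup>+ y. indicator {y. poly P y = 0} y \<partial>lborel)"
      by (auto simp: P indicator_def intro!: nn_integral_cong)
    also have "\<dots> = emeasure lborel {y. poly P y = 0}"
      using fin by (intro nn_integral_indicator) (auto intro: borel_closed finite_imp_closed)
    also have "\<dots> = 0" using fin by (simp add: emeasure_lborel_countable countable_finite)
    finally show "(\<integral>\<^sup>+ y. ?Z (x(i := y)) \<partial>lborel) = 0" .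
  qed
  finally have "(\<integral>\<^sup>+ x. ?Z x \<partial>(\<Pi>\<^sub>M j\<in>insert i I. lborel)) = 0" by simp
  then show ?case
    by (subst (asm) nn_integral_0_iff_AE) (auto elim!: eventually_mono simp: indicator_def split: if_splits)
qed

text \<open>Coefficients and variances are two factors of the parameter measure;
  \<open>case_sum\<close> glues them into one index set, so that a single notion of polynomial
  function serves for both.\<close>

lemma polyfun_pair_AE_nonzero:
  fixes g :: "('i + 'j \<Rightarrow> real) \<Rightarrow> real"
  assumes "finite I" "finite J" "polyfun g" "x0 \<in> extensional I" "y0 \<in> extensional J"
    "g (case_sum x0 y0) \<noteq> 0"
  shows "AE z in (\<Pi>\<^sub>M j\<in>I. lborel) \<Otimes>\<^sub>M (\<Pi>\<^sub>M j\<in>J. lborel). g (case_sum (fst z) (snd z)) \<noteq> 0"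
proof -
  interpret I: product_sigma_finite "\<lambda>_ :: 'i. (lborel :: real measure)" by standard
  interpret J: product_sigma_finite "\<lambda>_ :: 'j. (lborel :: real measure)" by standard
  interpret J': sigma_finite_measure "\<Pi>\<^sub>M j\<in>J. (lborel :: real measure)"
    by (rule J.sigma_finite) fact
  interpret I': sigma_finite_measure "\<Pi>\<^sub>M j\<in>I. (lborel :: real measure)"
    by (rule I.sigma_finite) fact
  interpret IJ: pair_sigma_finite "\<Pi>\<^sub>M j\<in>I. (lborel :: real measure)"
    "\<Pi>\<^sub>M j\<in>J. (lborel :: real measure)" ..
  note [measurable] = polyfun_pair_measurable[OF assms(3)]
  have "AE x in (\<Pi>\<^sub>M j\<in>I. lborel). g (case_sum x y0) \<noteq> 0"
    using polyfun_AE_nonzero[OF assms(1) _ assms(4)] polyfun_case_sum[OF assms(3)] assms(6) by blast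
  then have "AE x in (\<Pi>\<^sub>M j\<in>I. lborel). AE y in (\<Pi>\<^sub>M j\<in>J. lborel). g (case_sum x y) \<noteq> 0"
  proof eventually_elim
    case (elim x)
    then show ?case
      using polyfun_AE_nonzero[OF assms(2) _ assms(5)] polyfun_case_sum[OF assms(3)] by blast
  qed
  then show ?thesis
    by (intro IJ.AE_pair_measure) simp_all
qed

subsection \<open>Conditional independence of Gaussian vectors\<close>

text \<open>In other words, \<open>W\<close> has conditional expectation zero given
  \<open>Y\<close>. The positive and the negative part of \<open>W\<close>, normalized, are
  densities whose images under \<open>Y\<close> have the same characteristic function and hence
  coincide by Levy's uniqueness theorem.\<close>

lemma (in prob_space) weight_vanishes_real:
  fixes W Y :: "'a \<Rightarrow> real"
  assumes W: "integrable M W" and Y[measurable]: "Y \<in> borel_measurable M"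
    and eq0: "\<And>t. (CLINT \<omega>|M. complex_of_real (W \<omega>) * iexp (t * Y \<omega>)) = 0"
    and E[measurable]: "E \<in> sets borel"
  shows "(\<integral>\<omega>. W \<omega> * indicator E (Y \<omega>) \<partial>M) = 0"
proof -
  have [measurable]: "W \<in> borel_measurable M" using W by simp
  define Wp Wm where "Wp = (\<lambda>\<omega>. max (W \<omega>) 0)" and "Wm = (\<lambda>\<omega>. max (- W \<omega>) 0)"
  have W_eq: "W \<omega> = Wp \<omega> - Wm \<omega>" for \<omega> by (auto simp: Wp_def Wm_def max_def)
  have int: "integrable M Wp" "integrable M Wm"
    using W by (auto simp: Wp_def Wm_def intro!: integrable_max)
  have pos: "Wp \<omega> \<ge> 0" "Wm \<omega> \<ge> 0" for \<omega> by (auto simp: Wp_def Wm_def)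
  have [measurable]: "Wp \<in> borel_measurable M" "Wm \<in> borel_measurable M" using int by simp_all
  \<comment> \<open>The case \<open>t = 0\<close>: both parts have the same mass, so one constant
    \<open>c\<close> normalizes both.\<close>
  have "complex_of_real (integral\<^sup>L M W) = 0" using eq0[of 0] by simp
  then have "integral\<^sup>L M W = 0" by simp
  then have c_eq: "integral\<^sup>L M Wp = integral\<^sup>L M Wm"
    using int by (simp add: W_eq[abs_def])
  define c where "c = integral\<^sup>L M Wp"
  have "c \<ge> 0" unfolding c_def by (intro integral_nonneg_AE) (use pos in auto)
  have int_iexp: "integrable M (\<lambda>\<omega>. complex_of_real (V \<omega>) * iexp (t * Y \<omega>))"
    if "integrable M V" for V t
  proof (rule Bochner_Integration.integrable_bound[OF that])
    have [measurable]: "V \<in> borel_measurable M" using that by simp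
    show "(\<lambda>\<omega>. complex_of_real (V \<omega>) * iexp (t * Y \<omega>)) \<in> borel_measurable M" by measurable
  qed (simp add: norm_mult)
  have char_eq: "(CLINT \<omega>|M. complex_of_real (Wp \<omega>) * iexp (t * Y \<omega>)) =
      (CLINT \<omega>|M. complex_of_real (Wm \<omega>) * iexp (t * Y \<omega>))" for t
    using eq0[of t] int_iexp[OF int(1), of t] int_iexp[OF int(2), of t]
    by (simp add: W_eq left_diff_distrib)
  have int_ind: "integrable M (\<lambda>\<omega>. V \<omega> * indicator E (Y \<omega>))" if "integrable M V" for V :: "'a \<Rightarrow> real"
  proof (rule Bochner_Integration.integrable_bound[OF that])
    have [measurable]: "V \<in> borel_measurable M" using that by simp
    show "(\<lambda>\<omega>. V \<omega> * indicator E (Y \<omega>)) \<in> borel_measurable M" by measurable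
  qed (simp add: indicator_def)
  have "(\<integral>\<omega>. Wp \<omega> * indicator E (Y \<omega>) \<partial>M) = (\<integral>\<omega>. Wm \<omega> * indicator E (Y \<omega>) \<partial>M)"
  proof (cases "c = 0")
    case True
    have "AE \<omega> in M. Wp \<omega> = 0" "AE \<omega> in M. Wm \<omega> = 0"
      using integral_nonneg_eq_0_iff_AE[OF int(1)] integral_nonneg_eq_0_iff_AE[OF int(2)]
        True pos c_eq unfolding c_def by auto
    then have "AE \<omega> in M. Wp \<omega> * indicator E (Y \<omega>) = Wm \<omega> * indicator E (Y \<omega>)"
      by eventually_elim simp
    then show ?thesis by (intro integral_cong_AE) auto
  next
    case False
    then have "c > 0" using \<open>c \<ge> 0\<close> by simp
    define D where "D = (\<lambda>V. distr (density M (\<lambda>\<omega>. ennreal (V \<omega> / c))) borel Y)"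
    have D: "real_distribution (D V)"
        "\<And>t. char (D V) t = (CLINT \<omega>|M. complex_of_real (V \<omega>) * iexp (t * Y \<omega>)) / c"
        "measure (D V) E = (\<integral>\<omega>. V \<omega> * indicator E (Y \<omega>) \<partial>M) / c"
      if V: "integrable M V" "integral\<^sup>L M V = c" "\<And>\<omega>. V \<omega> \<ge> 0" for V
    proof -
      have [measurable]: "V \<in> borel_measurable M" using V by simp
      have nn: "V \<omega> / c \<ge> 0" for \<omega> using V \<open>c > 0\<close> by simp
      have "emeasure (density M (\<lambda>\<omega>. ennreal (V \<omega> / c))) (space M) = (\<integral>\<^sup>+\<omega>. ennreal (V \<omega> / c) \<partial>M)"
        by (subst emeasure_density) (auto intro!: nn_integral_cong)
      also have "\<dots> = ennreal (integral\<^sup>L M (\<lambda>\<omega>. V \<omega> / c))"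
        by (rule nn_integral_eq_integral) (use V nn in auto)
      also have "\<dots> = 1" using V False by simp
      finally have prob: "prob_space (density M (\<lambda>\<omega>. ennreal (V \<omega> / c)))"
        by (intro prob_spaceI) simp
      have "prob_space (D V)" unfolding D_def
        by (rule prob_space.prob_space_distr[OF prob]) simp
      then show "real_distribution (D V)"
        by (intro real_distribution.intro real_distribution_axioms.intro) (auto simp: D_def)
      show "char (D V) t = (CLINT \<omega>|M. complex_of_real (V \<omega>) * iexp (t * Y \<omega>)) / c" for t
        unfolding D_def char_def
        by (subst integral_distr, simp, simp, subst integral_density)
          (use nn in \<open>simp_all add: scaleR_conv_of_real field_simps\<close>)
      have "measure (D V) E = (\<integral>x. indicator E x \<partial>D V)" by (simp add: D_def)
      also have "\<dots> = (\<integral>\<omega>. V \<omega> / c * indicator E (Y \<omega>) \<partial>M)"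
        unfolding D_def by (subst integral_distr, simp, simp, subst integral_density)
          (use nn in simp_all)
      finally show "measure (D V) E = (\<integral>\<omega>. V \<omega> * indicator E (Y \<omega>) \<partial>M) / c" by simp
    qed
    note Dp = D[OF int(1) c_def[symmetric] pos(1)]
    note Dm = D[OF int(2) _ pos(2), unfolded c_eq[symmetric], OF c_def[symmetric]]
    have "D Wp = D Wm"
      by (rule Levy_uniqueness[OF Dp(1) Dm(1)]) (rule ext, simp only: Dp(2) Dm(2) char_eq)
    then show ?thesis using Dp(3) Dm(3) False by simp
  qed
  then show ?thesis
    using int_ind[OF int(1)] int_ind[OF int(2)] by (simp add: W_eq left_diff_distrib)
qed

text \<open>Complex weights arise when exponentials of further coordinates are absorbed into the
  weight. Conjugating the hypothesis at \<open>- t\<close> gives it for \<open>cnj W\<close>, and so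
  for the real and the imaginary part.\<close>

lemma (in prob_space) weight_vanishes_complex:
  fixes W :: "'a \<Rightarrow> complex" and Y :: "'a \<Rightarrow> real"
  assumes W: "integrable M W" and Y[measurable]: "Y \<in> borel_measurable M"
    and eq0: "\<And>t. (CLINT \<omega>|M. W \<omega> * iexp (t * Y \<omega>)) = 0"
    and E[measurable]: "E \<in> sets borel"
  shows "(CLINT \<omega>|M. W \<omega> * indicator E (Y \<omega>)) = 0"
proof -
  have [measurable]: "W \<in> borel_measurable M" using W by simp
  have int1: "integrable M (\<lambda>\<omega>. W \<omega> * iexp (t * Y \<omega>))" for t
    by (rule Bochner_Integration.integrable_bound[OF W]) (simp_all add: norm_mult)
  have "integrable M (\<lambda>\<omega>. cnj (W \<omega>))" using W by simp
  then have [measurable]: "(\<lambda>\<omega>. cnj (W \<omega>)) \<in> borel_measurable M"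
    by (rule borel_measurable_integrable)
  have int2: "integrable M (\<lambda>\<omega>. cnj (W \<omega>) * iexp (t * Y \<omega>))" for t
    by (rule Bochner_Integration.integrable_bound[OF W]) (simp_all add: norm_mult)
  have eq0': "(CLINT \<omega>|M. cnj (W \<omega>) * iexp (t * Y \<omega>)) = 0" for t
  proof -
    have "(CLINT \<omega>|M. cnj (W \<omega>) * iexp (t * Y \<omega>)) = (CLINT \<omega>|M. cnj (W \<omega> * iexp (- t * Y \<omega>)))"
      by (simp add: exp_cnj)
    also have "\<dots> = cnj (CLINT \<omega>|M. W \<omega> * iexp (- t * Y \<omega>))" by (rule Bochner_Integration.integral_cnj)
    finally show ?thesis using eq0[of "- t"] by simp
  qed
  have ReW: "complex_of_real (Re (W \<omega>)) = (W \<omega> + cnj (W \<omega>)) / 2"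
    and ImW: "complex_of_real (Im (W \<omega>)) = (W \<omega> - cnj (W \<omega>)) / (2 * \<i>)" for \<omega>
    by (simp_all add: complex_add_cnj complex_diff_cnj complex_eq_iff)
  have "(CLINT \<omega>|M. complex_of_real (Re (W \<omega>)) * iexp (t * Y \<omega>)) = 0" for t
  proof -
    have "(CLINT \<omega>|M. complex_of_real (Re (W \<omega>)) * iexp (t * Y \<omega>)) =
        (CLINT \<omega>|M. (W \<omega> * iexp (t * Y \<omega>) + cnj (W \<omega>) * iexp (t * Y \<omega>)) / 2)"
      unfolding ReW by (simp only: distrib_right times_divide_eq_left)
    then show ?thesis
      by (simp only: integral_divide_zero Bochner_Integration.integral_add[OF int1 int2] eq0 eq0') simp
  qed
  from weight_vanishes_real[OF integrable_Re[OF W] Y this E]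
  have r: "(\<integral>\<omega>. Re (W \<omega>) * indicator E (Y \<omega>) \<partial>M) = 0" .
  have "(CLINT \<omega>|M. complex_of_real (Im (W \<omega>)) * iexp (t * Y \<omega>)) = 0" for t
  proof -
    have "(CLINT \<omega>|M. complex_of_real (Im (W \<omega>)) * iexp (t * Y \<omega>)) =
        (CLINT \<omega>|M. (W \<omega> * iexp (t * Y \<omega>) - cnj (W \<omega>) * iexp (t * Y \<omega>)) / (2 * \<i>))"
      unfolding ImW by (simp only: left_diff_distrib times_divide_eq_left)
    then show ?thesis
      by (simp only: integral_divide_zero Bochner_Integration.integral_diff[OF int1 int2] eq0 eq0') simp
  qed
  from weight_vanishes_real[OF integrable_Im[OF W] Y this E]
  have i: "(\<integral>\<omega>. Im (W \<omega>) * indicator E (Y \<omega>) \<partial>M) = 0" .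
  have int: "integrable M (\<lambda>\<omega>. W \<omega> * indicator E (Y \<omega>))"
    by (rule Bochner_Integration.integrable_bound[OF W]) (simp_all add: norm_mult indicator_def)
  have "Re (W \<omega> * indicator E (Y \<omega>)) = Re (W \<omega>) * indicator E (Y \<omega>)"
    "Im (W \<omega> * indicator E (Y \<omega>)) = Im (W \<omega>) * indicator E (Y \<omega>)" for \<omega>
    by (simp_all add: indicator_def)
  then show ?thesis
    using r i integral_Re[OF int] integral_Im[OF int] by (simp add: complex_eq_iff)
qed

text \<open>One coordinate at a time: with the exponentials of the other coordinates inside the
  weight, the one-variable result trades \<open>iexp (t * Y b)\<close> for an indicator, which then
  becomes part of the weight.\<close>

lemma (in prob_space) weight_vanishes_boxes:
  fixes W :: "'a \<Rightarrow> complex" and Y :: "'b \<Rightarrow> 'a \<Rightarrow> real"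
  assumes "finite B" "integrable M W" "\<And>b. b \<in> B \<Longrightarrow> Y b \<in> borel_measurable M"
    and "\<And>\<tau>. (CLINT \<omega>|M. W \<omega> * iexp (\<Sum>b\<in>B. \<tau> b * Y b \<omega>)) = 0"
    and "\<And>b. b \<in> B \<Longrightarrow> E b \<in> sets borel"
  shows "(CLINT \<omega>|M. W \<omega> * (\<Prod>b\<in>B. indicator (E b) (Y b \<omega>))) = 0"
  using assms
proof (induction B arbitrary: W rule: finite_induct)
  case empty
  then show ?case by simp
next
  case (insert b B)
  have Y[measurable]: "Y b \<in> borel_measurable M" "\<And>b. b \<in> B \<Longrightarrow> Y b \<in> borel_measurable M"
    using insert.prems by auto
  have W[measurable]: "W \<in> borel_measurable M" using insert.prems by simp
  have E[measurable]: "E b \<in> sets borel" using insert.prems by auto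
  let ?W = "\<lambda>\<omega>. W \<omega> * indicator (E b) (Y b \<omega>)"
  have eq: "(CLINT \<omega>|M. ?W \<omega> * (\<Prod>b\<in>B. indicator (E b) (Y b \<omega>))) = 0"
  proof (rule insert.IH)
    show "integrable M ?W"
      by (rule Bochner_Integration.integrable_bound[OF insert.prems(1)])
        (simp_all add: norm_mult indicator_def)
    fix \<tau>
    let ?V = "\<lambda>\<omega>. W \<omega> * iexp (\<Sum>b\<in>B. \<tau> b * Y b \<omega>)"
    have "(CLINT \<omega>|M. ?V \<omega> * indicator (E b) (Y b \<omega>)) = 0"
    proof (rule weight_vanishes_complex)
      show "integrable M ?V"
        by (rule Bochner_Integration.integrable_bound[OF insert.prems(1)]) (simp_all add: norm_mult)
      fix t
      have *: "(\<Sum>c\<in>B. (\<tau>(b := t)) c * Y c \<omega>) = (\<Sum>c\<in>B. \<tau> c * Y c \<omega>)" for \<omega>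
        using insert.hyps by (intro sum.cong) auto
      have **: "(\<Sum>c\<in>insert b B. (\<tau>(b := t)) c * Y c \<omega>) = t * Y b \<omega> + (\<Sum>c\<in>B. \<tau> c * Y c \<omega>)" for \<omega>
        by (subst sum.insert) (use insert.hyps in \<open>simp_all only: * fun_upd_same simp_thms\<close>)
      have "(CLINT \<omega>|M. ?V \<omega> * iexp (t * Y b \<omega>)) =
          (CLINT \<omega>|M. W \<omega> * iexp (\<Sum>c\<in>insert b B. (\<tau>(b := t)) c * Y c \<omega>))"
        unfolding ** by (simp add: distrib_left exp_add mult.assoc mult.commute mult.left_commute)
      then show "(CLINT \<omega>|M. ?V \<omega> * iexp (t * Y b \<omega>)) = 0"
        using insert.prems(3)[of "\<tau>(b := t)"] by simp
    qed simp_all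
    then show "(CLINT \<omega>|M. ?W \<omega> * iexp (\<Sum>b\<in>B. \<tau> b * Y b \<omega>)) = 0"
      by (simp add: mult.assoc mult.commute mult.left_commute)
  qed (use insert.prems in auto)
  then show ?case using insert.hyps by (simp add: mult.assoc)
qed

lemma coordinate_algebra_facts:
  fixes \<mu> :: "('v \<Rightarrow> real) measure"
  assumes sets: "sets \<mu> = sets (\<Pi>\<^sub>M v\<in>V. borel)" and "A \<subseteq> V"
  shows "subalgebra \<mu> (coordinate_algebra \<mu> A)"
    and "v \<in> A \<Longrightarrow> (\<lambda>x. x v) \<in> borel_measurable (coordinate_algebra \<mu> A)"
proof -
  have m: "(\<lambda>x. restrict x A) \<in> \<mu> \<rightarrow>\<^sub>M (\<Pi>\<^sub>M v\<in>A. borel :: real measure)"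
    unfolding measurable_cong_sets[OF sets refl] by (rule measurable_restrict_subset) fact
  show "subalgebra \<mu> (coordinate_algebra \<mu> A)"
    unfolding subalgebra_def coordinate_algebra_def
    using measurable_sets[OF m] by (auto simp: sets_vimage_algebra2[OF measurable_space[OF m, THEN funcsetI[of "space \<mu>"]]] )
  assume v: "v \<in> A"
  have "(\<lambda>x. x v) \<circ> (\<lambda>x. restrict x A) \<in> borel_measurable (coordinate_algebra \<mu> A)"
    unfolding coordinate_algebra_def
    by (rule measurable_comp[OF measurable_vimage_algebra1 measurable_component_singleton])
      (use v measurable_space[OF m] in auto)
  then show "(\<lambda>x. x v) \<in> borel_measurable (coordinate_algebra \<mu> A)" using v by (simp add: o_def)
qed

text \<open>Boxes form an intersection-stable generator, and the sets over which the weight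
  integrates to zero form a Dynkin system. So a test against exponentials is enough for
  orthogonality to the whole algebra of the coordinates \<open>B\<close>.\<close>

lemma weight_vanishes_coordinate_algebra:
  fixes \<mu> :: "('v \<Rightarrow> real) measure" and W :: "('v \<Rightarrow> real) \<Rightarrow> real"
  assumes "prob_space \<mu>" and sets: "sets \<mu> = sets (\<Pi>\<^sub>M v\<in>V. borel)" and "B \<subseteq> V" "finite B"
    and W: "integrable \<mu> W"
    and eq0: "\<And>\<tau>. (CLINT x|\<mu>. complex_of_real (W x) * iexp (\<Sum>b\<in>B. \<tau> b * x b)) = 0"
    and Z: "Z \<in> sets (coordinate_algebra \<mu> B)"
  shows "(\<integral>x. indicator Z x * W x \<partial>\<mu>) = 0"
proof -
  interpret prob_space \<mu> by fact
  note ca = coordinate_algebra_facts[OF sets \<open>B \<subseteq> V\<close>]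
  have coord: "(\<lambda>x. x b) \<in> borel_measurable \<mu>" if "b \<in> B" for b
    using measurable_from_subalg[OF ca(1) ca(2)[OF that]] .
  have m: "(\<lambda>x. restrict x B) \<in> \<mu> \<rightarrow>\<^sub>M (\<Pi>\<^sub>M v\<in>B. borel :: real measure)"
    unfolding measurable_cong_sets[OF sets refl] by (rule measurable_restrict_subset) fact
  have [measurable]: "W \<in> borel_measurable \<mu>" using W by simp
  define T where "T = (\<lambda>A. (\<lambda>x. restrict x B) -` A \<inter> space \<mu>)"
  obtain A where A: "A \<in> sets (\<Pi>\<^sub>M v\<in>B. borel :: real measure)" and Z_eq: "Z = T A"
    using Z unfolding coordinate_algebra_def T_def
    by (auto simp: sets_vimage_algebra2[OF measurable_space[OF m, THEN funcsetI[of "space \<mu>"]]])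
  have T_sets: "T A \<in> sets \<mu>" if "A \<in> sets (\<Pi>\<^sub>M v\<in>B. borel :: real measure)" for A
    unfolding T_def using measurable_sets[OF m that] .
  have intT: "integrable \<mu> (\<lambda>x. indicator (T A) x * W x)"
    if "A \<in> sets (\<Pi>\<^sub>M v\<in>B. borel :: real measure)" for A
    using integrable_mult_indicator[OF T_sets[OF that] W] by simp
  let ?G = "{Pi\<^sub>E B E | E. \<forall>b\<in>B. E b \<in> sets (borel :: real measure)}"
  let ?\<Omega> = "\<Pi>\<^sub>E b\<in>B. (UNIV :: real set)"
  have sets_eq: "sets (\<Pi>\<^sub>M v\<in>B. borel :: real measure) = sigma_sets ?\<Omega> ?G"
  proof -
    have "prod_algebra B (\<lambda>_. borel :: real measure) = ?G"
      unfolding prod_algebra_eq_finite[OF \<open>finite B\<close>] by (auto simp: Pi_iff)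
    then show ?thesis by (simp add: sets_PiM)
  qed
  have box: "(\<integral>x. indicator (T (Pi\<^sub>E B E)) x * W x \<partial>\<mu>) = 0"
    if E: "\<forall>b\<in>B. E b \<in> sets (borel :: real measure)" for E
  proof -
    have "(CLINT x|\<mu>. complex_of_real (W x) * (\<Prod>b\<in>B. indicator (E b) (x b))) = 0"
      by (rule weight_vanishes_boxes[OF \<open>finite B\<close> _ coord eq0]) (use W E in auto)
    also have "(CLINT x|\<mu>. complex_of_real (W x) * (\<Prod>b\<in>B. indicator (E b) (x b))) =
       (CLINT x|\<mu>. complex_of_real (indicator (T (Pi\<^sub>E B E)) x * W x))"
    proof (rule Bochner_Integration.integral_cong[OF refl])
      fix x assume "x \<in> space \<mu>"
      then have "x \<in> T (Pi\<^sub>E B E) \<longleftrightarrow> (\<forall>b\<in>B. x b \<in> E b)" by (auto simp: T_def)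
      moreover have "(\<Prod>b\<in>B. indicator (E b) (x b) :: complex) = (if \<forall>b\<in>B. x b \<in> E b then 1 else 0)"
        using \<open>finite B\<close> by (auto simp: indicator_def)
      ultimately show "complex_of_real (W x) * (\<Prod>b\<in>B. indicator (E b) (x b)) =
         complex_of_real (indicator (T (Pi\<^sub>E B E)) x * W x)" by auto
    qed
    finally show ?thesis by (simp only: integral_complex_of_real of_real_eq_0_iff)
  qed
  have UN: "?\<Omega> \<in> ?G" by (intro CollectI exI[of _ "\<lambda>_. UNIV"]) auto
  have Tc: "indicator (T (?\<Omega> - A)) x = (indicator (T ?\<Omega>) x - indicator (T A) x :: real)"
    if "A \<subseteq> ?\<Omega>" for A x
    using that by (auto simp: T_def indicator_def)
  have sub: "B' \<subseteq> ?\<Omega>" if "B' \<in> sigma_sets ?\<Omega> ?G" for B'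
    using sigma_sets_into_sp[OF _ that] by auto
  have "Int_stable ?G" using Int_stable_PiE[of B B "\<lambda>_. borel"] by simp
  moreover have "?G \<subseteq> Pow ?\<Omega>" by auto
  moreover have "A \<in> sigma_sets ?\<Omega> ?G" using A sets_eq by simp
  ultimately have "(\<integral>x. indicator (T A) x * W x \<partial>\<mu>) = 0"
  proof (induction rule: sigma_sets_induct_disjoint)
    case (basic A)
    then show ?case using box by auto
  next
    case empty
    show ?case by (simp add: T_def)
  next
    case (compl A)
    have "?\<Omega> \<in> sets (\<Pi>\<^sub>M v\<in>B. borel :: real measure)" "A \<in> sets (\<Pi>\<^sub>M v\<in>B. borel :: real measure)"
      using UN compl sets_eq by auto
    then show ?case
      using compl box[of "\<lambda>_. UNIV"] intT Tc[OF sub[OF compl(1)]]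
      by (simp add: left_diff_distrib)
  next
    case (union F)
    have F: "F i \<in> sets (\<Pi>\<^sub>M v\<in>B. borel :: real measure)" for i
      using union sets_eq by auto
    have "(\<integral>x. indicator (T (\<Union>i. F i)) x * W x \<partial>\<mu>) = (LINT x:(\<Union>i. T (F i))|\<mu>. W x)"
      unfolding set_lebesgue_integral_def T_def by (simp add: vimage_UN)
    also have "\<dots> = (\<Sum>i. (LINT x:T (F i)|\<mu>. W x))"
    proof (rule lebesgue_integral_countable_add)
      show "T (F i) \<in> sets \<mu>" for i by (rule T_sets[OF F])
      show "T (F i) \<inter> T (F j) = {}" if "i \<noteq> j" for i j
        using union(1) that by (auto simp: T_def disjoint_family_on_def)
      show "set_integrable \<mu> (\<Union>i. T (F i)) W"
        using integrable_mult_indicator[OF sets.countable_UN W, of "\<lambda>i. T (F i)" UNIV] T_sets[OF F]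
        unfolding set_integrable_def by auto
    qed
    also have "\<dots> = 0" using union(3) by (simp add: set_lebesgue_integral_def)
    finally show ?case .
  qed
  then show ?thesis using Z_eq by simp
qed


section \<open>First moments of Gaussian vectors from characteristic functions\<close>

lemma iexp_difference_quotient:
  "(\<lambda>n. (iexp (y / real (Suc n)) - 1) * of_nat (Suc n)) \<longlonglongrightarrow> \<i> * complex_of_real y"
proof (rule Lim_transform_bound[THEN LIM_zero_cancel])
  show "(\<lambda>n. y\<^sup>2 / 2 * (1 / real (Suc n))) \<longlonglongrightarrow> 0"
    by (rule tendsto_mult_right_zero, rule LIMSEQ_Suc, rule lim_1_over_n)
  show "\<forall>\<^sub>F n in sequentially. norm ((iexp (y / real (Suc n)) - 1) * of_nat (Suc n) - \<i> * complex_of_real y)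
      \<le> norm (y\<^sup>2 / 2 * (1 / real (Suc n)))"
  proof (rule always_eventually, rule allI)
    fix n
    define N where "N = real (Suc n)"
    have N: "N > 0" by (simp add: N_def)
    have "(iexp (y / N) - 1) * of_nat (Suc n) - \<i> * complex_of_real y =
        (iexp (y / N) - (\<Sum>k\<le>1. (\<i> * complex_of_real (y / N))^k / fact k)) * complex_of_real N"
    proof -
      have alg: "(E - 1) * m - \<i> * (z * m) = (E - (1 + \<i> * z)) * m" for E m z :: complex
        by (simp add: algebra_simps)
      have "complex_of_nat (Suc n) = complex_of_real N" by (simp add: N_def)
      moreover have "complex_of_real y = complex_of_real (y / N) * complex_of_real N"
        using N by (simp only: of_real_mult[symmetric]) simp
      moreover have "(\<Sum>k\<le>1. (\<i> * z)^k / fact k) = 1 + \<i> * z" for z :: complex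
        by simp
      ultimately show ?thesis using alg by metis
    qed
    then have "norm ((iexp (y / N) - 1) * of_nat (Suc n) - \<i> * complex_of_real y) =
        norm (iexp (y / N) - (\<Sum>k\<le>1. (\<i> * complex_of_real (y / N))^k / fact k)) * N"
      using N by (simp only: norm_mult norm_of_real abs_of_pos)
    also have "\<dots> \<le> (\<bar>y / N\<bar> ^ Suc 1 / fact (Suc 1)) * N"
      by (intro mult_right_mono iexp_approx1) (use N in simp)
    also have "\<dots> = y\<^sup>2 / 2 * (1 / N)"
      using N by (simp add: power2_eq_square abs_divide field_simps flip: abs_mult)
    finally show "norm ((iexp (y / real (Suc n)) - 1) * of_nat (Suc n) - \<i> * complex_of_real y)
      \<le> norm (y\<^sup>2 / 2 * (1 / real (Suc n)))"
      by (simp add: N_def del: of_nat_Suc)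
  qed
qed

lemma norm_iexp_minus_1_le: "cmod (iexp y - 1) \<le> \<bar>y\<bar>"
  using iexp_approx1[of y 0] by simp

text \<open>Here \<open>a\<close>, \<open>b\<close> and \<open>c\<close> stand for the variance of
  \<open>e\<close>, the covariance of \<open>e\<close> with \<open>X\<close> and the variance of
  \<open>X\<close>. The formula is the derivative of the characteristic function at
  \<open>x = 0\<close>, taken along \<open>x = 1 / Suc n\<close>, with the absolute value of
  \<open>e\<close> as dominating function.\<close>

lemma (in prob_space) gaussian_first_moment:
  fixes e X :: "'a \<Rightarrow> real"
  assumes e: "integrable M e" and X[measurable]: "X \<in> borel_measurable M"
    and CF: "\<And>x. (CLINT \<omega>|M. iexp (x * e \<omega> + X \<omega>)) = complex_of_real (exp (- (x\<^sup>2 * a + 2 * x * b + c) / 2))"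
  shows "(CLINT \<omega>|M. complex_of_real (e \<omega>) * iexp (X \<omega>)) = \<i> * complex_of_real (b * exp (- c / 2))"
proof -
  have [measurable]: "e \<in> borel_measurable M" using e by simp
  define f where "f = (\<lambda>n \<omega>. (iexp (e \<omega> / real (Suc n)) - 1) * of_nat (Suc n) * iexp (X \<omega>))"
  have lim1: "(\<lambda>n. CLINT \<omega>|M. f n \<omega>) \<longlonglongrightarrow> (CLINT \<omega>|M. \<i> * complex_of_real (e \<omega>) * iexp (X \<omega>))"
  proof (rule integral_dominated_convergence)
    show "integrable M (\<lambda>\<omega>. \<bar>e \<omega>\<bar>)" using e by simp
    show "AE \<omega> in M. (\<lambda>n. f n \<omega>) \<longlonglongrightarrow> \<i> * complex_of_real (e \<omega>) * iexp (X \<omega>)"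
      unfolding f_def by (intro AE_I2 tendsto_mult iexp_difference_quotient tendsto_const)
    show "AE \<omega> in M. cmod (f n \<omega>) \<le> \<bar>e \<omega>\<bar>" for n
    proof (rule AE_I2)
      fix \<omega>
      have "cmod (f n \<omega>) = cmod (iexp (e \<omega> / real (Suc n)) - 1) * real (Suc n)"
        by (simp add: f_def norm_mult del: of_nat_Suc)
      also have "\<dots> \<le> \<bar>e \<omega> / real (Suc n)\<bar> * real (Suc n)"
        by (intro mult_right_mono norm_iexp_minus_1_le) simp
      also have "\<dots> = \<bar>e \<omega>\<bar>" by (simp add: abs_divide)
      finally show "cmod (f n \<omega>) \<le> \<bar>e \<omega>\<bar>" .
    qed
  qed (simp_all add: f_def)
  define g where "g = (\<lambda>x. exp (- (x\<^sup>2 * a + 2 * x * b + c) / 2))"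
  have f_eq: "(CLINT \<omega>|M. f n \<omega>) = complex_of_real ((g (1 / real (Suc n)) - g 0) / (1 / real (Suc n)))" for n
  proof -
    have int: "integrable M (\<lambda>\<omega>. iexp (Z \<omega>))" if [measurable]: "Z \<in> borel_measurable M" for Z
      by (rule integrable_const_bound[of _ 1]) simp_all
    have i1: "integrable M (\<lambda>\<omega>. iexp (1 / real (Suc n) * e \<omega> + X \<omega>))" by (rule int) measurable
    have i2: "integrable M (\<lambda>\<omega>. iexp (0 * e \<omega> + X \<omega>))" by (rule int) measurable
    have "(CLINT \<omega>|M. f n \<omega>) =
      (CLINT \<omega>|M. (iexp (1 / real (Suc n) * e \<omega> + X \<omega>) - iexp (0 * e \<omega> + X \<omega>)) * of_nat (Suc n))"
      unfolding f_def
      by (intro Bochner_Integration.integral_cong refl)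
        (simp add: algebra_simps exp_add del: of_nat_Suc)
    also have "\<dots> = ((CLINT \<omega>|M. iexp (1 / real (Suc n) * e \<omega> + X \<omega>)) -
       (CLINT \<omega>|M. iexp (0 * e \<omega> + X \<omega>))) * of_nat (Suc n)"
      by (simp only: integral_mult_left_zero Bochner_Integration.integral_diff[OF i1 i2])
    also have "\<dots> = complex_of_real ((g (1 / real (Suc n)) - g 0) / (1 / real (Suc n)))"
      unfolding CF g_def by (simp del: of_nat_Suc)
    finally show ?thesis .
  qed
  have "(g has_real_derivative (- b * exp (- c / 2))) (at 0)"
    unfolding g_def by (auto intro!: derivative_eq_intros)
  then have "((\<lambda>h. (g h - g 0) / h) \<longlongrightarrow> (- b * exp (- c / 2))) (at 0)"
    by (simp add: DERIV_def)
  moreover have "filterlim (\<lambda>n. 1 / real (Suc n)) (at 0) sequentially"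
    by (intro filterlim_atI LIMSEQ_Suc[OF lim_1_over_n]) (simp_all)
  ultimately have "(\<lambda>n. (g (1 / real (Suc n)) - g 0) / (1 / real (Suc n))) \<longlonglongrightarrow> - b * exp (- c / 2)"
    by (rule filterlim_compose)
  then have "(\<lambda>n. CLINT \<omega>|M. f n \<omega>) \<longlonglongrightarrow> complex_of_real (- b * exp (- c / 2))"
    unfolding f_eq by (rule tendsto_of_real)
  from LIMSEQ_unique[OF lim1 this]
  have "(CLINT \<omega>|M. \<i> * (complex_of_real (e \<omega>) * iexp (X \<omega>))) = complex_of_real (- b * exp (- c / 2))"
    by (simp add: mult.assoc)
  then have "\<i> * (CLINT \<omega>|M. complex_of_real (e \<omega>) * iexp (X \<omega>)) = \<i> * (\<i> * complex_of_real (b * exp (- c / 2)))"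
    by simp
  then show ?thesis by (subst (asm) mult_left_cancel) simp_all
qed

text \<open>By uniqueness of characteristic functions \<open>e\<close> has the law of
  \<open>sqrt a\<close> times a standard normal variable, which covers the degenerate case
  \<open>a = 0\<close> as well.\<close>

lemma (in prob_space) gaussian_integrable:
  fixes e :: "'a \<Rightarrow> real"
  assumes e[measurable]: "e \<in> borel_measurable M"
    and CF: "\<And>x. (CLINT \<omega>|M. iexp (x * e \<omega>)) = complex_of_real (exp (- (x\<^sup>2 * a) / 2))"
  shows "integrable M e"
proof -
  \<comment> \<open>A characteristic function is bounded by 1, which forces \<open>a\<close> to be
    nonnegative.\<close>
  have "cmod (CLINT \<omega>|M. iexp (1 * e \<omega>)) \<le> (\<integral>\<omega>. cmod (iexp (1 * e \<omega>)) \<partial>M)"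
    by (rule integral_norm_bound)
  then have "exp (- a / 2) \<le> 1" unfolding CF by (simp add: prob_space)
  then have a: "a \<ge> 0" by simp
  let ?N = "distr std_normal_distribution borel (\<lambda>x. sqrt a * x)"
  have std: "real_distribution std_normal_distribution"
    by (rule real_dist_normal_dist)
  interpret std: real_distribution std_normal_distribution by (rule std)
  have "distr M borel e = ?N"
  proof (rule Levy_uniqueness)
    show "real_distribution (distr M borel e)" by (rule real_distribution_distr) simp
    show "real_distribution ?N" by (rule std.real_distribution_distr) simp
    show "char (distr M borel e) = char ?N"
    proof
      fix t
      have "char ?N t = char std_normal_distribution (t * sqrt a)"
        unfolding char_def by (subst integral_distr) (simp_all add: mult.assoc)
      also have "\<dots> = complex_of_real (exp (- (t\<^sup>2 * a) / 2))"
        using a by (simp add: char_std_normal_distribution power_mult_distrib)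
      also have "\<dots> = (CLINT \<omega>|M. iexp (t * e \<omega>))" by (simp only: CF)
      also have "\<dots> = char (distr M borel e) t"
        unfolding char_def by (subst integral_distr) simp_all
      finally show "char (distr M borel e) t = char ?N t" by simp
    qed
  qed
  moreover have "integrable ?N (\<lambda>x. x)"
  proof -
    have "integrable std_normal_distribution (\<lambda>x. x)"
    proof (rule integrable_density[THEN iffD2])
      show "integrable lborel (\<lambda>x. std_normal_density x *\<^sub>R x)"
        using integrable_std_normal_moment[of 1] by (simp only: power_one_right real_scaleR_def)
      show "AE x in lborel. 0 \<le> std_normal_density x" by (intro AE_I2) simp
    qed simp_all
    then have "integrable std_normal_distribution (\<lambda>x. sqrt a * x)"
      by (rule integrable_mult_right)
    then show ?thesis
    proof (rule integrable_distr_eq[THEN iffD2, rotated 2])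
      show "(\<lambda>x. sqrt a * x) \<in> borel_measurable std_normal_distribution" by measurable
    qed measurable
  qed
  ultimately have "integrable (distr M borel e) (\<lambda>x. x)" by simp
  then show ?thesis by (rule integrable_distr_eq[THEN iffD1, rotated 2]) measurable
qed

text \<open>The combination with coefficients \<open>k\<close> acts as a residual of
  \<open>a\<close> after regression on \<open>B\<close>: it is uncorrelated with \<open>B\<close>
  and turns out to be uncorrelated with \<open>c\<close>. Taking any such combination, instead of
  the regression itself, avoids inverting a covariance matrix that may be singular.\<close>

lemma gaussian_cond_indep:
  fixes \<mu> :: "('v \<Rightarrow> real) measure" and Sg :: "'v \<Rightarrow> 'v \<Rightarrow> real"
  assumes "prob_space \<mu>" and sets: "sets \<mu> = sets (\<Pi>\<^sub>M v\<in>V. borel)"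
    and sym: "\<And>v w. v \<in> V \<Longrightarrow> w \<in> V \<Longrightarrow> Sg v w = Sg w v"
    and CF: "\<And>W l. finite W \<Longrightarrow> W \<subseteq> V \<Longrightarrow> (CLINT x|\<mu>. iexp (\<Sum>v\<in>W. l v * x v)) =
      complex_of_real (exp (- (\<Sum>v\<in>W. \<Sum>w\<in>W. l v * l w * Sg v w) / 2))"
    and ci: "cond_indep \<mu> A C B"
    and sub: "A \<subseteq> V" "B \<subseteq> V" "C \<subseteq> V" and fin: "finite B"
    and a: "a \<in> A" and c: "c \<in> C"
    and k: "\<And>b. b \<in> B \<Longrightarrow> (\<Sum>v\<in>insert a B. k v * Sg v b) = 0"
  shows "(\<Sum>v\<in>insert a B. k v * Sg v c) = 0"
proof -
  interpret prob_space \<mu> by fact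
  have coord[measurable]: "(\<lambda>x. x v) \<in> borel_measurable \<mu>" if "v \<in> V" for v
    unfolding measurable_cong_sets[OF sets refl] using that by simp
  have intc: "integrable \<mu> (\<lambda>x. x v)" if "v \<in> V" for v
  proof (rule gaussian_integrable[where a = "Sg v v"])
    fix t
    show "(CLINT x|\<mu>. iexp (t * x v)) = complex_of_real (exp (- (t\<^sup>2 * Sg v v) / 2))"
      using CF[of "{v}" "\<lambda>_. t"] that by (simp add: power2_eq_square)
  qed (use coord[OF that] in simp)
  define e where "e = (\<lambda>x :: 'v \<Rightarrow> real. \<Sum>v\<in>insert a B. k v * x v)"
  have VB: "v \<in> V" if "v \<in> insert a B" for v using that sub a by auto
  have inte: "integrable \<mu> e" unfolding e_def by (intro Bochner_Integration.integrable_sum integrable_mult_right intc VB)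
  then have [measurable]: "e \<in> borel_measurable \<mu>" by simp
  have moment: "(CLINT x|\<mu>. complex_of_real (e x) * iexp (\<Sum>w\<in>W. \<tau> w * x w)) =
      \<i> * complex_of_real ((\<Sum>v\<in>insert a B. \<Sum>w\<in>W. k v * \<tau> w * Sg v w) *
        exp (- (\<Sum>v\<in>W. \<Sum>w\<in>W. \<tau> v * \<tau> w * Sg v w) / 2))"
    if W: "finite W" "W \<subseteq> V" for W \<tau>
  proof (rule gaussian_first_moment[OF inte])
    show "(\<lambda>x. \<Sum>w\<in>W. \<tau> w * x w) \<in> borel_measurable \<mu>"
      using W(2) by (intro borel_measurable_sum borel_measurable_times borel_measurable_const coord) auto
    fix t
    \<comment> \<open>\<open>W\<close> may overlap \<open>insert a B\<close>, so both families of
      coefficients are extended by zero to the union before the characteristic function is expanded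
      as a quadratic form.\<close>
    define U where "U = insert a B \<union> W"
    have U: "finite U" "U \<subseteq> V" using W fin VB by (auto simp: U_def)
    define k' where "k' = (\<lambda>v. if v \<in> insert a B then k v else 0)"
    define \<tau>' where "\<tau>' = (\<lambda>v. if v \<in> W then \<tau> v else 0)"
    have ext1: "(\<Sum>v\<in>U. k' v * h v) = (\<Sum>v\<in>insert a B. k v * h v)" for h
      using U(1) by (intro sum.mono_neutral_cong_right) (auto simp: U_def k'_def)
    have ext2: "(\<Sum>v\<in>U. \<tau>' v * h v) = (\<Sum>v\<in>W. \<tau> v * h v)" for h
      using U(1) by (intro sum.mono_neutral_cong_right) (auto simp: U_def \<tau>'_def)
    have lin: "t * e x + (\<Sum>w\<in>W. \<tau> w * x w) = (\<Sum>v\<in>U. (t * k' v + \<tau>' v) * x v)" for x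
      unfolding e_def ext1[symmetric] ext2[symmetric] sum_distrib_left sum.distrib[symmetric]
      by (intro sum.cong refl) (simp add: algebra_simps)
    define q where "q = (\<lambda>f g. \<Sum>v\<in>U. f v * (\<Sum>w\<in>U. g w * Sg v w))"
    have q_sym: "q f g = q g f" for f g
    proof -
      have "q f g = (\<Sum>v\<in>U. \<Sum>w\<in>U. f v * g w * Sg v w)"
        by (simp add: q_def sum_distrib_left mult.assoc)
      also have "\<dots> = (\<Sum>w\<in>U. \<Sum>v\<in>U. f v * g w * Sg v w)" by (rule sum.swap)
      also have "\<dots> = (\<Sum>w\<in>U. \<Sum>v\<in>U. g w * (f v * Sg w v))"
        using U(2) sym by (intro sum.cong refl) (auto simp: subset_eq)
      finally show ?thesis by (simp add: q_def sum_distrib_left)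
    qed
    have "(\<Sum>v\<in>U. \<Sum>w\<in>U. (t * k' v + \<tau>' v) * (t * k' w + \<tau>' w) * Sg v w) =
        t\<^sup>2 * q k' k' + t * q k' \<tau>' + t * q \<tau>' k' + q \<tau>' \<tau>'"
      unfolding q_def sum_distrib_left sum.distrib[symmetric]
      by (intro sum.cong refl) (simp add: algebra_simps power2_eq_square)
    also have "\<dots> = t\<^sup>2 * q k' k' + 2 * t * q k' \<tau>' + q \<tau>' \<tau>'"
      using q_sym[of \<tau>' k'] by simp
    finally have quad: "(\<Sum>v\<in>U. \<Sum>w\<in>U. (t * k' v + \<tau>' v) * (t * k' w + \<tau>' w) * Sg v w) =
        t\<^sup>2 * q k' k' + 2 * t * q k' \<tau>' + q \<tau>' \<tau>'" .
    have q1: "q k' \<tau>' = (\<Sum>v\<in>insert a B. \<Sum>w\<in>W. k v * \<tau> w * Sg v w)"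
      unfolding q_def ext1 ext2 by (simp add: sum_distrib_left mult.assoc)
    have q2: "q \<tau>' \<tau>' = (\<Sum>v\<in>W. \<Sum>w\<in>W. \<tau> v * \<tau> w * Sg v w)"
      unfolding q_def ext2 by (simp add: sum_distrib_left mult.assoc)
    have q3: "q k' k' = (\<Sum>v\<in>insert a B. k v * (\<Sum>w\<in>insert a B. k w * Sg v w))"
      unfolding q_def ext1 ..
    show "(CLINT x|\<mu>. iexp (t * e x + (\<Sum>w\<in>W. \<tau> w * x w))) = complex_of_real (exp (-
        (t\<^sup>2 * (\<Sum>v\<in>insert a B. k v * (\<Sum>w\<in>insert a B. k w * Sg v w))
         + 2 * t * (\<Sum>v\<in>insert a B. \<Sum>w\<in>W. k v * \<tau> w * Sg v w)
         + (\<Sum>v\<in>W. \<Sum>w\<in>W. \<tau> v * \<tau> w * Sg v w)) / 2))"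
      unfolding lin CF[OF U] quad q1[symmetric] q2[symmetric] q3[symmetric] ..
  qed
  define F G H where "F = coordinate_algebra \<mu> A" and "G = coordinate_algebra \<mu> C"
    and "H = coordinate_algebra \<mu> B"
  note caF = coordinate_algebra_facts[OF sets sub(1), folded F_def]
  note caG = coordinate_algebra_facts[OF sets sub(3), folded G_def]
  note caH = coordinate_algebra_facts[OF sets sub(2), folded H_def]
  interpret F: finite_measure_subalgebra \<mu> F by unfold_locales (rule caF)
  interpret G: finite_measure_subalgebra \<mu> G by unfold_locales (rule caG)
  interpret H: finite_measure_subalgebra \<mu> H by unfold_locales (rule caH)
  \<comment> \<open>The first moment of the residual against an exponential of \<open>B\<close>
    carries the covariance with \<open>B\<close> as a factor, which is zero.\<close>
  have eH: "(\<integral>x. indicator Z x * e x \<partial>\<mu>) = 0" if "Z \<in> sets H" for Z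
  proof (rule weight_vanishes_coordinate_algebra[OF \<open>prob_space \<mu>\<close> sets sub(2) fin inte _ that[unfolded H_def]])
    fix \<tau>
    have "(\<Sum>v\<in>insert a B. \<Sum>w\<in>B. k v * \<tau> w * Sg v w) = (\<Sum>w\<in>B. \<tau> w * (\<Sum>v\<in>insert a B. k v * Sg v w))"
      by (subst sum.swap) (simp add: sum_distrib_left mult_ac)
    also have "\<dots> = 0" using k by simp
    finally show "(CLINT x|\<mu>. complex_of_real (e x) * iexp (\<Sum>b\<in>B. \<tau> b * x b)) = 0"
      unfolding moment[OF fin sub(2)] by simp
  qed
  have AE0: "AE x in \<mu>. real_cond_exp \<mu> N W x = 0"
    if "finite_measure_subalgebra \<mu> N" "integrable \<mu> W"
      "\<And>Z. Z \<in> sets N \<Longrightarrow> (\<integral>x. indicator Z x * W x \<partial>\<mu>) = 0" for N and W :: "_ \<Rightarrow> real"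
  proof -
    interpret N: finite_measure_subalgebra \<mu> N by fact
    show ?thesis
      by (rule N.real_cond_exp_charact) (use that in \<open>simp_all add: set_lebesgue_integral_def\<close>)
  qed
  have orth: "(\<integral>x. f x * W x \<partial>\<mu>) = 0"
    if "finite_measure_subalgebra \<mu> N" "integrable \<mu> W"
      "\<And>Z. Z \<in> sets N \<Longrightarrow> (\<integral>x. indicator Z x * W x \<partial>\<mu>) = 0"
      "f \<in> borel_measurable N" "integrable \<mu> (\<lambda>x. f x * W x)" for N and W f :: "_ \<Rightarrow> real"
  proof -
    interpret N: finite_measure_subalgebra \<mu> N by fact
    have [measurable]: "f \<in> borel_measurable \<mu>"
      using measurable_from_subalg[OF N.subalg that(4)] .
    have "(\<integral>x. f x * W x \<partial>\<mu>) = (\<integral>x. f x * real_cond_exp \<mu> N W x \<partial>\<mu>)"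
      by (rule N.real_cond_exp_intg(2)[symmetric]) (use that in simp_all)
    also have "\<dots> = (\<integral>x. 0 \<partial>\<mu>)"
      by (rule integral_cong_AE) (use AE0[OF that(1-3)] in \<open>auto elim!: eventually_mono\<close>)
    finally show ?thesis by simp
  qed
  have eG: "(\<integral>x. indicator Y x * e x \<partial>\<mu>) = 0" if Y: "Y \<in> sets G" for Y
  proof -
    have Ym[measurable]: "Y \<in> sets \<mu>" using Y caG(1) by (auto simp: subalgebra_def)
    define g where "g = real_cond_exp \<mu> H (indicator Y)"
    have gH: "g \<in> borel_measurable H" unfolding g_def by simp
    have [measurable]: "g \<in> borel_measurable \<mu>" unfolding g_def by simp
    have intY: "integrable \<mu> (indicator Y :: _ \<Rightarrow> real)"
      by (rule integrable_real_indicator[OF Ym]) (simp add: emeasure_eq_measure)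
    have "AE x in \<mu>. g x \<ge> 0"
      unfolding g_def by (rule H.real_cond_exp_ge_c[OF intY]) (simp add: indicator_def)
    moreover have "AE x in \<mu>. g x \<le> 1"
      unfolding g_def by (rule H.real_cond_exp_le_c[OF intY]) (simp add: indicator_def)
    ultimately have g1: "AE x in \<mu>. \<bar>g x\<bar> \<le> 1" by eventually_elim auto
    have intg: "integrable \<mu> (\<lambda>x. f x * g x)" if "integrable \<mu> f" for f
    proof (rule Bochner_Integration.integrable_bound[OF that])
      show "AE x in \<mu>. norm (f x * g x) \<le> norm (f x)"
        using g1 by eventually_elim (simp add: abs_mult mult_left_le)
      show "(\<lambda>x. f x * g x) \<in> borel_measurable \<mu>" using that by simp
    qed
    have intI: "integrable \<mu> (\<lambda>x. f x * indicator Y x)" if "integrable \<mu> f" for f :: "_ \<Rightarrow> real"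
      using integrable_mult_indicator[OF Ym that] by (simp add: mult.commute)
    \<comment> \<open>The event \<open>Y\<close> minus its conditional probability given
      \<open>B\<close>. Conditional independence makes \<open>W\<close> orthogonal to
      \<open>x a\<close>, the definition of conditional expectation makes it orthogonal to each
      \<open>x b\<close>; hence it is orthogonal to the residual.\<close>
    define W where "W = (\<lambda>x. indicator Y x - g x)"
    have intfW: "integrable \<mu> (\<lambda>x. f x * W x)" if "integrable \<mu> f" for f
      using intg[OF that] intI[OF that] by (simp add: W_def right_diff_distrib)
    have intW: "integrable \<mu> W" using intfW[of "\<lambda>_. 1"] by simp
    have WF: "(\<integral>x. indicator X x * W x \<partial>\<mu>) = 0" if X: "X \<in> sets F" for X
    proof -
      have Xm[measurable]: "X \<in> sets \<mu>" using X caF(1) by (auto simp: subalgebra_def)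
      have intX: "integrable \<mu> (indicator X :: _ \<Rightarrow> real)"
        by (rule integrable_real_indicator[OF Xm]) (simp add: emeasure_eq_measure)
      have "(\<integral>x. indicator X x * (indicator Y x :: real) \<partial>\<mu>) = (\<integral>x. indicator (X \<inter> Y) x \<partial>\<mu>)"
        by (intro Bochner_Integration.integral_cong refl) (auto simp: indicator_def)
      also have "\<dots> = (\<integral>x. real_cond_exp \<mu> H (indicator (X \<inter> Y)) x \<partial>\<mu>)"
        by (rule H.real_cond_exp_int(2)[symmetric], rule integrable_real_indicator[OF sets.Int[OF Xm Ym]])
          (simp add: emeasure_eq_measure)
      also have "\<dots> = (\<integral>x. g x * real_cond_exp \<mu> H (indicator X) x \<partial>\<mu>)"
        using ci X Y unfolding cond_indep_def cond_indep_algebras_def F_def[symmetric] G_def[symmetric] H_def[symmetric]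
        by (intro integral_cong_AE) (auto simp: g_def mult.commute)
      also have "\<dots> = (\<integral>x. g x * indicator X x \<partial>\<mu>)"
        by (rule H.real_cond_exp_intg(2)) (use intg[OF intX] gH in \<open>simp_all add: mult.commute\<close>)
      finally have "(\<integral>x. indicator X x * (indicator Y x :: real) \<partial>\<mu>) = (\<integral>x. indicator X x * g x \<partial>\<mu>)"
        by (simp add: mult.commute)
      then show ?thesis using intg[OF intX] intI[OF intX] by (simp add: W_def right_diff_distrib)
    qed
    have Wa: "(\<integral>x. x a * W x \<partial>\<mu>) = 0"
      by (rule orth[OF _ intW WF]) (use F.finite_measure_subalgebra_axioms caF(2)[OF a] intfW intc VB in auto)
    have Wb: "(\<integral>x. x b * W x \<partial>\<mu>) = 0" if "b \<in> B" for b
    proof -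
      have "(\<integral>x. x b * g x \<partial>\<mu>) = (\<integral>x. x b * indicator Y x \<partial>\<mu>)"
        unfolding g_def by (rule H.real_cond_exp_intg(2)) (use intI[OF intc] caH(2)[OF that] VB that in auto)
      then show ?thesis using intg[OF intc] intI[OF intc] VB that by (simp add: W_def right_diff_distrib)
    qed
    have "(\<integral>x. e x * W x \<partial>\<mu>) = (\<integral>x. (\<Sum>v\<in>insert a B. k v * (x v * W x)) \<partial>\<mu>)"
      by (simp add: e_def sum_distrib_right mult.assoc)
    also have "\<dots> = (\<Sum>v\<in>insert a B. k v * (\<integral>x. x v * W x \<partial>\<mu>))"
      by (subst Bochner_Integration.integral_sum) (use intfW[OF intc] VB in auto)
    also have "\<dots> = 0" by (intro sum.neutral) (use Wa Wb in auto)
    finally have "(\<integral>x. e x * indicator Y x \<partial>\<mu>) = (\<integral>x. e x * g x \<partial>\<mu>)"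
      using intg[OF inte] intI[OF inte] by (simp add: W_def right_diff_distrib)
    also have "\<dots> = (\<integral>x. g x * e x \<partial>\<mu>)" by (simp add: mult.commute)
    also have "\<dots> = 0"
      by (rule orth[OF H.finite_measure_subalgebra_axioms inte eH gH])
        (use intg[OF inte] in \<open>simp_all add: mult.commute\<close>)
    finally show ?thesis by (simp add: mult.commute)
  qed
  have cV: "c \<in> V" using c sub by auto
  \<comment> \<open>A bounded test function of \<open>x c\<close>. Being the imaginary part of
    \<open>iexp\<close>, it lets the first moment formula return the covariance with
    \<open>c\<close> times a positive factor.\<close>
  have "(\<integral>x. sin (x c) * e x \<partial>\<mu>) = 0"
  proof (rule orth[OF G.finite_measure_subalgebra_axioms inte eG])
    show "(\<lambda>x. sin (x c)) \<in> borel_measurable G"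
      using caG(2)[OF c] by measurable
    show "integrable \<mu> (\<lambda>x. sin (x c) * e x)"
      by (rule Bochner_Integration.integrable_bound[OF inte])
        (use cV in \<open>auto simp: abs_mult mult_left_le_one_le intro!: borel_measurable_times\<close>)
  qed
  moreover have "(\<integral>x. sin (x c) * e x \<partial>\<mu>) = Im (CLINT x|\<mu>. complex_of_real (e x) * iexp (x c))"
  proof -
    have "integrable \<mu> (\<lambda>x. complex_of_real (e x) * iexp (x c))"
      by (rule Bochner_Integration.integrable_bound[OF inte])
        (use cV in \<open>auto simp: norm_mult intro!: borel_measurable_times\<close>)
    from integral_Im[OF this, symmetric] show ?thesis
      by (simp add: Im_exp mult.commute)
  qed
  moreover have "(CLINT x|\<mu>. complex_of_real (e x) * iexp (x c)) =
     \<i> * complex_of_real ((\<Sum>v\<in>insert a B. k v * Sg v c) * exp (- Sg c c / 2))"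
    using moment[of "{c}" "\<lambda>_. 1"] cV by simp
  ultimately show ?thesis by simp
qed

subsection \<open>Matrices indexed by finite sets\<close>

text \<open>Determinants are needed for matrices indexed by nodes, states and pairs of states. An
  arbitrary enumeration transfers them to numbered matrices; the lemmas below translate the results
  back, so that the choice never shows.\<close>

definition enum_list :: "'a set \<Rightarrow> 'a list" where
  "enum_list X = (SOME xs. set xs = X \<and> distinct xs)"

lemma enum_list:
  assumes "finite X"
  shows "set (enum_list X) = X" "distinct (enum_list X)" "length (enum_list X) = card X"
proof -
  have "set (enum_list X) = X \<and> distinct (enum_list X)"
    unfolding enum_list_def by (rule someI_ex) (rule finite_distinct_list[OF assms])
  then show "set (enum_list X) = X" "distinct (enum_list X)" by auto
  then show "length (enum_list X) = card X" using distinct_card by fastforce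
qed

lemma bij_betw_enum_list: "finite X \<Longrightarrow> bij_betw (\<lambda>i. enum_list X ! i) {0..<card X} X"
  using bij_betw_nth[of "enum_list X"] enum_list[of X] by (metis atLeast0LessThan)

lemma enum_list_mem: "finite X \<Longrightarrow> i < card X \<Longrightarrow> enum_list X ! i \<in> X"
  using enum_list[of X] by (metis nth_mem)

lemma enum_list_eq_iff:
  "finite X \<Longrightarrow> i < card X \<Longrightarrow> j < card X \<Longrightarrow> enum_list X ! i = enum_list X ! j \<longleftrightarrow> i = j"
  using enum_list[of X] by (metis nth_eq_iff_index_eq)

lemma enum_list_surj: "finite X \<Longrightarrow> x \<in> X \<Longrightarrow> \<exists>i<card X. enum_list X ! i = x"
  using enum_list[of X] by (metis in_set_conv_nth)

lemma sum_enum_list: "finite X \<Longrightarrow> (\<Sum>i\<in>{0..<card X}. f (enum_list X ! i)) = sum f X"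
  by (rule sum.reindex_bij_betw[OF bij_betw_enum_list])

definition mat_on :: "'a set \<Rightarrow> ('a \<Rightarrow> 'a \<Rightarrow> 'b) \<Rightarrow> 'b mat" where
  "mat_on X M = Matrix.mat (card X) (card X) (\<lambda>(i, j). M (enum_list X ! i) (enum_list X ! j))"

definition vec_on :: "'a set \<Rightarrow> ('a \<Rightarrow> 'b) \<Rightarrow> 'b Matrix.vec" where
  "vec_on X v = Matrix.vec (card X) (\<lambda>i. v (enum_list X ! i))"

definition det_on :: "'a set \<Rightarrow> ('a \<Rightarrow> 'a \<Rightarrow> 'b :: comm_ring_1) \<Rightarrow> 'b" where
  "det_on X M = Determinant.det (mat_on X M)"

lemma mat_on_carrier [simp]: "mat_on X M \<in> carrier_mat (card X) (card X)"
  by (simp add: mat_on_def)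

lemma vec_on_carrier [simp]: "vec_on X v \<in> carrier_vec (card X)"
  by (simp add: vec_on_def)

lemma mat_on_mult_vec_on:
  fixes M :: "'a \<Rightarrow> 'a \<Rightarrow> 'b :: comm_ring_1"
  assumes "finite X"
  shows "mat_on X M *\<^sub>v vec_on X v = vec_on X (\<lambda>x. \<Sum>y\<in>X. M x y * v y)"
  by (rule eq_vecI)
    (simp_all add: mat_on_def vec_on_def scalar_prod_def sum_enum_list[OF assms, symmetric])

lemma mat_on_mult:
  fixes M :: "'a \<Rightarrow> 'a \<Rightarrow> 'b :: comm_ring_1"
  assumes "finite X"
  shows "mat_on X M * mat_on X N = mat_on X (\<lambda>x z. \<Sum>y\<in>X. M x y * N y z)"
  by (rule eq_matI)
    (simp_all add: mat_on_def scalar_prod_def sum_enum_list[OF assms, symmetric])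

lemma mat_on_eq_iff:
  "finite X \<Longrightarrow> mat_on X M = mat_on X N \<longleftrightarrow> (\<forall>x\<in>X. \<forall>y\<in>X. M x y = N x y)"
proof
  assume X: "finite X" and eq: "mat_on X M = mat_on X N"
  show "\<forall>x\<in>X. \<forall>y\<in>X. M x y = N x y"
  proof (intro ballI)
    fix x y assume "x \<in> X" "y \<in> X"
    then obtain i j where ij: "i < card X" "enum_list X ! i = x" "j < card X" "enum_list X ! j = y"
      using enum_list_surj[OF X] by metis
    then show "M x y = N x y" using arg_cong[OF eq, of "\<lambda>A. A $$ (i, j)"] by (simp add: mat_on_def)
  qed
qed (auto simp: mat_on_def enum_list_mem intro!: eq_matI)

lemma vec_on_eq_iff:
  "finite X \<Longrightarrow> vec_on X v = vec_on X w \<longleftrightarrow> (\<forall>x\<in>X. v x = w x)"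
proof
  assume X: "finite X" and eq: "vec_on X v = vec_on X w"
  show "\<forall>x\<in>X. v x = w x"
  proof
    fix x assume "x \<in> X"
    then obtain i where "i < card X" "enum_list X ! i = x" using enum_list_surj[OF X] by metis
    then show "v x = w x" using arg_cong[OF eq, of "\<lambda>u. u $ i"] by (simp add: vec_on_def)
  qed
qed (auto simp: vec_on_def enum_list_mem intro!: eq_vecI)

lemma vec_on_surj:
  assumes "finite X" "u \<in> carrier_vec (card X)"
  shows "\<exists>v. u = vec_on X v"
proof (intro exI eq_vecI)
  let ?pos = "inv_into {0..<card X} (\<lambda>i. enum_list X ! i)"
  fix i assume "i < dim_vec (vec_on X (\<lambda>x. u $ ?pos x))"
  then have i: "i < card X" by (simp add: vec_on_def)
  have "?pos (enum_list X ! i) = i"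
    by (rule inv_into_f_f) (use bij_betw_enum_list[OF assms(1)] i in \<open>auto simp: bij_betw_def\<close>)
  then show "u $ i = vec_on X (\<lambda>x. u $ ?pos x) $ i" using i by (simp add: vec_on_def)
qed (use assms in \<open>simp add: vec_on_def\<close>)

lemma mat_on_one: "finite X \<Longrightarrow> mat_on X (\<lambda>x y. if x = y then 1 else 0) = 1\<^sub>m (card X)"
  by (rule eq_matI) (auto simp: mat_on_def enum_list_eq_iff)

lemma vec_on_zero: "vec_on X (\<lambda>x. 0) = 0\<^sub>v (card X)"
  by (rule eq_vecI) (auto simp: vec_on_def)

lemma det_on_eq_0_iff:
  fixes M :: "'a \<Rightarrow> 'a \<Rightarrow> 'b :: idom"
  assumes X: "finite X"
  shows "det_on X M = 0 \<longleftrightarrow> (\<exists>v. (\<exists>x\<in>X. v x \<noteq> 0) \<and> (\<forall>x\<in>X. (\<Sum>y\<in>X. M x y * v y) = 0))"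
proof -
  have nz: "vec_on X v \<noteq> 0\<^sub>v (card X) \<longleftrightarrow> (\<exists>x\<in>X. v x \<noteq> 0)" for v :: "'a \<Rightarrow> 'b"
    unfolding vec_on_zero[of X, symmetric] vec_on_eq_iff[OF X] by auto
  have eq: "mat_on X M *\<^sub>v vec_on X v = 0\<^sub>v (card X) \<longleftrightarrow> (\<forall>x\<in>X. (\<Sum>y\<in>X. M x y * v y) = 0)" for v
    unfolding mat_on_mult_vec_on[OF X] vec_on_zero[of X, symmetric] vec_on_eq_iff[OF X] ..
  show ?thesis
    unfolding det_on_def det_0_iff_vec_prod_zero[OF mat_on_carrier]
  proof
    assume "\<exists>u. u \<in> carrier_vec (card X) \<and> u \<noteq> 0\<^sub>v (card X) \<and> mat_on X M *\<^sub>v u = 0\<^sub>v (card X)"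
    then obtain u where u: "u \<in> carrier_vec (card X)" "u \<noteq> 0\<^sub>v (card X)" "mat_on X M *\<^sub>v u = 0\<^sub>v (card X)"
      by blast
    obtain v where "u = vec_on X v" using vec_on_surj[OF X u(1)] by blast
    then show "\<exists>v. (\<exists>x\<in>X. v x \<noteq> 0) \<and> (\<forall>x\<in>X. (\<Sum>y\<in>X. M x y * v y) = 0)"
      using u(2,3) unfolding \<open>u = vec_on X v\<close> nz eq by (intro exI[of _ v] conjI)
  next
    assume "\<exists>v. (\<exists>x\<in>X. v x \<noteq> 0) \<and> (\<forall>x\<in>X. (\<Sum>y\<in>X. M x y * v y) = 0)"
    then obtain v where "\<exists>x\<in>X. v x \<noteq> 0" "\<forall>x\<in>X. (\<Sum>y\<in>X. M x y * v y) = 0" by blast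
    then show "\<exists>u. u \<in> carrier_vec (card X) \<and> u \<noteq> 0\<^sub>v (card X) \<and> mat_on X M *\<^sub>v u = 0\<^sub>v (card X)"
      by (intro exI[of _ "vec_on X v"]) (simp add: nz eq)
  qed
qed

lemma det_on_solvable:
  fixes M :: "'a \<Rightarrow> 'a \<Rightarrow> 'b :: field"
  assumes X: "finite X" and "det_on X M \<noteq> 0"
  shows "\<exists>v. \<forall>x\<in>X. (\<Sum>y\<in>X. M x y * v y) = b x"
proof -
  let ?D = "det_on X M"
  have adj: "adj_mat (mat_on X M) \<in> carrier_mat (card X) (card X)"
    "mat_on X M * adj_mat (mat_on X M) = ?D \<cdot>\<^sub>m 1\<^sub>m (card X)"
    using adj_mat[OF mat_on_carrier] by (auto simp: det_on_def)
  have "adj_mat (mat_on X M) *\<^sub>v vec_on X b \<in> carrier_vec (card X)"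
    using adj by simp
  then obtain v where v: "adj_mat (mat_on X M) *\<^sub>v vec_on X b = vec_on X v"
    using vec_on_surj[OF X] by blast
  have "mat_on X M *\<^sub>v vec_on X v = (?D \<cdot>\<^sub>m 1\<^sub>m (card X)) *\<^sub>v vec_on X b"
    unfolding v[symmetric] adj(2)[symmetric]
    by (rule assoc_mult_mat_vec[OF mat_on_carrier adj(1) vec_on_carrier, symmetric])
  also have "\<dots> = vec_on X (\<lambda>x. ?D * b x)"
    by (rule eq_vecI)
      (auto simp: vec_on_def scalar_prod_def if_distrib[of "\<lambda>u. u * _"] if_distrib[of "times _"] cong: if_cong)
  finally have "\<forall>x\<in>X. (\<Sum>y\<in>X. M x y * v y) = ?D * b x"
    unfolding mat_on_mult_vec_on[OF X] vec_on_eq_iff[OF X] .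
  then have "\<forall>x\<in>X. (\<Sum>y\<in>X. M x y * (v y / ?D)) = b x"
    using assms(2) by (simp add: sum_divide_distrib[symmetric])
  then show ?thesis by (rule exI[of _ "\<lambda>y. v y / ?D"])
qed

lemma det_on_cramer:
  fixes M :: "'a \<Rightarrow> 'a \<Rightarrow> 'b :: field"
  assumes X: "finite X" and z: "z \<in> X" and eq: "\<And>x. x \<in> X \<Longrightarrow> (\<Sum>y\<in>X. M x y * v y) = b x"
  shows "det_on X (\<lambda>x y. if y = z then b x else M x y) = v z * det_on X M"
proof -
  obtain k where k: "k < card X" "enum_list X ! k = z" using enum_list_surj[OF X z] by blast
  have "mat_on X M *\<^sub>v vec_on X v = vec_on X b"
    unfolding mat_on_mult_vec_on[OF X] vec_on_eq_iff[OF X] using eq by simp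
  then have "replace_col (mat_on X M) (mat_on X M *\<^sub>v vec_on X v) k =
      mat_on X (\<lambda>x y. if y = z then b x else M x y)"
    using k by (intro eq_matI)
      (auto simp: replace_col_def mat_on_def vec_on_def enum_list_eq_iff[OF X, symmetric])
  then show ?thesis
    using cramer_lemma_mat[OF mat_on_carrier vec_on_carrier k(1), of M v] k
    by (simp add: det_on_def vec_on_def)
qed

text \<open>In \<open>ar_witness\<close> this lets the recursion for the responses be read from the
  other side.\<close>

lemma left_inverse_imp_right_inverse_on:
  fixes M N :: "'a \<Rightarrow> 'a \<Rightarrow> 'b :: field"
  assumes X: "finite X"
    and "\<And>x z. x \<in> X \<Longrightarrow> z \<in> X \<Longrightarrow> (\<Sum>y\<in>X. M x y * N y z) = (if x = z then 1 else 0)"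
    and "x \<in> X" "z \<in> X"
  shows "(\<Sum>y\<in>X. N x y * M y z) = (if x = z then 1 else 0)"
proof -
  have "mat_on X M * mat_on X N = 1\<^sub>m (card X)"
    unfolding mat_on_mult[OF X] mat_on_one[OF X, symmetric] mat_on_eq_iff[OF X] using assms by auto
  then have "mat_on X N * mat_on X M = 1\<^sub>m (card X)"
    by (rule mat_mult_left_right_inverse[OF mat_on_carrier mat_on_carrier])
  then show ?thesis
    unfolding mat_on_mult[OF X] mat_on_one[OF X, symmetric] mat_on_eq_iff[OF X] using assms by auto
qed

lemma polyfun_det_on:
  assumes "finite X" "\<And>x y. x \<in> X \<Longrightarrow> y \<in> X \<Longrightarrow> polyfun (\<lambda>t. M t x y)"
  shows "polyfun (\<lambda>t. det_on X (M t))"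
  unfolding det_on_def mat_on_def
  by (rule polyfun_det) (auto intro!: assms enum_list_mem)

section \<open>Matrix powers and their geometric decay\<close>

fun fpow :: "'a set \<Rightarrow> ('a \<Rightarrow> 'a \<Rightarrow> 'b :: comm_ring_1) \<Rightarrow> nat \<Rightarrow> 'a \<Rightarrow> 'a \<Rightarrow> 'b" where
  "fpow X F 0 x y = (if x = y then 1 else 0)"
| "fpow X F (Suc k) x y = (\<Sum>z\<in>X. fpow X F k x z * F z y)"

lemma fpow_Suc_left:
  assumes X: "finite X" and "x \<in> X" "y \<in> X"
  shows "fpow X F (Suc k) x y = (\<Sum>z\<in>X. F x z * fpow X F k z y)"
  using assms(3)
proof (induction k arbitrary: y)
  case 0
  then show ?case using assms(1,2) by (simp add: if_distrib if_distribR cong: if_cong)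
next
  case (Suc k)
  have "fpow X F (Suc (Suc k)) x y = (\<Sum>z\<in>X. fpow X F (Suc k) x z * F z y)"
    by (simp only: fpow.simps)
  also have "\<dots> = (\<Sum>z\<in>X. (\<Sum>w\<in>X. F x w * fpow X F k w z) * F z y)"
    by (intro sum.cong refl) (simp only: Suc.IH)
  also have "\<dots> = (\<Sum>w\<in>X. F x w * (\<Sum>z\<in>X. fpow X F k w z * F z y))"
    by (simp only: sum_distrib_right sum_distrib_left mult.assoc) (rule sum.swap)
  finally show ?case by (simp only: fpow.simps)
qed

lemma mat_on_fpow: "finite X \<Longrightarrow> mat_on X F ^\<^sub>m k = mat_on X (fpow X F k)"
proof (induction k)
  case 0
  then show ?case by (simp add: mat_on_one mat_on_def[of X F])
next
  case (Suc k)
  then show ?case by (simp add: mat_on_mult)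
qed

lemma fpow_of_real:
  "fpow X (\<lambda>x y. complex_of_real (F x y)) k x y = complex_of_real (fpow X F k x y)"
  by (induction k arbitrary: y) simp_all

lemma fpow_divide:
  fixes F :: "'a \<Rightarrow> 'a \<Rightarrow> 'b :: field"
  shows "fpow X (\<lambda>x y. F x y / r) k x y = fpow X F k x y / r ^ k"
  by (induction k arbitrary: y) (simp_all add: sum_divide_distrib[symmetric] mult.commute)

text \<open>The bound comes from the Jordan normal form, which exists over the complex numbers;
  hence the complex entries.\<close>

lemma fpow_bounded:
  fixes F :: "'a \<Rightarrow> 'a \<Rightarrow> complex"
  assumes X: "finite X" "X \<noteq> {}"
    and "spectral_radius (mat_on X F) < 1"
  shows "\<exists>c. \<forall>k. \<forall>x\<in>X. \<forall>y\<in>X. cmod (fpow X F k x y) \<le> c"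
proof -
  have "\<exists>c. \<forall>k. norm_bound (mat_on X F ^\<^sub>m k) c"
    using spectral_radius_jnf_norm_bound_less_1[OF mat_on_carrier assms(3)]
      char_poly_factorized[OF mat_on_carrier, of X F] jordan_nf_exists[OF mat_on_carrier, of X F] by blast
  then obtain c where c: "\<And>k. norm_bound (mat_on X F ^\<^sub>m k) c" by blast
  have "cmod (fpow X F k x y) \<le> c" if xy: "x \<in> X" "y \<in> X" for k x y
  proof -
    obtain i where i: "i < card X" "enum_list X ! i = x" using enum_list_surj[OF X(1) xy(1)] by blast
    obtain j where j: "j < card X" "enum_list X ! j = y" using enum_list_surj[OF X(1) xy(2)] by blast
    have "norm (mat_on X (fpow X F k) $$ (i, j)) \<le> c"
      using c[of k] i(1) j(1) unfolding norm_bound_def mat_on_fpow[OF X(1)] by (simp add: mat_on_def)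
    then show ?thesis using i j by (simp add: mat_on_def)
  qed
  then show ?thesis by blast
qed

lemma eigenvalue_mat_on:
  fixes F :: "'a \<Rightarrow> 'a \<Rightarrow> complex"
  assumes X: "finite X" and "eigenvalue (mat_on X F) l"
  shows "\<exists>v. (\<exists>x\<in>X. v x \<noteq> 0) \<and> (\<forall>x\<in>X. (\<Sum>y\<in>X. F x y * v y) = l * v x)"
proof -
  obtain u where u: "u \<in> carrier_vec (card X)" "u \<noteq> 0\<^sub>v (card X)" "mat_on X F *\<^sub>v u = l \<cdot>\<^sub>v u"
    using assms(2) unfolding eigenvalue_def eigenvector_def by (auto simp: mat_on_def)
  obtain v where v: "u = vec_on X v" using vec_on_surj[OF X u(1)] by blast
  have "l \<cdot>\<^sub>v vec_on X v = vec_on X (\<lambda>x. l * v x)"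
    by (rule eq_vecI) (auto simp: vec_on_def)
  then have "\<forall>x\<in>X. (\<Sum>y\<in>X. F x y * v y) = l * v x"
    using u(3) unfolding v mat_on_mult_vec_on[OF X] by (simp add: vec_on_eq_iff[OF X])
  moreover have "\<exists>x\<in>X. v x \<noteq> 0"
    using u(2) unfolding v vec_on_zero[of X, symmetric] vec_on_eq_iff[OF X] by auto
  ultimately show ?thesis by blast
qed

lemma spectral_radius_less:
  fixes F :: "'a \<Rightarrow> 'a \<Rightarrow> complex"
  assumes X: "finite X" "X \<noteq> {}"
    and eig: "\<And>l v. (\<exists>x\<in>X. v x \<noteq> 0) \<Longrightarrow> (\<forall>x\<in>X. (\<Sum>y\<in>X. F x y * v y) = l * v x) \<Longrightarrow> cmod l < r"
  shows "spectral_radius (mat_on X F) < r"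
proof -
  have "card X \<noteq> 0" using X by simp
  then obtain l where "l \<in> spectrum (mat_on X F)" "spectral_radius (mat_on X F) = cmod l"
    using spectral_radius_mem_max(1)[OF mat_on_carrier, of X F] by auto
  then show ?thesis
    using eigenvalue_mat_on[OF X(1), of F l] eig by (auto simp: spectrum_def)
qed

text \<open>Rescaling turns boundedness into geometric decay: division by a number \<open>r\<close>
  strictly between the spectral radius and 1 leaves the spectral radius below 1.\<close>

lemma fpow_decay:
  fixes F :: "'a \<Rightarrow> 'a \<Rightarrow> real"
  assumes X: "finite X"
    and eig: "\<And>l v. (\<exists>x\<in>X. v x \<noteq> 0) \<Longrightarrow>
      (\<forall>x\<in>X. (\<Sum>y\<in>X. complex_of_real (F x y) * v y) = l * v x) \<Longrightarrow> cmod l < 1"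
  shows "\<exists>c r. 0 \<le> c \<and> 0 < r \<and> r < 1 \<and> (\<forall>k. \<forall>x\<in>X. \<forall>y\<in>X. \<bar>fpow X F k x y\<bar> \<le> c * r ^ k)"
proof (cases "X = {}")
  case True
  then show ?thesis by (intro exI[of _ 0] exI[of _ "1/2"]) auto
next
  case False
  let ?F = "\<lambda>x y. complex_of_real (F x y)"
  define \<rho> where "\<rho> = max 0 (spectral_radius (mat_on X ?F))"
  have \<rho>: "0 \<le> \<rho>" "\<rho> < 1"
    using spectral_radius_less[OF X False eig] by (auto simp: \<rho>_def)
  define r where "r = (1 + \<rho>) / 2"
  have r: "0 < r" "r < 1" "\<rho> < r" using \<rho> by (auto simp: r_def)
  have "spectral_radius (mat_on X (\<lambda>x y. ?F x y / of_real r)) < 1"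
  proof (rule spectral_radius_less[OF X False])
    fix l v
    assume v: "\<exists>x\<in>X. v x \<noteq> 0" and l: "\<forall>x\<in>X. (\<Sum>y\<in>X. ?F x y / of_real r * v y) = l * v x"
    have "mat_on X ?F *\<^sub>v vec_on X v = (l * of_real r) \<cdot>\<^sub>v vec_on X v"
    proof -
      have "(\<Sum>y\<in>X. ?F x y * v y) = l * of_real r * v x" if "x \<in> X" for x
      proof -
        have "(\<Sum>y\<in>X. ?F x y * v y) = (\<Sum>y\<in>X. ?F x y / of_real r * v y) * of_real r"
          using r by (simp add: sum_distrib_right)
        then show ?thesis using l that by simp
      qed
      moreover have "(l * of_real r) \<cdot>\<^sub>v vec_on X v = vec_on X (\<lambda>x. l * of_real r * v x)"
        by (rule eq_vecI) (auto simp: vec_on_def)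
      ultimately show ?thesis
        unfolding mat_on_mult_vec_on[OF X] by (simp add: vec_on_eq_iff[OF X])
    qed
    moreover have "vec_on X v \<noteq> 0\<^sub>v (card X)"
      unfolding vec_on_zero[of X, symmetric] vec_on_eq_iff[OF X] using v by auto
    ultimately have "l * of_real r \<in> spectrum (mat_on X ?F)"
      unfolding spectrum_def eigenvalue_def eigenvector_def
      using carrier_matD(1)[OF mat_on_carrier, of X ?F] vec_on_carrier[of X v]
      by (intro CollectI exI[of _ "vec_on X v"] conjI) simp_all
    then have "cmod (l * of_real r) \<le> spectral_radius (mat_on X ?F)"
      using X False by (intro spectral_radius_mem_max(2)[OF mat_on_carrier]) auto
    moreover have "spectral_radius (mat_on X ?F) < r" using r(3) by (simp add: \<rho>_def)
    moreover have "cmod (l * of_real r) = cmod l * r" using r by (simp add: norm_mult)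
    ultimately have "cmod l * r < 1 * r" by linarith
    then show "cmod l < 1" using r mult_less_cancel_right_pos by blast
  qed
  then obtain c where c: "\<forall>k. \<forall>x\<in>X. \<forall>y\<in>X. cmod (fpow X (\<lambda>x y. ?F x y / of_real r) k x y) \<le> c"
    using fpow_bounded[OF X False] by blast
  have "\<bar>fpow X F k x y\<bar> \<le> max c 0 * r ^ k" if "x \<in> X" "y \<in> X" for k x y
  proof -
    have "cmod (fpow X (\<lambda>x y. ?F x y / of_real r) k x y) \<le> c" using c that by blast
    then have "\<bar>fpow X F k x y\<bar> / r ^ k \<le> c"
      unfolding fpow_divide fpow_of_real using r by (simp add: norm_divide norm_power)
    then have "\<bar>fpow X F k x y\<bar> \<le> c * r ^ k" using r by (simp add: pos_divide_le_eq)
    also have "\<dots> \<le> max c 0 * r ^ k" using r by (intro mult_right_mono) auto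
    finally show ?thesis .
  qed
  then show ?thesis using r by (intro exI[of _ "max c 0"] exI[of _ r]) auto
qed

subsection \<open>Companion form and moving average coefficients\<close>

text \<open>The inverse of \<open>1 - A 0\<close>. This matrix is lower triangular with unit
  diagonal, so its determinant is 1 and the adjugate is the inverse; the entries are thus visibly
  polynomial in those of \<open>A 0\<close>.\<close>

definition inv_A0 :: "nat \<Rightarrow> (nat \<Rightarrow> real mat) \<Rightarrow> nat \<Rightarrow> nat \<Rightarrow> real" where
  "inv_A0 d A i j = adj_mat (1\<^sub>m d - A 0) $$ (i, j)"

text \<open>Blocks \<open>0\<close> to \<open>p\<close> belong to the process and blocks
  \<open>Suc p\<close> to \<open>p + q + 1\<close> to the innovations. One lag more than the
  recursion reads is kept in each group, so that neither is empty for \<open>p = 0\<close> or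
  \<open>q = 0\<close>.\<close>

definition states :: "nat \<Rightarrow> nat \<Rightarrow> nat \<Rightarrow> (nat \<times> nat) set" where
  "states d p q = {..<p + q + 2} \<times> {..<d}"

text \<open>Companion form with state \<open>(S t, \<dots>, S (t - p), \<epsilon> t, \<dots>, \<epsilon> (t - q))\<close>, in which \<open>(b, i)\<close> is
  component \<open>i\<close> of block \<open>b\<close>.\<close>

definition companion ::
  "nat \<Rightarrow> nat \<Rightarrow> nat \<Rightarrow> (nat \<Rightarrow> real mat) \<Rightarrow> (nat \<Rightarrow> real mat) \<Rightarrow> nat \<times> nat \<Rightarrow> nat \<times> nat \<Rightarrow> real" where
  "companion d p q A B x y = (case x of (b, i) \<Rightarrow> case y of (b', j) \<Rightarrow>
     if b = 0 then
       (if b' < p then \<Sum>m<d. inv_A0 d A i m * A (Suc b') $$ (m, j)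
        else if p < b' \<and> b' \<le> p + q then \<Sum>m<d. inv_A0 d A i m * B (b' - p) $$ (m, j)
        else 0)
     else if b = Suc p then 0 else if Suc b' = b \<and> i = j then 1 else 0)"

definition input :: "nat \<Rightarrow> nat \<Rightarrow> (nat \<Rightarrow> real mat) \<Rightarrow> nat \<times> nat \<Rightarrow> nat \<Rightarrow> real" where
  "input d p A x m = (case x of (b, i) \<Rightarrow>
     if b = 0 then inv_A0 d A i m else if b = Suc p then (if i = m then 1 else 0) else 0)"

text \<open>The effect on the state of an innovation \<open>k\<close> steps earlier: the
  \<open>k\<close>-th power of the companion matrix applied to the input matrix.\<close>

definition state_response ::
  "nat \<Rightarrow> nat \<Rightarrow> nat \<Rightarrow> (nat \<Rightarrow> real mat) \<Rightarrow> (nat \<Rightarrow> real mat) \<Rightarrow> nat \<Rightarrow> nat \<times> nat \<Rightarrow> nat \<Rightarrow> real" where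
  "state_response d p q A B k x m =
     (\<Sum>y\<in>states d p q. fpow (states d p q) (companion d p q A B) k x y * input d p A y m)"

text \<open>The coefficients of the moving average representation of infinite order.\<close>

definition psi ::
  "nat \<Rightarrow> nat \<Rightarrow> nat \<Rightarrow> (nat \<Rightarrow> real mat) \<Rightarrow> (nat \<Rightarrow> real mat) \<Rightarrow> nat \<Rightarrow> nat \<Rightarrow> nat \<Rightarrow> real" where
  "psi d p q A B k i m = state_response d p q A B k (0, i) m"

lemma finite_states [simp]: "finite (states d p q)"
  by (simp add: states_def)

lemma sum_states:
  "(\<Sum>x\<in>states d p q. f x) = (\<Sum>b<p + q + 2. \<Sum>i<d. f (b, i))"
  by (simp add: states_def sum.cartesian_product)

lemma inv_A0:
  assumes "varma_coeffs d p q A B" "i < d" "j < d"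
  shows "(\<Sum>m<d. inv_A0 d A i m * ((if m = j then 1 else 0) - A 0 $$ (m, j))) = (if i = j then 1 else 0)"
    "(\<Sum>m<d. ((if i = m then 1 else 0) - A 0 $$ (i, m)) * inv_A0 d A m j) = (if i = j then 1 else 0)"
proof -
  let ?M = "1\<^sub>m d - A 0"
  have A0: "A 0 \<in> carrier_mat d d" "\<And>i j. i < d \<Longrightarrow> j < d \<Longrightarrow> i \<le> j \<Longrightarrow> A 0 $$ (i, j) = 0"
    using assms(1) by (auto simp: varma_coeffs_def)
  then have M: "?M \<in> carrier_mat d d" by (intro minus_carrier_mat)
  have "Determinant.det ?M = prod_list (diag_mat ?M)"
    by (rule det_lower_triangular[OF _ M]) (use A0 in auto)
  also have "diag_mat ?M = map (\<lambda>i. 1) [0..<d]"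
    unfolding diag_mat_def using A0 by (intro map_cong) auto
  also have "prod_list (map (\<lambda>i. 1 :: real) [0..<d]) = 1" by (simp add: map_replicate_const)
  finally have det: "Determinant.det ?M = 1" .
  have one: "1 \<cdot>\<^sub>m 1\<^sub>m d = (1\<^sub>m d :: real mat)" by (intro eq_matI) auto
  note adj = adj_mat[OF M, unfolded det one]
  have "(\<Sum>m<d. adj_mat ?M $$ (i, m) * ?M $$ (m, j)) = (adj_mat ?M * ?M) $$ (i, j)"
    using adj(1) M assms(2,3) A0(1) by (simp add: scalar_prod_def atLeast0LessThan)
  also have "\<dots> = (if i = j then 1 else 0)" unfolding adj(3) using assms(2,3) by simp
  finally show "(\<Sum>m<d. inv_A0 d A i m * ((if m = j then 1 else 0) - A 0 $$ (m, j))) = (if i = j then 1 else 0)"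
    using A0(1) assms(3) by (simp add: inv_A0_def)
  have "(\<Sum>m<d. ?M $$ (i, m) * adj_mat ?M $$ (m, j)) = (?M * adj_mat ?M) $$ (i, j)"
    using adj(1) M assms(2,3) A0(1) by (simp add: scalar_prod_def atLeast0LessThan)
  also have "\<dots> = (if i = j then 1 else 0)" unfolding adj(2) using assms(2,3) by simp
  finally show "(\<Sum>m<d. ((if i = m then 1 else 0) - A 0 $$ (i, m)) * inv_A0 d A m j) = (if i = j then 1 else 0)"
    using A0(1) assms(2) by (simp add: inv_A0_def)
qed

lemma sum_kronecker:
  fixes f :: "nat \<Rightarrow> 'a :: semiring_1"
  shows "i < d \<Longrightarrow> (\<Sum>m<d. (if i = m then 1 else 0) * f m) = f i"
    "i < d \<Longrightarrow> (\<Sum>m<d. (if m = i then 1 else 0) * f m) = f i"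
    "i < d \<Longrightarrow> (\<Sum>m<d. f m * (if i = m then 1 else 0)) = f i"
    "i < d \<Longrightarrow> (\<Sum>m<d. f m * (if m = i then 1 else 0)) = f i"
  by (simp_all add: if_distrib[of "\<lambda>x. x * _"] if_distrib[of "\<lambda>x. _ * x"] cong: if_cong)

text \<open>Needed over the reals for the recursions and over the complex numbers for eigenvectors;
  hence the general algebra.\<close>

lemma inv_A0_solve_of_real:
  fixes x y :: "nat \<Rightarrow> 'a :: {real_algebra_1, comm_ring_1}"
  assumes v: "varma_coeffs d p q A B"
  shows "(\<forall>i<d. x i - (\<Sum>m<d. of_real (A 0 $$ (i, m)) * x m) = y i) \<longleftrightarrow>
    (\<forall>i<d. x i = (\<Sum>m<d. of_real (inv_A0 d A i m) * y m))"
proof -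
  let ?C = "\<lambda>i j. (if i = j then 1 else 0) - A 0 $$ (i, j)"
  have minus: "x i - (\<Sum>m<d. of_real (A 0 $$ (i, m)) * x m) = (\<Sum>m<d. of_real (?C i m) * x m)"
    if "i < d" for i and x :: "nat \<Rightarrow> 'a"
  proof -
    have "(\<Sum>m<d. of_real (?C i m) * x m) =
        (\<Sum>m<d. (if i = m then 1 else 0) * x m) - (\<Sum>m<d. of_real (A 0 $$ (i, m)) * x m)"
      unfolding sum_subtractf[symmetric] by (intro sum.cong refl) (simp add: left_diff_distrib)
    then show ?thesis using that by (simp only: sum_kronecker)
  qed
  have comp: "(\<Sum>m<d. of_real (f i m) * (\<Sum>j<d. of_real (g m j) * x j)) = x i"
    if "i < d" and fg: "\<And>j. j < d \<Longrightarrow> (\<Sum>m<d. f i m * g m j) = (if i = j then 1 else 0)"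
    for i f g and x :: "nat \<Rightarrow> 'a"
  proof -
    have "(\<Sum>m<d. of_real (f i m) * (\<Sum>j<d. of_real (g m j) * x j)) =
        (\<Sum>j<d. of_real (\<Sum>m<d. f i m * g m j) * x j)"
      by (simp add: sum_distrib_left sum_distrib_right mult.assoc) (rule sum.swap)
    also have "\<dots> = (\<Sum>j<d. (if i = j then 1 else 0) * x j)"
      by (intro sum.cong refl) (simp add: fg)
    finally show ?thesis using that(1) by (simp only: sum_kronecker)
  qed
  have 1: "(\<Sum>m<d. of_real (inv_A0 d A i m) * (\<Sum>j<d. of_real (?C m j) * x j)) = x i" if "i < d" for i
    by (rule comp[where f = "inv_A0 d A" and g = ?C, OF that inv_A0(1)[OF v that]])
  have 2: "(\<Sum>m<d. of_real (?C i m) * (\<Sum>j<d. of_real (inv_A0 d A m j) * y j)) = y i" if "i < d" for i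
    by (rule comp[where f = ?C and g = "inv_A0 d A", OF that inv_A0(2)[OF v that]])
  show ?thesis
  proof
    assume "\<forall>i<d. x i - (\<Sum>m<d. of_real (A 0 $$ (i, m)) * x m) = y i"
    then have y_eq: "\<And>i. i < d \<Longrightarrow> y i = (\<Sum>m<d. of_real (?C i m) * x m)" by (simp only: minus[symmetric])
    show "\<forall>i<d. x i = (\<Sum>m<d. of_real (inv_A0 d A i m) * y m)"
    proof (intro allI impI)
      fix i assume i: "i < d"
      have "(\<Sum>m<d. of_real (inv_A0 d A i m) * y m) =
          (\<Sum>m<d. of_real (inv_A0 d A i m) * (\<Sum>j<d. of_real (?C m j) * x j))"
        by (intro sum.cong refl arg_cong2[where f = times] y_eq) simp
      then show "x i = (\<Sum>m<d. of_real (inv_A0 d A i m) * y m)" using 1[OF i] by simp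
    qed
  next
    assume x: "\<forall>i<d. x i = (\<Sum>m<d. of_real (inv_A0 d A i m) * y m)"
    show "\<forall>i<d. x i - (\<Sum>m<d. of_real (A 0 $$ (i, m)) * x m) = y i"
    proof (intro allI impI)
      fix i assume i: "i < d"
      have "(\<Sum>m<d. of_real (?C i m) * x m) =
          (\<Sum>m<d. of_real (?C i m) * (\<Sum>j<d. of_real (inv_A0 d A m j) * y j))"
        by (intro sum.cong refl arg_cong2[where f = times] x[rule_format]) simp
      then show "x i - (\<Sum>m<d. of_real (A 0 $$ (i, m)) * x m) = y i"
        using 2[OF i] minus[OF i, of x] by simp
    qed
  qed
qed

lemmas inv_A0_solve = inv_A0_solve_of_real[where 'a = real, simplified of_real_eq_id id_apply]

lemma companion_apply_top_of_real:
  fixes f :: "nat \<times> nat \<Rightarrow> 'a :: {real_algebra_1, comm_ring_1}"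
  shows "i < d \<Longrightarrow> (\<Sum>y\<in>states d p q. of_real (companion d p q A B (0, i) y) * f y) =
     (\<Sum>m<d. of_real (inv_A0 d A i m) * ((\<Sum>k = 1..p. \<Sum>j<d. of_real (A k $$ (m, j)) * f (k - 1, j)) +
        (\<Sum>l = 1..q. \<Sum>j<d. of_real (B l $$ (m, j)) * f (p + l, j))))"
proof -
  \<comment> \<open>The blocks \<open>p\<close> and \<open>Suc (p + q)\<close> of the previous state
    hold lags \<open>p + 1\<close> and \<open>q + 1\<close>, which the equation does not read; their
    columns in the top row are zero.\<close>
  have split: "{..<p + q + 2} = {..<p} \<union> {Suc p..p + q} \<union> {p, Suc (p + q)}" by auto
  have "(\<Sum>y\<in>states d p q. of_real (companion d p q A B (0, i) y) * f y) =
      (\<Sum>b<p. \<Sum>j<d. of_real (\<Sum>m<d. inv_A0 d A i m * A (Suc b) $$ (m, j)) * f (b, j)) +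
      (\<Sum>b = Suc p..p + q. \<Sum>j<d. of_real (\<Sum>m<d. inv_A0 d A i m * B (b - p) $$ (m, j)) * f (b, j))"
  proof -
    have "(\<Sum>y\<in>states d p q. of_real (companion d p q A B (0, i) y) * f y) =
       (\<Sum>b\<in>{..<p} \<union> {Suc p..p + q} \<union> {p, Suc (p + q)}. \<Sum>j<d. of_real (companion d p q A B (0, i) (b, j)) * f (b, j))"
      unfolding sum_states split ..
    also have "\<dots> = (\<Sum>b\<in>{..<p} \<union> {Suc p..p + q}. \<Sum>j<d. of_real (companion d p q A B (0, i) (b, j)) * f (b, j))"
      by (intro sum.mono_neutral_right) (auto simp: companion_def)
    also have "\<dots> = (\<Sum>b<p. \<Sum>j<d. of_real (companion d p q A B (0, i) (b, j)) * f (b, j)) +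
       (\<Sum>b = Suc p..p + q. \<Sum>j<d. of_real (companion d p q A B (0, i) (b, j)) * f (b, j))"
      by (rule sum.union_disjoint) auto
    finally show ?thesis by (simp add: companion_def)
  qed
  also have "(\<Sum>b<p. \<Sum>j<d. of_real (\<Sum>m<d. inv_A0 d A i m * A (Suc b) $$ (m, j)) * f (b, j)) =
      (\<Sum>k = 1..p. \<Sum>j<d. of_real (\<Sum>m<d. inv_A0 d A i m * A k $$ (m, j)) * f (k - 1, j))"
    by (rule sum.reindex_bij_witness[of _ "\<lambda>k. k - 1" Suc]) auto
  also have "(\<Sum>b = Suc p..p + q. \<Sum>j<d. of_real (\<Sum>m<d. inv_A0 d A i m * B (b - p) $$ (m, j)) * f (b, j)) =
      (\<Sum>l = 1..q. \<Sum>j<d. of_real (\<Sum>m<d. inv_A0 d A i m * B l $$ (m, j)) * f (p + l, j))"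
    by (rule sum.reindex_bij_witness[of _ "\<lambda>l. p + l" "\<lambda>b. b - p"]) auto
  also have "(\<Sum>k = 1..p. \<Sum>j<d. of_real (\<Sum>m<d. inv_A0 d A i m * A k $$ (m, j)) * f (k - 1, j)) =
     (\<Sum>m<d. of_real (inv_A0 d A i m) * (\<Sum>k = 1..p. \<Sum>j<d. of_real (A k $$ (m, j)) * f (k - 1, j)))"
    by (simp add: sum_distrib_left sum_distrib_right mult.assoc)
      (subst (2) sum.swap, subst sum.swap, rule refl)
  also have "(\<Sum>l = 1..q. \<Sum>j<d. of_real (\<Sum>m<d. inv_A0 d A i m * B l $$ (m, j)) * f (p + l, j)) =
     (\<Sum>m<d. of_real (inv_A0 d A i m) * (\<Sum>l = 1..q. \<Sum>j<d. of_real (B l $$ (m, j)) * f (p + l, j)))"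
    by (simp add: sum_distrib_left sum_distrib_right mult.assoc)
      (subst (2) sum.swap, subst sum.swap, rule refl)
  finally show ?thesis by (simp add: distrib_left sum.distrib)
qed

lemma companion_apply_shift_of_real:
  fixes f :: "nat \<times> nat \<Rightarrow> 'a :: {real_algebra_1, comm_ring_1}"
  shows "i < d \<Longrightarrow> b < p + q + 2 \<Longrightarrow> b \<noteq> 0 \<Longrightarrow> (\<Sum>y\<in>states d p q. of_real (companion d p q A B (b, i) y) * f y) =
     (if b = Suc p then 0 else f (b - 1, i))"
proof -
  assume *: "i < d" "b < p + q + 2" "b \<noteq> 0"
  show ?thesis
  proof (cases "b = Suc p")
    case True
    then show ?thesis by (auto simp: companion_def case_prod_beta)
  next
    case False
    then have "(\<Sum>y\<in>states d p q. of_real (companion d p q A B (b, i) y) * f y) =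
       (\<Sum>y\<in>states d p q. if y = (b - 1, i) then f y else 0)"
      using * by (intro sum.cong refl) (auto simp: companion_def split: prod.splits)
    then show ?thesis using * False by (simp add: states_def)
  qed
qed

lemmas companion_apply_top = companion_apply_top_of_real[where 'a = real, simplified of_real_eq_id id_apply]
lemmas companion_apply_shift = companion_apply_shift_of_real[where 'a = real, simplified of_real_eq_id id_apply]

lemma state_response_Suc:
  "x \<in> states d p q \<Longrightarrow> state_response d p q A B (Suc k) x m =
     (\<Sum>y\<in>states d p q. companion d p q A B x y * state_response d p q A B k y m)"
proof -
  assume x: "x \<in> states d p q"
  have "state_response d p q A B (Suc k) x m = (\<Sum>y\<in>states d p q. (\<Sum>z\<in>states d p q.
      companion d p q A B x z * fpow (states d p q) (companion d p q A B) k z y) * input d p A y m)"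
    unfolding state_response_def
    by (intro sum.cong refl) (simp only: fpow_Suc_left[OF finite_states x])
  also have "\<dots> = (\<Sum>z\<in>states d p q. \<Sum>y\<in>states d p q.
      companion d p q A B x z * fpow (states d p q) (companion d p q A B) k z y * input d p A y m)"
    by (simp only: sum_distrib_right) (rule sum.swap)
  finally show ?thesis by (simp add: state_response_def sum_distrib_left mult.assoc)
qed

lemma state_response_0:
  "x \<in> states d p q \<Longrightarrow> state_response d p q A B 0 x m = input d p A x m"
  by (simp add: state_response_def if_distrib[of "\<lambda>u. u * _"] cong: if_cong)

text \<open>The lower blocks are delay lines: process block \<open>b\<close> repeats the top block
  \<open>b\<close> steps later, and an innovation block sees the unit impulse at exactly one
  step.\<close>

lemma state_response_block:
  assumes "i < d" "m < d" "b < p + q + 2"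
  shows "state_response d p q A B k (b, i) m =
    (if b \<le> p then if b \<le> k then psi d p q A B (k - b) i m else 0
     else if b = Suc p + k \<and> i = m then 1 else 0)"
  using assms(3)
proof (induction k arbitrary: b)
  case 0
  then show ?case using assms
    by (auto simp: psi_def state_response_0 states_def input_def)
next
  case (Suc k)
  have mem: "(b, i) \<in> states d p q" using assms Suc.prems by (simp add: states_def)
  show ?case
  proof (cases "b = 0")
    case True
    then show ?thesis by (simp add: psi_def)
  next
    case False
    have "state_response d p q A B (Suc k) (b, i) m =
        (if b = Suc p then 0 else state_response d p q A B k (b - 1, i) m)"
      unfolding state_response_Suc[OF mem] by (rule companion_apply_shift) (use assms Suc.prems False in auto)
    also have "\<dots> = (if b \<le> p then if b \<le> Suc k then psi d p q A B (Suc k - b) i m else 0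
     else if b = Suc p + Suc k \<and> i = m then 1 else 0)"
      using Suc.IH[of "b - 1"] Suc.prems False by auto
    finally show ?thesis .
  qed
qed

text \<open>The defining equation of the process, applied to a unit impulse.\<close>

lemma psi_recursion:
  assumes v: "varma_coeffs d p q A B" and "i < d" "j < d"
  shows "psi d p q A B k i j - (\<Sum>m<d. A 0 $$ (i, m) * psi d p q A B k m j) =
    (\<Sum>l = 1..p. if l \<le> k then \<Sum>m<d. A l $$ (i, m) * psi d p q A B (k - l) m j else 0)
    + (if k = 0 then if i = j then 1 else 0 else if k \<le> q then B k $$ (i, j) else 0)"
proof (cases k)
  case 0
  have "\<forall>i<d. psi d p q A B 0 i j = (\<Sum>m<d. inv_A0 d A i m * (if m = j then 1 else 0))"
    using assms by (simp add: psi_def state_response_0 states_def input_def sum_kronecker)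
  from inv_A0_solve[OF v, THEN iffD2, OF this] assms 0 show ?thesis by simp
next
  case (Suc k')
  have "psi d p q A B (Suc k') i j = (\<Sum>m<d. inv_A0 d A i m *
      ((\<Sum>l = 1..p. if l \<le> k then \<Sum>n<d. A l $$ (m, n) * psi d p q A B (k - l) n j else 0)
    + (if k \<le> q then B k $$ (m, j) else 0)))" if i: "i < d" for i
  proof -
    have mem: "(0, i) \<in> states d p q" using i by (simp add: states_def)
    have *: "(\<Sum>l = 1..p. \<Sum>n<d. A l $$ (m, n) * state_response d p q A B k' (l - 1, n) j) =
       (\<Sum>l = 1..p. if l \<le> k then \<Sum>n<d. A l $$ (m, n) * psi d p q A B (k - l) n j else 0)" for m
    proof (intro sum.cong refl)
      fix l assume "l \<in> {1..p}"
      then obtain l' where "l = Suc l'" "l' < p" by (cases l) auto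
      then show "(\<Sum>n<d. A l $$ (m, n) * state_response d p q A B k' (l - 1, n) j) =
          (if l \<le> k then \<Sum>n<d. A l $$ (m, n) * psi d p q A B (k - l) n j else 0)"
        using assms Suc by (auto simp: state_response_block)
    qed
    have **: "(\<Sum>l = 1..q. \<Sum>n<d. B l $$ (m, n) * state_response d p q A B k' (p + l, n) j) =
       (if k \<le> q then B k $$ (m, j) else 0)" for m
    proof -
      have "(\<Sum>l = 1..q. \<Sum>n<d. B l $$ (m, n) * state_response d p q A B k' (p + l, n) j) =
         (\<Sum>l = 1..q. if l = k then \<Sum>n<d. B l $$ (m, n) * (if n = j then 1 else 0) else 0)"
        by (intro sum.cong refl) (use assms Suc in \<open>auto simp: state_response_block intro!: sum.cong\<close>)
      then show ?thesis using assms Suc by (simp add: sum_kronecker)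
    qed
    show ?thesis
      unfolding psi_def[of _ _ _ _ _ "Suc k'"] state_response_Suc[OF mem] companion_apply_top[OF i] * ** ..
  qed
  then have "\<forall>i<d. psi d p q A B (Suc k') i j = (\<Sum>m<d. inv_A0 d A i m *
      ((\<Sum>l = 1..p. if l \<le> k then \<Sum>n<d. A l $$ (m, n) * psi d p q A B (k - l) n j else 0)
    + (if k \<le> q then B k $$ (m, j) else 0)))" by blast
  from inv_A0_solve[OF v, THEN iffD2, OF this] assms Suc show ?thesis by simp
qed

text \<open>For an eigenvalue \<open>l\<close> of modulus at least 1 the shift rows can be divided
  by \<open>l\<close>: the innovation blocks of the eigenvector vanish and its process blocks are
  powers of \<open>l\<close> times the last one, \<open>w\<close>. The top row then puts
  \<open>w\<close> into the kernel of the matrix of \<open>root_condition\<close> at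
  \<open>l\<close>.\<close>

lemma companion_eigenvalue:
  assumes v: "varma_coeffs d p q A B" and root: "root_condition d p A"
    and nz: "\<exists>x\<in>states d p q. v x \<noteq> 0"
    and eig: "\<forall>x\<in>states d p q. (\<Sum>y\<in>states d p q. complex_of_real (companion d p q A B x y) * v y) = l * v x"
  shows "cmod l < 1"
proof (rule ccontr)
  assume "\<not> cmod l < 1"
  then have l: "l \<noteq> 0" by auto
  have shift: "l * v (b, i) = (if b = Suc p then 0 else v (b - 1, i))"
    if "i < d" "b < p + q + 2" "b \<noteq> 0" for b i
    using eig companion_apply_shift_of_real[OF that, of A B v] that by (simp add: states_def)
  have noise: "v (Suc p + b, i) = 0" if "i < d" "b \<le> q" for b i
    using that(2)
  proof (induction b)
    case 0
    then show ?case using shift[of i "Suc p"] that l by simp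
  next
    case (Suc b)
    then show ?case using shift[of i "Suc p + Suc b"] that l by simp
  qed
  define w where "w = (\<lambda>i. v (p, i))"
  have endo: "v (p - k, i) = l ^ k * w i" if "i < d" "k \<le> p" for k i
    using that(2)
  proof (induction k)
    case 0
    then show ?case by (simp add: w_def)
  next
    case (Suc k)
    then have "l * v (p - k, i) = v (p - Suc k, i)" using shift[of i "p - k"] that by simp
    then show ?case using Suc by (simp add: mult.assoc)
  qed
  have "\<exists>i<d. w i \<noteq> 0"
  proof (rule ccontr)
    assume "\<not> (\<exists>i<d. w i \<noteq> 0)"
    then have w0: "w i = 0" if "i < d" for i using that by blast
    have "v (b, i) = 0" if "b < p + q + 2" "i < d" for b i
    proof (cases "b \<le> p")
      case True
      then show ?thesis using endo[of i "p - b"] w0 that by simp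
    next
      case False
      then show ?thesis using noise[of i "b - Suc p"] that by simp
    qed
    then show False using nz by (auto simp: states_def)
  qed
  have "\<forall>i<d. l * v (0, i) = (\<Sum>m<d. of_real (inv_A0 d A i m) *
      (\<Sum>k = 1..p. \<Sum>j<d. of_real (A k $$ (m, j)) * v (k - 1, j)))"
  proof (intro allI impI)
    fix i assume i: "i < d"
    have "(\<Sum>j<d. of_real (B l' $$ (m, j)) * v (p + l', j)) = 0" if "l' \<in> {1..q}" for l' m
    proof (intro sum.neutral ballI)
      fix j assume "j \<in> {..<d}"
      then show "of_real (B l' $$ (m, j)) * v (p + l', j) = 0"
        using noise[of j "l' - 1"] that by (cases l') auto
    qed
    then show "l * v (0, i) = (\<Sum>m<d. of_real (inv_A0 d A i m) *
      (\<Sum>k = 1..p. \<Sum>j<d. of_real (A k $$ (m, j)) * v (k - 1, j)))"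
      using eig companion_apply_top_of_real[OF i, where p = p and q = q and A = A and B = B and f = v] i by (simp add: states_def)
  qed
  from inv_A0_solve_of_real[OF v, THEN iffD2, OF this]
  have eq: "l * v (0, i) - (\<Sum>m<d. of_real (A 0 $$ (i, m)) * (l * v (0, m))) =
     (\<Sum>k = 1..p. \<Sum>j<d. of_real (A k $$ (i, j)) * v (k - 1, j))" if "i < d" for i
    using that by blast
  let ?N = "\<lambda>i j. complex_of_real ((1\<^sub>m d - A 0) $$ (i, j)) * l ^ p
          - (\<Sum>k=1..p. complex_of_real (A k $$ (i, j)) * l ^ (p - k))"
  have A0: "A 0 \<in> carrier_mat d d" using v by (auto simp: varma_coeffs_def)
  have kernel: "(\<Sum>j<d. ?N i j * w j) = 0" if i: "i < d" for i
  proof -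
    \<comment> \<open>The state has \<open>Suc p\<close> process blocks, so the eigenvalue equation
      is the characteristic equation times one extra factor \<open>l\<close>.\<close>
    have "l * (\<Sum>j<d. ?N i j * w j) =
        (\<Sum>j<d. (if i = j then 1 else 0) * (l * (l ^ p * w j))) -
        (\<Sum>j<d. of_real (A 0 $$ (i, j)) * (l * (l ^ p * w j))) -
        (\<Sum>j<d. \<Sum>k=1..p. of_real (A k $$ (i, j)) * (l ^ (p - (k - 1)) * w j))"
      unfolding sum_distrib_left sum_subtractf[symmetric]
    proof (intro sum.cong refl)
      fix j assume j: "j \<in> {..<d}"
      have E1: "l * (\<Sum>k=1..p. complex_of_real (A k $$ (i, j)) * l ^ (p - k)) * w j =
          (\<Sum>k=1..p. of_real (A k $$ (i, j)) * (l ^ (p - (k - 1)) * w j))"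
        unfolding sum_distrib_left sum_distrib_right
      proof (intro sum.cong refl)
        fix k assume "k \<in> {1..p}"
        then have "p - (k - 1) = Suc (p - k)" by auto
        then show "l * (complex_of_real (A k $$ (i, j)) * l ^ (p - k)) * w j =
          of_real (A k $$ (i, j)) * (l ^ (p - (k - 1)) * w j)" by simp
      qed
      have E2: "complex_of_real ((1\<^sub>m d - A 0) $$ (i, j)) = (if i = j then 1 else 0) - of_real (A 0 $$ (i, j))"
        using A0 i j by auto
      have alg: "l * (((e - a) * P - s) * u) = e * (l * (P * u)) - a * (l * (P * u)) - l * s * u"
        for e a P s u :: complex
        by (simp add: algebra_simps)
      show "l * (?N i j * w j) = (if i = j then 1 else 0) * (l * (l ^ p * w j)) -
          of_real (A 0 $$ (i, j)) * (l * (l ^ p * w j)) -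
          (\<Sum>k=1..p. of_real (A k $$ (i, j)) * (l ^ (p - (k - 1)) * w j))"
        unfolding E1[symmetric] E2 by (rule alg)
    qed
    also have "\<dots> = l * v (0, i) - (\<Sum>m<d. of_real (A 0 $$ (i, m)) * (l * v (0, m))) -
        (\<Sum>k = 1..p. \<Sum>j<d. of_real (A k $$ (i, j)) * v (k - 1, j))"
    proof -
      have v0: "l ^ p * w j = v (0, j)" if "j < d" for j using endo[of j p] that by simp
      have vk: "l ^ (p - (k - 1)) * w j = v (k - 1, j)" if "j < d" "k \<in> {1..p}" for j k
        using endo[of j "p - (k - 1)"] that by simp
      have "(\<Sum>j<d. \<Sum>k=1..p. of_real (A k $$ (i, j)) * (l ^ (p - (k - 1)) * w j)) =
         (\<Sum>k = 1..p. \<Sum>j<d. of_real (A k $$ (i, j)) * v (k - 1, j))"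
        by (subst sum.swap, intro sum.cong refl) (simp only: vk lessThan_iff)
      then show ?thesis using i by (simp add: sum_kronecker v0)
    qed
    also have "\<dots> = 0" using eq[OF i] by simp
    finally show ?thesis using l by simp
  qed
  have "Matrix.mat d d (\<lambda>(i, j). ?N i j) *\<^sub>v Matrix.vec d w = 0\<^sub>v d"
    by (rule eq_vecI) (use kernel in \<open>simp_all add: scalar_prod_def atLeast0LessThan\<close>)
  moreover have "Matrix.vec d w \<noteq> 0\<^sub>v d"
    using \<open>\<exists>i<d. w i \<noteq> 0\<close> by (auto simp: vec_eq_iff)
  ultimately have "Determinant.det (Matrix.mat d d (\<lambda>(i, j). ?N i j)) = 0"
    by (subst det_0_iff_vec_prod_zero[of _ d]) (auto intro!: exI[of _ "Matrix.vec d w"])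
  then show False using root \<open>\<not> cmod l < 1\<close> unfolding root_condition_def by blast
qed

lemma fpow_companion_decay:
  assumes "varma_coeffs d p q A B" "root_condition d p A"
  shows "\<exists>c r. 0 \<le> c \<and> 0 < r \<and> r < 1 \<and>
    (\<forall>k. \<forall>x\<in>states d p q. \<forall>y\<in>states d p q. \<bar>fpow (states d p q) (companion d p q A B) k x y\<bar> \<le> c * r ^ k)"
  by (rule fpow_decay) (use companion_eigenvalue[OF assms] in auto)

lemma state_response_decay:
  assumes "varma_coeffs d p q A B" "root_condition d p A"
  shows "\<exists>c r. 0 \<le> c \<and> 0 < r \<and> r < 1 \<and>
    (\<forall>k. \<forall>x\<in>states d p q. \<forall>m<d. \<bar>state_response d p q A B k x m\<bar> \<le> c * r ^ k)"
proof -
  obtain c r where cr: "0 \<le> c" "0 < r" "r < 1"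
    "\<And>k x y. x \<in> states d p q \<Longrightarrow> y \<in> states d p q \<Longrightarrow> \<bar>fpow (states d p q) (companion d p q A B) k x y\<bar> \<le> c * r ^ k"
    using fpow_companion_decay[OF assms] by blast
  define g where "g = (\<Sum>y\<in>states d p q. \<Sum>m<d. \<bar>input d p A y m\<bar>)"
  have g: "g \<ge> 0" unfolding g_def by (intro sum_nonneg) auto
  have "\<bar>state_response d p q A B k x m\<bar> \<le> (c * g) * r ^ k" if x: "x \<in> states d p q" and m: "m < d" for k x m
  proof -
    have "\<bar>state_response d p q A B k x m\<bar> \<le>
        (\<Sum>y\<in>states d p q. \<bar>fpow (states d p q) (companion d p q A B) k x y * input d p A y m\<bar>)"
      unfolding state_response_def by (rule sum_abs)
    also have "\<dots> \<le> (\<Sum>y\<in>states d p q. (c * r ^ k) * \<bar>input d p A y m\<bar>)"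
      unfolding abs_mult by (intro sum_mono mult_right_mono cr x) auto
    also have "\<dots> = (c * r ^ k) * (\<Sum>y\<in>states d p q. \<bar>input d p A y m\<bar>)" by (simp add: sum_distrib_left)
    also have "\<dots> \<le> (c * r ^ k) * g"
      unfolding g_def using cr m
      by (intro mult_left_mono sum_mono member_le_sum) auto
    finally show ?thesis by (simp add: mult_ac)
  qed
  then show ?thesis using cr g by (intro exI[of _ "c * g"] exI[of _ r]) auto
qed

subsection \<open>The stationary solution and its covariances\<close>

text \<open>The coefficient of innovation \<open>(u, m)\<close> in node \<open>v\<close>, that is,
  the moving average coefficients as an infinite matrix indexed by absolute times.\<close>

definition response ::
  "nat \<Rightarrow> nat \<Rightarrow> nat \<Rightarrow> (nat \<Rightarrow> real mat) \<Rightarrow> (nat \<Rightarrow> real mat) \<Rightarrow> int \<times> nat \<Rightarrow> int \<Rightarrow> nat \<Rightarrow> real" where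
  "response d p q A B v u m = (if u \<le> fst v then psi d p q A B (nat (fst v - u)) (snd v) m else 0)"

definition autocov ::
  "nat \<Rightarrow> nat \<Rightarrow> nat \<Rightarrow> (nat \<Rightarrow> real mat) \<Rightarrow> (nat \<Rightarrow> real mat) \<Rightarrow> (nat \<Rightarrow> real) \<Rightarrow>
   int \<times> nat \<Rightarrow> int \<times> nat \<Rightarrow> real" where
  "autocov d p q A B s2 v w =
     (\<Sum>k. \<Sum>m<d. s2 m * response d p q A B v (fst v - int k) m * response d p q A B w (fst v - int k) m)"

locale stable_coeffs =
  fixes d p q :: nat and A B :: "nat \<Rightarrow> real mat" and s2 :: "nat \<Rightarrow> real"
  assumes coeffs: "varma_coeffs d p q A B" and root: "root_condition d p A"
begin

abbreviation "X \<equiv> states d p q"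
abbreviation "F \<equiv> companion d p q A B"
abbreviation "Wr \<equiv> state_response d p q A B"
abbreviation "rsp \<equiv> response d p q A B"
abbreviation "gam \<equiv> autocov d p q A B s2"

lemma psi_bound:
  obtains c r where "0 \<le> c" "0 < r" "r < 1"
    "\<And>k i m. i < d \<Longrightarrow> m < d \<Longrightarrow> \<bar>psi d p q A B k i m\<bar> \<le> c * r ^ k"
proof -
  obtain c r where cr: "0 \<le> c" "0 < r" "r < 1"
    "\<And>k x m. x \<in> X \<Longrightarrow> m < d \<Longrightarrow> \<bar>Wr k x m\<bar> \<le> c * r ^ k"
    using state_response_decay[OF coeffs root] by blast
  show ?thesis
    by (rule that[OF cr(1-3)]) (auto simp: psi_def states_def intro!: cr(4))
qed

text \<open>The shift \<open>h\<close> separates the decay in the time distance of the two nodes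
  from the decay in the summation index; \<open>autocov_decay\<close> needs both.\<close>

lemma autocov_term_bound:
  obtains K r where "0 \<le> K" "0 < r" "r < 1"
    "\<And>v w h k. snd v < d \<Longrightarrow> snd w < d \<Longrightarrow>
      \<bar>\<Sum>m<d. s2 m * rsp v (fst v - int h - int k) m * rsp w (fst v - int h - int k) m\<bar> \<le> K * r ^ h * r ^ k"
proof -
  obtain c r where cr: "0 \<le> c" "0 < r" "r < 1"
    "\<And>k i m. i < d \<Longrightarrow> m < d \<Longrightarrow> \<bar>psi d p q A B k i m\<bar> \<le> c * r ^ k"
    using psi_bound by blast
  have "\<bar>\<Sum>m<d. s2 m * rsp v (fst v - int h - int k) m * rsp w (fst v - int h - int k) m\<bar>
      \<le> ((\<Sum>m<d. \<bar>s2 m\<bar>) * c * c) * r ^ h * r ^ k" if vw: "snd v < d" "snd w < d" for v w h k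
  proof -
    have "\<bar>\<Sum>m<d. s2 m * rsp v (fst v - int h - int k) m * rsp w (fst v - int h - int k) m\<bar> \<le>
       (\<Sum>m<d. \<bar>s2 m * rsp v (fst v - int h - int k) m * rsp w (fst v - int h - int k) m\<bar>)"
      by (rule sum_abs)
    also have "\<dots> \<le> (\<Sum>m<d. \<bar>s2 m\<bar> * (c * r ^ (h + k)) * c)"
    proof (rule sum_mono)
      fix m assume m: "m \<in> {..<d}"
      have 1: "\<bar>rsp v (fst v - int h - int k) m\<bar> \<le> c * r ^ (h + k)"
        using cr(4)[of "snd v" m "h + k"] vw m by (simp add: response_def nat_add_distrib)
      have "\<bar>rsp w u m\<bar> \<le> c" for u
      proof (cases "u \<le> fst w")
        case True
        have "\<bar>psi d p q A B (nat (fst w - u)) (snd w) m\<bar> \<le> c * r ^ nat (fst w - u)"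
          using cr(4) vw m by simp
        also have "\<dots> \<le> c * 1" using cr by (intro mult_left_mono power_le_one) auto
        finally show ?thesis using True by (simp add: response_def)
      qed (use cr in \<open>simp add: response_def\<close>)
      then show "\<bar>s2 m * rsp v (fst v - int h - int k) m * rsp w (fst v - int h - int k) m\<bar> \<le>
          \<bar>s2 m\<bar> * (c * r ^ (h + k)) * c"
        unfolding abs_mult using 1 cr by (intro mult_mono mult_nonneg_nonneg) auto
    qed
    also have "\<dots> = ((\<Sum>m<d. \<bar>s2 m\<bar>) * c * c) * r ^ h * r ^ k"
      by (simp add: sum_distrib_left sum_distrib_right power_add mult_ac)
    finally show ?thesis .
  qed
  then show ?thesis
    using cr by (intro that[of "(\<Sum>m<d. \<bar>s2 m\<bar>) * c * c" r]) (auto intro!: mult_nonneg_nonneg sum_nonneg)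
qed

text \<open>Innovations after \<open>fst v\<close> do not reach \<open>v\<close>, so an earlier
  start of the backward sum only prepends zeros. A common starting time is what symmetry and finite
  linear combinations of nodes require.\<close>

lemma autocov_sums:
  assumes "snd v < d" "snd w < d" "fst v \<le> T"
  shows "(\<lambda>k. \<Sum>m<d. s2 m * rsp v (T - int k) m * rsp w (T - int k) m) sums gam v w"
  using assms(3)
proof (induction T rule: int_ge_induct)
  case base
  obtain K r where K: "0 \<le> K" "0 < r" "r < 1"
    "\<And>v w h k. snd v < d \<Longrightarrow> snd w < d \<Longrightarrow>
      \<bar>\<Sum>m<d. s2 m * rsp v (fst v - int h - int k) m * rsp w (fst v - int h - int k) m\<bar> \<le> K * r ^ h * r ^ k"
    using autocov_term_bound by blast
  have "summable (\<lambda>k. \<Sum>m<d. s2 m * rsp v (fst v - int k) m * rsp w (fst v - int k) m)"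
    by (rule summable_comparison_test'[of "\<lambda>k. K * r ^ k" 0])
      (use K(4)[OF assms(1,2), of 0] K in \<open>auto intro!: summable_mult summable_geometric\<close>)
  then show ?case unfolding autocov_def by (rule summable_sums)
next
  case (step T)
  have "rsp v (T + 1) m = 0" for m using step by (simp add: response_def)
  moreover have "(\<lambda>k. \<Sum>m<d. s2 m * rsp v (T + 1 - int (Suc k)) m * rsp w (T + 1 - int (Suc k)) m) sums gam v w"
    using step.IH by simp
  ultimately show ?case by (subst (asm) sums_Suc_iff) simp
qed

lemma autocov_sym:
  assumes "snd v < d" "snd w < d"
  shows "gam v w = gam w v"
  using autocov_sums[of v w "max (fst v) (fst w)"] autocov_sums[of w v "max (fst v) (fst w)"] assms
  by (auto simp: mult_ac intro: sums_unique2)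

lemma autocov_decay:
  obtains K r where "0 \<le> K" "0 < r" "r < 1"
    "\<And>v w. snd v < d \<Longrightarrow> snd w < d \<Longrightarrow> \<bar>gam v w\<bar> \<le> K * r ^ nat \<bar>fst v - fst w\<bar>"
proof -
  obtain K r where K: "0 \<le> K" "0 < r" "r < 1"
    "\<And>v w h k. snd v < d \<Longrightarrow> snd w < d \<Longrightarrow>
      \<bar>\<Sum>m<d. s2 m * rsp v (fst v - int h - int k) m * rsp w (fst v - int h - int k) m\<bar> \<le> K * r ^ h * r ^ k"
    using autocov_term_bound by blast
  have *: "\<bar>gam v w\<bar> \<le> K / (1 - r) * r ^ nat \<bar>fst v - fst w\<bar>"
    if vw: "snd v < d" "snd w < d" "fst w \<le> fst v" for v w
  proof -
    define h where "h = nat (fst v - fst w)"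
    have h: "fst w = fst v - int h" using vw by (simp add: h_def)
    have s: "(\<lambda>k. \<Sum>m<d. s2 m * rsp v (fst w - int k) m * rsp w (fst w - int k) m) sums gam v w"
      using autocov_sums[of w v "fst w"] vw autocov_sym[of v w] by (simp add: mult_ac)
    have g: "(\<lambda>k. K * r ^ h * r ^ k) sums (K * r ^ h * (1 / (1 - r)))"
      by (intro sums_mult geometric_sums) (use K in auto)
    have "\<bar>gam v w\<bar> \<le> K * r ^ h * (1 / (1 - r))"
      unfolding sums_unique[OF s] sums_unique[OF g] real_norm_def[symmetric]
      by (rule norm_suminf_le) (use K(4)[OF vw(1,2), of h] h sums_summable[OF g] in auto)
    then show ?thesis using h by simp
  qed
  show ?thesis
  proof (rule that[of "K / (1 - r)" r])
    fix v w :: "int \<times> nat" assume vw: "snd v < d" "snd w < d"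
    show "\<bar>gam v w\<bar> \<le> K / (1 - r) * r ^ nat \<bar>fst v - fst w\<bar>"
      using *[OF vw] *[OF vw(2,1)] autocov_sym[OF vw] by (cases "fst w \<le> fst v") (auto simp: abs_minus_commute)
  qed (use K in auto)
qed

end

section \<open>Characteristic functions of the innovations and of the process\<close>

lemma normal_char:
  assumes "s > 0"
  shows "(CLINT x|density lborel (normal_density 0 s). iexp (a * x)) = complex_of_real (exp (- (a\<^sup>2 * s\<^sup>2) / 2))"
proof -
  let ?N = "density lborel (normal_density 0 s)"
  interpret N: prob_space ?N using assms by (rule prob_space_normal_density)
  have "distributed ?N lborel (\<lambda>x. x) (normal_density 0 s)"
    unfolding distributed_def by (auto simp: distr_id2)
  then have "distributed ?N lborel (\<lambda>x. (x - 0) / s) std_normal_density"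
    using N.normal_standard_normal_convert[OF assms, of "\<lambda>x. x" 0] by simp
  then have eq: "distr ?N lborel (\<lambda>x. x / s) = std_normal_distribution"
    by (simp add: distributed_def)
  have "(CLINT x|?N. iexp (a * x)) = (CLINT x|?N. iexp (a * s * (x / s)))"
    using assms by simp
  also have "\<dots> = (CLINT y|distr ?N lborel (\<lambda>x. x / s). iexp (a * s * y))"
    by (subst integral_distr) simp_all
  also have "\<dots> = char std_normal_distribution (a * s)" unfolding eq char_def ..
  finally show ?thesis by (simp add: char_std_normal_distribution power_mult_distrib)
qed

lemma prod_exp_half:
  "finite I \<Longrightarrow> (\<Prod>i\<in>I. complex_of_real (exp (- f i / 2))) = complex_of_real (exp (- (\<Sum>i\<in>I. f i) / 2))"
proof (induction I rule: finite_induct)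
  case (insert i I)
  have "- (f i + (\<Sum>i\<in>I. f i)) / 2 = - f i / 2 + - (\<Sum>i\<in>I. f i) / 2" by (simp add: field_simps)
  then show ?case using insert by (simp only: sum.insert prod.insert exp_add of_real_mult not_False_eq_True)
qed simp

lemma normal_diag_char:
  assumes "\<And>i. i < d \<Longrightarrow> s2 i > 0"
  shows "(CLINT x|normal_diag d s2. iexp (\<Sum>m<d. a m * x m)) = complex_of_real (exp (- (\<Sum>m<d. s2 m * (a m)\<^sup>2) / 2))"
proof -
  \<comment> \<open>The value 1 outside the index range makes every factor a probability measure, as
    the product locale demands; the product itself only sees \<open>i < d\<close>.\<close>
  let ?s = "\<lambda>i. if i < d then sqrt (s2 i) else 1"
  let ?N = "\<lambda>i. density lborel (normal_density 0 (?s i))"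
  have s: "?s i > 0" for i using assms by simp
  interpret N: prob_space "?N i" for i using s by (rule prob_space_normal_density)
  interpret product_sigma_finite ?N by standard
  have "normal_diag d s2 = (\<Pi>\<^sub>M i\<in>{..<d}. ?N i)"
    unfolding normal_diag_def by (intro PiM_cong) auto
  then have "(CLINT x|normal_diag d s2. iexp (\<Sum>m<d. a m * x m)) =
      (CLINT x|(\<Pi>\<^sub>M i\<in>{..<d}. ?N i). (\<Prod>m<d. iexp (a m * x m)))"
    by (simp add: exp_sum[symmetric] sum_distrib_left)
  also have "\<dots> = (\<Prod>m<d. (CLINT x|?N m. iexp (a m * x)))"
  proof (rule product_integral_prod)
    show "integrable (?N i) (\<lambda>x. iexp (a i * x))" for i
      by (rule N.integrable_const_bound[of _ 1]) auto
  qed simp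
  also have "\<dots> = (\<Prod>m<d. complex_of_real (exp (- (s2 m * (a m)\<^sup>2) / 2)))"
  proof (rule prod.cong[OF refl])
    fix m assume "m \<in> {..<d}"
    then show "(CLINT x|?N m. iexp (a m * x)) = complex_of_real (exp (- (s2 m * (a m)\<^sup>2) / 2))"
      unfolding normal_char[OF s] using assms[of m] by (simp add: mult.commute less_imp_le)
  qed
  finally show ?thesis by (simp only: prod_exp_half[OF finite_lessThan])
qed

locale stationary_solution = stable_coeffs d p q A B s2
  for d p q A B s2 +
  fixes M :: "'w measure" and \<epsilon> S :: "int \<Rightarrow> nat \<Rightarrow> 'w \<Rightarrow> real"
  assumes var_pos: "\<And>i. i < d \<Longrightarrow> s2 i > 0"
    and solution: "stationary_varma d p q A B s2 M \<epsilon> S"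
begin

sublocale prob_space M using solution by (simp add: stationary_varma_def)

definition Y :: "int \<Rightarrow> nat \<times> nat \<Rightarrow> 'w \<Rightarrow> real" where
  "Y t x \<omega> = (case x of (b, i) \<Rightarrow> if b \<le> p then S (t - int b) i \<omega> else \<epsilon> (t - int (b - Suc p)) i \<omega>)"

lemma S_measurable [measurable]: "i < d \<Longrightarrow> S t i \<in> borel_measurable M"
  using solution by (simp add: stationary_varma_def)

lemma \<epsilon>_indep:
  "indep_vars (\<lambda>_. \<Pi>\<^sub>M i\<in>{..<d}. borel) (\<lambda>t \<omega>. \<lambda>i\<in>{..<d}. \<epsilon> t i \<omega>) UNIV"
  using solution by (simp add: stationary_varma_def)

lemma \<epsilon>_vec_measurable: "(\<lambda>\<omega>. \<lambda>i\<in>{..<d}. \<epsilon> t i \<omega>) \<in> M \<rightarrow>\<^sub>M (\<Pi>\<^sub>M i\<in>{..<d}. borel)"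
  using \<epsilon>_indep by (simp add: indep_vars_def)

lemma \<epsilon>_measurable [measurable]: "i < d \<Longrightarrow> \<epsilon> t i \<in> borel_measurable M"
  using measurable_compose[OF \<epsilon>_vec_measurable measurable_component_singleton[of i]] by simp

lemma \<epsilon>_distr: "distr M (\<Pi>\<^sub>M i\<in>{..<d}. borel) (\<lambda>\<omega>. \<lambda>i\<in>{..<d}. \<epsilon> t i \<omega>) = normal_diag d s2"
  using solution by (simp add: stationary_varma_def)

lemma \<epsilon>_law: "i < d \<Longrightarrow> distr M borel (\<epsilon> t i) = distr M borel (\<epsilon> t' i)"
proof -
  assume i: "i < d"
  have "distr M borel (\<epsilon> t i) = distr (normal_diag d s2) borel (\<lambda>x. x i)" for t
    unfolding \<epsilon>_distr[of t, symmetric]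
    by (subst distr_distr[OF measurable_component_singleton \<epsilon>_vec_measurable])
      (use i in \<open>simp_all add: o_def\<close>)
  then show ?thesis by metis
qed

lemma path_measurable:
  "(\<lambda>\<omega>. \<lambda>(t, i)\<in>UNIV \<times> {..<d}. S t i \<omega>) \<in> M \<rightarrow>\<^sub>M (\<Pi>\<^sub>M v\<in>UNIV \<times> {..<d}. borel)"
  by (rule measurable_restrict) auto

lemma S_law: "i < d \<Longrightarrow> distr M borel (S t i) = distr M borel (S t' i)"
proof -
  assume i: "i < d"
  have pm: "(\<lambda>\<omega>. \<lambda>(t, i)\<in>UNIV \<times> {..<d}. S (t + h) i \<omega>) \<in> M \<rightarrow>\<^sub>M (\<Pi>\<^sub>M v\<in>UNIV \<times> {..<d}. borel)" for h
    by (rule measurable_restrict) auto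
  have "distr M borel (S (0 + h) i) = distr (path_law d M (\<lambda>t. S (t + h))) borel (\<lambda>x. x (0, i))" for h
    unfolding path_law_def
    by (subst distr_distr[OF measurable_component_singleton pm])
      (use i in \<open>simp_all add: o_def\<close>)
  moreover have "path_law d M (\<lambda>t. S (t + h)) = path_law d M S" for h
    using solution by (simp add: stationary_varma_def)
  ultimately show ?thesis by simp
qed

lemma Y_measurable [measurable]: "x \<in> X \<Longrightarrow> Y t x \<in> borel_measurable M"
  by (cases x) (auto simp: Y_def[abs_def] states_def)

text \<open>One-dimensional laws suffice, because the remainder of the iterated state equation is
  estimated component by component.\<close>

lemma Y_law: "x \<in> X \<Longrightarrow> distr M borel (Y t x) = distr M borel (Y t' x)"
proof -
  assume "x \<in> X"
  then obtain b i where x: "x = (b, i)" "i < d" by (auto simp: states_def)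
  show ?thesis
    using S_law[OF x(2), of "t - int b" "t' - int b"]
      \<epsilon>_law[OF x(2), of "t - int (b - Suc p)" "t' - int (b - Suc p)"]
    by (cases "b \<le> p") (simp_all add: Y_def[abs_def] x(1))
qed

lemma state_equation:
  "AE \<omega> in M. \<forall>x\<in>X. Y t x \<omega> = (\<Sum>y\<in>X. F x y * Y (t - 1) y \<omega>) + (\<Sum>m<d. input d p A x m * \<epsilon> t m \<omega>)"
proof -
  have "AE \<omega> in M. \<forall>i\<in>{..<d}. S t i \<omega> = (\<Sum>k\<le>p. \<Sum>j<d. A k $$ (i, j) * S (t - int k) j \<omega>)
          + \<epsilon> t i \<omega> + (\<Sum>l=1..q. \<Sum>j<d. B l $$ (i, j) * \<epsilon> (t - int l) j \<omega>)"
    by (rule AE_finite_allI) (use solution in \<open>simp_all add: stationary_varma_def\<close>)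
  then show ?thesis
  proof eventually_elim
    case (elim \<omega>)
    define y where "y = (\<lambda>i. (\<Sum>k=1..p. \<Sum>j<d. A k $$ (i, j) * S (t - int k) j \<omega>)
          + (\<Sum>l=1..q. \<Sum>j<d. B l $$ (i, j) * \<epsilon> (t - int l) j \<omega>) + \<epsilon> t i \<omega>)"
    have split: "{..p} = insert 0 {1..p}" by auto
    have "\<forall>i<d. S t i \<omega> - (\<Sum>m<d. A 0 $$ (i, m) * S t m \<omega>) = y i"
    proof (intro allI impI)
      fix i assume "i < d"
      then have "S t i \<omega> = (\<Sum>k\<le>p. \<Sum>j<d. A k $$ (i, j) * S (t - int k) j \<omega>)
          + \<epsilon> t i \<omega> + (\<Sum>l=1..q. \<Sum>j<d. B l $$ (i, j) * \<epsilon> (t - int l) j \<omega>)"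
        using elim by blast
      moreover have "(\<Sum>k\<le>p. \<Sum>j<d. A k $$ (i, j) * S (t - int k) j \<omega>) =
          (\<Sum>j<d. A 0 $$ (i, j) * S t j \<omega>) + (\<Sum>k=1..p. \<Sum>j<d. A k $$ (i, j) * S (t - int k) j \<omega>)"
        unfolding split by (subst sum.insert) simp_all
      ultimately show "S t i \<omega> - (\<Sum>m<d. A 0 $$ (i, m) * S t m \<omega>) = y i"
        unfolding y_def by linarith
    qed
    then have S: "S t i \<omega> = (\<Sum>m<d. inv_A0 d A i m * y m)" if "i < d" for i
      using inv_A0_solve[OF coeffs, of "\<lambda>i. S t i \<omega>" y] that by blast
    show ?case
    proof
      fix x assume x: "x \<in> X"
      obtain b i where bi: "x = (b, i)" "b < p + q + 2" "i < d" using x by (auto simp: states_def)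
      show "Y t x \<omega> = (\<Sum>y\<in>X. F x y * Y (t - 1) y \<omega>) + (\<Sum>m<d. input d p A x m * \<epsilon> t m \<omega>)"
      proof (cases "b = 0")
        case True
        have 1: "(\<Sum>k=1..p. \<Sum>j<d. A k $$ (m, j) * Y (t - 1) (k - 1, j) \<omega>) =
            (\<Sum>k=1..p. \<Sum>j<d. A k $$ (m, j) * S (t - int k) j \<omega>)" for m
          by (intro sum.cong refl) (auto simp: Y_def of_nat_diff)
        have 2: "(\<Sum>l=1..q. \<Sum>j<d. B l $$ (m, j) * Y (t - 1) (p + l, j) \<omega>) =
            (\<Sum>l=1..q. \<Sum>j<d. B l $$ (m, j) * \<epsilon> (t - int l) j \<omega>)" for m
          by (intro sum.cong refl) (auto simp: Y_def of_nat_diff)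
        have "(\<Sum>y\<in>X. F (0, i) y * Y (t - 1) y \<omega>) + (\<Sum>m<d. inv_A0 d A i m * \<epsilon> t m \<omega>) =
           (\<Sum>m<d. inv_A0 d A i m * y m)"
          unfolding companion_apply_top[OF bi(3)] 1 2 y_def by (simp add: sum.distrib distrib_left)
        then show ?thesis using True bi S[of i] by (simp add: Y_def input_def)
      next
        case False
        have "(\<Sum>y\<in>X. F (b, i) y * Y (t - 1) y \<omega>) = (if b = Suc p then 0 else Y (t - 1) (b - 1, i) \<omega>)"
          by (rule companion_apply_shift) (use bi False in auto)
        moreover have "(\<Sum>m<d. input d p A (b, i) m * \<epsilon> t m \<omega>) = (if b = Suc p then \<epsilon> t i \<omega> else 0)"
          using False bi by (simp add: input_def sum_kronecker)
        moreover have "Y (t - 1) (b - 1, i) \<omega> = Y t (b, i) \<omega>" if "b \<noteq> Suc p"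
        proof (cases "b \<le> p")
          case True
          then have "b - 1 \<le> p" "t - 1 - int (b - 1) = t - int b" using False by auto
          then show ?thesis using True by (simp only: Y_def prod.case if_True)
        next
          case 2: False
          then have "\<not> b - 1 \<le> p" "t - 1 - int (b - 1 - Suc p) = t - int (b - Suc p)"
            using that by auto
          then show ?thesis using 2 by (simp only: Y_def prod.case if_False)
        qed
        moreover have "Y t (Suc p, i) \<omega> = \<epsilon> t i \<omega>" by (simp add: Y_def)
        ultimately show ?thesis using bi(1) by (cases "b = Suc p") simp_all
      qed
    qed
  qed
qed

lemma state_iterate:
  "AE \<omega> in M. \<forall>x\<in>X. Y t x \<omega> = (\<Sum>k<n. \<Sum>m<d. Wr k x m * \<epsilon> (t - int k) m \<omega>) +
     (\<Sum>y\<in>X. fpow X F n x y * Y (t - int n) y \<omega>)"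
proof (induction n)
  case 0
  show ?case by (simp add: if_distrib[of "\<lambda>u. u * _"] cong: if_cong)
next
  case (Suc n)
  from Suc state_equation[of "t - int n"] show ?case
  proof eventually_elim
    case (elim \<omega>)
    show ?case
    proof
      fix x assume x: "x \<in> X"
      let ?Z = "\<lambda>y. Y (t - int (Suc n)) y \<omega>"
      have "(\<Sum>y\<in>X. fpow X F n x y * Y (t - int n) y \<omega>) =
          (\<Sum>y\<in>X. fpow X F n x y * ((\<Sum>z\<in>X. F y z * ?Z z) + (\<Sum>m<d. input d p A y m * \<epsilon> (t - int n) m \<omega>)))"
        using elim(2) by (intro sum.cong refl) (simp add: algebra_simps)
      also have "\<dots> = (\<Sum>y\<in>X. \<Sum>z\<in>X. fpow X F n x y * F y z * ?Z z) +
          (\<Sum>y\<in>X. \<Sum>m<d. fpow X F n x y * input d p A y m * \<epsilon> (t - int n) m \<omega>)"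
        by (simp add: distrib_left sum.distrib sum_distrib_left mult.assoc)
      also have "(\<Sum>y\<in>X. \<Sum>z\<in>X. fpow X F n x y * F y z * ?Z z) = (\<Sum>z\<in>X. fpow X F (Suc n) x z * ?Z z)"
        by (subst sum.swap) (simp add: sum_distrib_right)
      also have "(\<Sum>y\<in>X. \<Sum>m<d. fpow X F n x y * input d p A y m * \<epsilon> (t - int n) m \<omega>) =
          (\<Sum>m<d. Wr n x m * \<epsilon> (t - int n) m \<omega>)"
        by (subst sum.swap) (simp add: sum_distrib_right state_response_def)
      finally show "Y t x \<omega> = (\<Sum>k<Suc n. \<Sum>m<d. Wr k x m * \<epsilon> (t - int k) m \<omega>) +
          (\<Sum>y\<in>X. fpow X F (Suc n) x y * ?Z y)"
        using elim(1) x by simp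
    qed
  qed
qed

lemma noise_char:
  "(CLINT \<omega>|M. iexp (\<Sum>k<n. \<Sum>m<d. a k m * \<epsilon> (T - int k) m \<omega>)) =
    complex_of_real (exp (- (\<Sum>k<n. \<Sum>m<d. s2 m * (a k m)\<^sup>2) / 2))"
proof -
  define f where "f = (\<lambda>t x. iexp (\<Sum>m<d. a (nat (T - t)) m * x m))"
  define I where "I = (\<lambda>k. T - int k) ` {..<n}"
  have inj: "inj_on (\<lambda>k. T - int k) {..<n}" by (auto simp: inj_on_def)
  have f_meas: "f t \<in> borel_measurable (\<Pi>\<^sub>M i\<in>{..<d}. borel)" for t
    unfolding f_def by measurable
  have ind: "indep_vars (\<lambda>_. borel) (\<lambda>t \<omega>. f t (\<lambda>i\<in>{..<d}. \<epsilon> t i \<omega>)) I"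
    by (rule indep_vars_compose2[OF indep_vars_subset[OF \<epsilon>_indep] f_meas]) simp
  have f_eq: "f t (\<lambda>i\<in>{..<d}. \<epsilon> t i \<omega>) = iexp (\<Sum>m<d. a (nat (T - t)) m * \<epsilon> t m \<omega>)" for t \<omega>
    by (simp add: f_def)
  have "(CLINT \<omega>|M. iexp (\<Sum>k<n. \<Sum>m<d. a k m * \<epsilon> (T - int k) m \<omega>)) =
      (CLINT \<omega>|M. (\<Prod>k<n. f (T - int k) (\<lambda>i\<in>{..<d}. \<epsilon> (T - int k) i \<omega>)))"
    unfolding f_eq by (simp add: exp_sum[symmetric] sum_distrib_left)
  also have "\<dots> = (CLINT \<omega>|M. (\<Prod>t\<in>I. f t (\<lambda>i\<in>{..<d}. \<epsilon> t i \<omega>)))"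
    unfolding I_def by (simp add: prod.reindex[OF inj])
  also have "\<dots> = (\<Prod>t\<in>I. (CLINT \<omega>|M. f t (\<lambda>i\<in>{..<d}. \<epsilon> t i \<omega>)))"
  proof (rule indep_vars_lebesgue_integral[OF _ ind])
    show "finite I" by (simp add: I_def)
    show "integrable M (\<lambda>\<omega>. f t (\<lambda>i\<in>{..<d}. \<epsilon> t i \<omega>))" for t
      unfolding f_eq by (rule integrable_const_bound[of _ 1]) auto
  qed
  also have "\<dots> = (\<Prod>k<n. (CLINT \<omega>|M. f (T - int k) (\<lambda>i\<in>{..<d}. \<epsilon> (T - int k) i \<omega>)))"
    unfolding I_def by (simp add: prod.reindex[OF inj])
  also have "\<dots> = (\<Prod>k<n. complex_of_real (exp (- (\<Sum>m<d. s2 m * (a k m)\<^sup>2) / 2)))"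
  proof (rule prod.cong[OF refl])
    fix k
    have "(CLINT \<omega>|M. f (T - int k) (\<lambda>i\<in>{..<d}. \<epsilon> (T - int k) i \<omega>)) = (CLINT x|normal_diag d s2. f (T - int k) x)"
      unfolding \<epsilon>_distr[of "T - int k", symmetric]
      by (rule integral_distr[symmetric, OF \<epsilon>_vec_measurable f_meas])
    also have "\<dots> = complex_of_real (exp (- (\<Sum>m<d. s2 m * (a k m)\<^sup>2) / 2))"
      unfolding f_def using normal_diag_char[OF var_pos, where a = "a k"] by simp
    finally show "(CLINT \<omega>|M. f (T - int k) (\<lambda>i\<in>{..<d}. \<epsilon> (T - int k) i \<omega>)) =
       complex_of_real (exp (- (\<Sum>m<d. s2 m * (a k m)\<^sup>2) / 2))" .
  qed
  finally show ?thesis by (simp only: prod_exp_half[OF finite_lessThan])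
qed

text \<open>The state at time \<open>T n\<close> may run off into the past, but the law of each
  component stays the same, so coefficients tending to zero make the remainder negligible. The test
  quantity \<open>cmod (iexp _ - 1)\<close> is bounded and subadditive in the exponent, which
  replaces second moments of the solution.\<close>

lemma remainder_vanishes:
  assumes c: "\<And>y. y \<in> X \<Longrightarrow> (\<lambda>n. c n y) \<longlonglongrightarrow> 0"
  shows "(\<lambda>n. (\<integral>\<omega>. cmod (iexp (\<Sum>y\<in>X. c n y * Y (T n) y \<omega>) - 1) \<partial>M)) \<longlonglongrightarrow> 0"
proof (rule tendsto_sandwich[OF _ _ tendsto_const])
  let ?g = "\<lambda>n. \<Sum>y\<in>X. (\<integral>\<omega>. cmod (iexp (c n y * Y 0 y \<omega>) - 1) \<partial>M)"
  have le2: "cmod (iexp u - 1) \<le> 2" for u using norm_triangle_ineq4[of "iexp u" 1] by simp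
  have int: "integrable M (\<lambda>\<omega>. cmod (iexp (Z \<omega>) - 1))" if [measurable]: "Z \<in> borel_measurable M" for Z
    by (rule integrable_const_bound[of _ 2]) (use le2 in auto)
  show "\<forall>\<^sub>F n in sequentially. 0 \<le> (\<integral>\<omega>. cmod (iexp (\<Sum>y\<in>X. c n y * Y (T n) y \<omega>) - 1) \<partial>M)"
    by (intro always_eventually allI integral_nonneg_AE AE_I2) simp
  show "\<forall>\<^sub>F n in sequentially. (\<integral>\<omega>. cmod (iexp (\<Sum>y\<in>X. c n y * Y (T n) y \<omega>) - 1) \<partial>M) \<le> ?g n"
  proof (intro always_eventually allI)
    fix n
    have "(\<integral>\<omega>. cmod (iexp (\<Sum>y\<in>X. c n y * Y (T n) y \<omega>) - 1) \<partial>M) \<le>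
        (\<integral>\<omega>. (\<Sum>y\<in>X. cmod (iexp (c n y * Y (T n) y \<omega>) - 1)) \<partial>M)"
    proof (rule integral_mono)
      show "integrable M (\<lambda>\<omega>. cmod (iexp (\<Sum>y\<in>X. c n y * Y (T n) y \<omega>) - 1))"
        by (rule int) simp
      show "integrable M (\<lambda>\<omega>. \<Sum>y\<in>X. cmod (iexp (c n y * Y (T n) y \<omega>) - 1))"
        by (rule Bochner_Integration.integrable_sum, rule int) simp
      fix \<omega>
      have "cmod ((\<Prod>y\<in>X. iexp (c n y * Y (T n) y \<omega>)) - (\<Prod>y\<in>X. 1)) \<le>
          (\<Sum>y\<in>X. cmod (iexp (c n y * Y (T n) y \<omega>) - 1))"
        by (rule norm_prod_diff) simp_all
      then show "cmod (iexp (\<Sum>y\<in>X. c n y * Y (T n) y \<omega>) - 1) \<le> (\<Sum>y\<in>X. cmod (iexp (c n y * Y (T n) y \<omega>) - 1))"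
        by (simp add: exp_sum[symmetric] sum_distrib_left)
    qed
    also have "\<dots> = (\<Sum>y\<in>X. (\<integral>\<omega>. cmod (iexp (c n y * Y (T n) y \<omega>) - 1) \<partial>M))"
      by (rule Bochner_Integration.integral_sum, rule int) simp
    also have "\<dots> = ?g n"
    proof (rule sum.cong[OF refl])
      fix y assume y: "y \<in> X"
      have *: "(\<integral>\<omega>. cmod (iexp (c n y * Y t y \<omega>) - 1) \<partial>M) =
          (\<integral>x. cmod (iexp (c n y * x) - 1) \<partial>distr M borel (Y t y))" for t
        by (rule integral_distr[symmetric]) (use y in simp_all)
      show "(\<integral>\<omega>. cmod (iexp (c n y * Y (T n) y \<omega>) - 1) \<partial>M) = (\<integral>\<omega>. cmod (iexp (c n y * Y 0 y \<omega>) - 1) \<partial>M)"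
        unfolding * using Y_law[OF y, of "T n" 0] by simp
    qed
    finally show "(\<integral>\<omega>. cmod (iexp (\<Sum>y\<in>X. c n y * Y (T n) y \<omega>) - 1) \<partial>M) \<le> ?g n" .
  qed
  have "(\<lambda>n. (\<integral>\<omega>. cmod (iexp (c n y * Y 0 y \<omega>) - 1) \<partial>M)) \<longlonglongrightarrow> (\<integral>\<omega>. 0 \<partial>M)" if y: "y \<in> X" for y
  proof (rule integral_dominated_convergence[where w = "\<lambda>_. 2"])
    show "AE \<omega> in M. (\<lambda>n. cmod (iexp (c n y * Y 0 y \<omega>) - 1)) \<longlonglongrightarrow> 0"
    proof (rule AE_I2)
      fix \<omega>
      have "(\<lambda>n. \<bar>c n y * Y 0 y \<omega>\<bar>) \<longlonglongrightarrow> 0"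
        using tendsto_mult_left_zero[OF c[OF y], of "Y 0 y \<omega>"] by (rule tendsto_rabs_zero)
      then show "(\<lambda>n. cmod (iexp (c n y * Y 0 y \<omega>) - 1)) \<longlonglongrightarrow> 0"
      proof (rule Lim_null_comparison[rotated])
        show "\<forall>\<^sub>F n in sequentially. norm (cmod (iexp (c n y * Y 0 y \<omega>) - 1)) \<le> \<bar>c n y * Y 0 y \<omega>\<bar>"
          unfolding real_norm_def abs_norm_cancel by (intro always_eventually allI norm_iexp_minus_1_le)
      qed
    qed
    show "(\<lambda>\<omega>. cmod (iexp (c n y * Y 0 y \<omega>) - 1)) \<in> borel_measurable M" for n
      using Y_measurable[OF y, of 0] by simp
    show "AE \<omega> in M. norm (cmod (iexp (c n y * Y 0 y \<omega>) - 1)) \<le> 2" for n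
      by (rule AE_I2, unfold real_norm_def abs_norm_cancel) (rule le2)
  qed simp_all
  then have "?g \<longlonglongrightarrow> (\<Sum>y\<in>X. 0)" by (intro tendsto_sum) simp
  then show "?g \<longlonglongrightarrow> 0" by simp
qed

text \<open>Moves the truncated sum of a node from its own time to a common later time
  \<open>T\<close>; the terms in between vanish by causality.\<close>

lemma response_combination:
  assumes T: "fst v \<le> T" and n: "nat (T - fst v) \<le> n"
  shows "(\<Sum>k<n. \<Sum>m<d. rsp v (T - int k) m * \<epsilon> (T - int k) m \<omega>) =
    (\<Sum>k<n - nat (T - fst v). \<Sum>m<d. Wr k (0, snd v) m * \<epsilon> (fst v - int k) m \<omega>)"
proof -
  define D where "D = nat (T - fst v)"
  have fv: "fst v = T - int D" using T by (simp add: D_def)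
  have nat_int_diff: "nat (int k - int D) = k - D" for k by simp
  have "(\<Sum>k<n. \<Sum>m<d. rsp v (T - int k) m * \<epsilon> (T - int k) m \<omega>) =
      (\<Sum>k\<in>{D..<n}. \<Sum>m<d. rsp v (T - int k) m * \<epsilon> (T - int k) m \<omega>)"
    by (rule sum.mono_neutral_right) (auto simp: response_def fv)
  also have "\<dots> = (\<Sum>k<n - D. \<Sum>m<d. Wr k (0, snd v) m * \<epsilon> (fst v - int k) m \<omega>)"
    by (rule sum.reindex_bij_witness[of _ "\<lambda>k. k + D" "\<lambda>k. k - D"])
      (use n in \<open>auto simp: nat_int_diff response_def fv psi_def D_def[symmetric] of_nat_diff algebra_simps\<close>)
  finally show ?thesis by (simp add: D_def)
qed

text \<open>The iterated state equation splits the linear combination into a finite sum of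
  independent normal variables and a remainder. The characteristic function of the first converges
  to the Gaussian one and the second drops out, so every stationary solution has the same
  law.\<close>

lemma process_char:
  assumes W: "finite W" "W \<subseteq> UNIV \<times> {..<d}"
  shows "(CLINT \<omega>|M. iexp (\<Sum>v\<in>W. l v * S (fst v) (snd v) \<omega>)) =
    complex_of_real (exp (- (\<Sum>v\<in>W. \<Sum>w\<in>W. l v * l w * gam v w) / 2))"
proof -
  have Wd: "snd v < d" if "v \<in> W" for v using W that by auto
  obtain T where T: "\<And>v. v \<in> W \<Longrightarrow> fst v \<le> T"
    using W(1) by (metis Max_ge finite_imageI imageI)
  obtain t0 where t0: "\<And>v. v \<in> W \<Longrightarrow> t0 \<le> fst v"
    using W(1) by (metis Min_le finite_imageI imageI)
  \<comment> \<open>From \<open>N0\<close> on, the subtraction \<open>n - nat (T - fst v)\<close> is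
    not cut off at zero for any node of \<open>W\<close>.\<close>
  define N0 where "N0 = nat (T - t0)"
  have N0: "nat (T - fst v) \<le> N0" if "v \<in> W" for v using t0[OF that] by (simp add: N0_def)
  define H where "H = (\<lambda>k m. \<Sum>v\<in>W. l v * rsp v (T - int k) m)"
  define main where "main = (\<lambda>n \<omega>. \<Sum>k<n. \<Sum>m<d. H k m * \<epsilon> (T - int k) m \<omega>)"
  define c where "c = (\<lambda>n y. \<Sum>v\<in>W. l v * fpow X F (n - nat (T - fst v)) (0, snd v) y)"
  define rem where "rem = (\<lambda>n \<omega>. \<Sum>y\<in>X. c n y * Y (T - int n) y \<omega>)"
  define L where "L = (\<lambda>\<omega>. \<Sum>v\<in>W. l v * S (fst v) (snd v) \<omega>)"
  have [measurable]: "main n \<in> borel_measurable M" "rem n \<in> borel_measurable M" "L \<in> borel_measurable M" for n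
    using Wd unfolding main_def rem_def L_def by measurable
  have decomp: "AE \<omega> in M. L \<omega> = main n \<omega> + rem n \<omega>" if n: "N0 \<le> n" for n
  proof -
    have "AE \<omega> in M. \<forall>v\<in>W. \<forall>x\<in>X. Y (fst v) x \<omega> =
      (\<Sum>k<n - nat (T - fst v). \<Sum>m<d. Wr k x m * \<epsilon> (fst v - int k) m \<omega>) +
      (\<Sum>y\<in>X. fpow X F (n - nat (T - fst v)) x y * Y (fst v - int (n - nat (T - fst v))) y \<omega>)"
      by (intro AE_finite_allI W(1) state_iterate)
    then show ?thesis
    proof eventually_elim
      case (elim \<omega>)
      have S: "S (fst v) (snd v) \<omega> = (\<Sum>k<n. \<Sum>m<d. rsp v (T - int k) m * \<epsilon> (T - int k) m \<omega>) +
          (\<Sum>y\<in>X. fpow X F (n - nat (T - fst v)) (0, snd v) y * Y (T - int n) y \<omega>)" if v: "v \<in> W" for v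
      proof -
        have mem: "(0, snd v) \<in> X" using Wd[OF v] by (simp add: states_def)
        have t_eq: "fst v - int (n - nat (T - fst v)) = T - int n"
          using N0[OF v] n T[OF v] by (simp add: of_nat_diff)
        have Y_eq: "Y (fst v) (0, snd v) \<omega> = S (fst v) (snd v) \<omega>" by (simp add: Y_def)
        have le: "nat (T - fst v) \<le> n" using N0[OF v] n by simp
        from elim[rule_format, OF v mem] show ?thesis
          unfolding response_combination[OF T[OF v] le] t_eq Y_eq .
      qed
      have "L \<omega> = (\<Sum>v\<in>W. l v * (\<Sum>k<n. \<Sum>m<d. rsp v (T - int k) m * \<epsilon> (T - int k) m \<omega>)) +
          (\<Sum>v\<in>W. l v * (\<Sum>y\<in>X. fpow X F (n - nat (T - fst v)) (0, snd v) y * Y (T - int n) y \<omega>))"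
        unfolding L_def sum.distrib[symmetric] by (intro sum.cong refl) (simp add: S distrib_left)
      also have "(\<Sum>v\<in>W. l v * (\<Sum>k<n. \<Sum>m<d. rsp v (T - int k) m * \<epsilon> (T - int k) m \<omega>)) = main n \<omega>"
        unfolding main_def H_def sum_distrib_left sum_distrib_right
        by (subst sum.swap, intro sum.cong refl, subst sum.swap) (simp add: mult.assoc)
      also have "(\<Sum>v\<in>W. l v * (\<Sum>y\<in>X. fpow X F (n - nat (T - fst v)) (0, snd v) y * Y (T - int n) y \<omega>)) = rem n \<omega>"
        unfolding rem_def c_def sum_distrib_left sum_distrib_right
        by (subst sum.swap) (simp add: mult.assoc)
      finally show ?case .
    qed
  qed
  have c0: "(\<lambda>n. c n y) \<longlonglongrightarrow> 0" if y: "y \<in> X" for y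
  proof -
    obtain C r where cr: "0 \<le> C" "0 < r" "r < 1"
      "\<And>k x y. x \<in> X \<Longrightarrow> y \<in> X \<Longrightarrow> \<bar>fpow X F k x y\<bar> \<le> C * r ^ k"
      using fpow_companion_decay[OF coeffs root] by blast
    have "(\<lambda>n. fpow X F (n - D) (0, snd v) y) \<longlonglongrightarrow> 0" if v: "v \<in> W" for v D
    proof -
      have mem: "(0, snd v) \<in> X" using Wd[OF v] by (simp add: states_def)
      have "(\<lambda>n. C * r ^ n) \<longlonglongrightarrow> 0"
        by (rule tendsto_mult_right_zero) (use cr in \<open>auto intro!: LIMSEQ_realpow_zero\<close>)
      then have "(\<lambda>n. fpow X F n (0, snd v) y) \<longlonglongrightarrow> 0"
        by (rule Lim_null_comparison[rotated]) (use cr(4)[OF mem y] in auto)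
      then show ?thesis by (subst LIMSEQ_offset[of _ D]) (auto intro: LIMSEQ_offset[of _ D])
    qed
    then have "(\<lambda>n. c n y) \<longlonglongrightarrow> (\<Sum>v\<in>W. l v * 0)" unfolding c_def by (intro tendsto_intros)
    then show ?thesis by simp
  qed
  have int: "integrable M (\<lambda>\<omega>. iexp (Z \<omega>))" if [measurable]: "Z \<in> borel_measurable M" for Z
    by (rule integrable_const_bound[of _ 1]) auto
  define \<phi> where "\<phi> = (CLINT \<omega>|M. iexp (L \<omega>))"
  have "(\<lambda>n. \<phi> - (CLINT \<omega>|M. iexp (main n \<omega>))) \<longlonglongrightarrow> 0"
  proof (rule Lim_null_comparison)
    show "(\<lambda>n. (\<integral>\<omega>. cmod (iexp (rem n \<omega>) - 1) \<partial>M)) \<longlonglongrightarrow> 0"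
      unfolding rem_def by (rule remainder_vanishes[OF c0])
    show "\<forall>\<^sub>F n in sequentially. norm (\<phi> - (CLINT \<omega>|M. iexp (main n \<omega>))) \<le> (\<integral>\<omega>. cmod (iexp (rem n \<omega>) - 1) \<partial>M)"
      using eventually_ge_at_top[of N0]
    proof eventually_elim
      case (elim n)
      have i1: "integrable M (\<lambda>\<omega>. iexp (main n \<omega> + rem n \<omega>))" by (rule int) measurable
      have i2: "integrable M (\<lambda>\<omega>. iexp (main n \<omega>))" by (rule int) measurable
      have "\<phi> = (CLINT \<omega>|M. iexp (main n \<omega> + rem n \<omega>))"
        unfolding \<phi>_def by (rule integral_cong_AE) (use decomp[OF elim] in \<open>auto elim!: eventually_mono\<close>)
      then have "\<phi> - (CLINT \<omega>|M. iexp (main n \<omega>)) =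
          (CLINT \<omega>|M. iexp (main n \<omega> + rem n \<omega>) - iexp (main n \<omega>))"
        by (simp only: Bochner_Integration.integral_diff[OF i1 i2])
      also have "norm \<dots> \<le> (\<integral>\<omega>. norm (iexp (main n \<omega> + rem n \<omega>) - iexp (main n \<omega>)) \<partial>M)"
        by (rule integral_norm_bound)
      also have "\<dots> = (\<integral>\<omega>. cmod (iexp (rem n \<omega>) - 1) \<partial>M)"
      proof (rule Bochner_Integration.integral_cong[OF refl])
        fix \<omega>
        have "iexp (main n \<omega> + rem n \<omega>) - iexp (main n \<omega>) = iexp (main n \<omega>) * (iexp (rem n \<omega>) - 1)"
          by (simp add: algebra_simps exp_add)
        then show "norm (iexp (main n \<omega> + rem n \<omega>) - iexp (main n \<omega>)) = cmod (iexp (rem n \<omega>) - 1)"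
          by (simp only: norm_mult norm_exp_i_times mult_1)
      qed
      finally show ?case .
    qed
  qed
  then have lim1: "(\<lambda>n. CLINT \<omega>|M. iexp (main n \<omega>)) \<longlonglongrightarrow> \<phi>"
    using tendsto_diff[OF tendsto_const[of \<phi>]] by fastforce
  have sq: "(\<Sum>k<n. \<Sum>m<d. s2 m * (H k m)\<^sup>2) =
      (\<Sum>v\<in>W. \<Sum>w\<in>W. l v * l w * (\<Sum>k<n. \<Sum>m<d. s2 m * rsp v (T - int k) m * rsp w (T - int k) m))" for n
  proof -
    have "s2 m * (H k m)\<^sup>2 = (\<Sum>v\<in>W. \<Sum>w\<in>W. l v * l w * (s2 m * rsp v (T - int k) m * rsp w (T - int k) m))" for k m
      unfolding H_def power2_eq_square sum_product by (simp add: sum_distrib_left mult_ac)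
    then have "(\<Sum>k<n. \<Sum>m<d. s2 m * (H k m)\<^sup>2) =
       (\<Sum>k<n. \<Sum>m<d. \<Sum>v\<in>W. \<Sum>w\<in>W. l v * l w * (s2 m * rsp v (T - int k) m * rsp w (T - int k) m))"
      by simp
    also have "\<dots> = (\<Sum>k<n. \<Sum>v\<in>W. \<Sum>w\<in>W. \<Sum>m<d. l v * l w * (s2 m * rsp v (T - int k) m * rsp w (T - int k) m))"
      by (intro sum.cong refl, subst sum.swap, intro sum.cong refl, rule sum.swap)
    also have "\<dots> = (\<Sum>v\<in>W. \<Sum>w\<in>W. \<Sum>k<n. \<Sum>m<d. l v * l w * (s2 m * rsp v (T - int k) m * rsp w (T - int k) m))"
      by (subst sum.swap, intro sum.cong refl, rule sum.swap)
    finally show ?thesis by (simp add: sum_distrib_left)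
  qed
  have "(\<lambda>n. \<Sum>k<n. \<Sum>m<d. s2 m * (H k m)\<^sup>2) \<longlonglongrightarrow> (\<Sum>v\<in>W. \<Sum>w\<in>W. l v * l w * gam v w)"
    unfolding sq
    by (intro tendsto_sum tendsto_mult tendsto_const)
      (use autocov_sums Wd T in \<open>auto simp: sums_def\<close>)
  then have lim2: "(\<lambda>n. CLINT \<omega>|M. iexp (main n \<omega>)) \<longlonglongrightarrow>
      complex_of_real (exp (- (\<Sum>v\<in>W. \<Sum>w\<in>W. l v * l w * gam v w) / 2))"
    unfolding main_def noise_char by (intro tendsto_intros) auto
  show ?thesis using LIMSEQ_unique[OF lim1 lim2] by (simp only: \<phi>_def L_def)
qed

lemma path_law_char:
  assumes W: "finite W" "W \<subseteq> UNIV \<times> {..<d}"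
  shows "(CLINT x|path_law d M S. iexp (\<Sum>v\<in>W. l v * x v)) =
    complex_of_real (exp (- (\<Sum>v\<in>W. \<Sum>w\<in>W. l v * l w * gam v w) / 2))"
proof -
  have m: "(\<lambda>x. iexp (\<Sum>v\<in>W. l v * x v)) \<in> borel_measurable (\<Pi>\<^sub>M v\<in>UNIV \<times> {..<d}. (borel :: real measure))"
  proof -
    have [measurable]: "(\<lambda>x. x v) \<in> borel_measurable (\<Pi>\<^sub>M v\<in>UNIV \<times> {..<d}. (borel :: real measure))"
      if "v \<in> W" for v
      using that W(2) by (intro measurable_component_singleton) auto
    show ?thesis by measurable
  qed
  have "(CLINT x|path_law d M S. iexp (\<Sum>v\<in>W. l v * x v)) =
      (CLINT \<omega>|M. iexp (\<Sum>v\<in>W. l v * (\<lambda>(t, i)\<in>UNIV \<times> {..<d}. S t i \<omega>) v))"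
    unfolding path_law_def by (rule integral_distr[OF path_measurable m])
  also have "(\<lambda>\<omega>. \<Sum>v\<in>W. l v * (\<lambda>(t, i)\<in>UNIV \<times> {..<d}. S t i \<omega>) v) =
     (\<lambda>\<omega>. \<Sum>v\<in>W. l v * S (fst v) (snd v) \<omega>)"
    using W(2) by (intro ext sum.cong refl) (auto simp: case_prod_beta subset_iff)
  finally show ?thesis by (simp only: process_char[OF W])
qed

lemma cond_indep_imp_orthogonal:
  assumes ci: "cond_indep (path_law d M S) A' C' B'"
    and sub: "A' \<subseteq> UNIV \<times> {..<d}" "B' \<subseteq> UNIV \<times> {..<d}" "C' \<subseteq> UNIV \<times> {..<d}" and fin: "finite B'"
    and ac: "a \<in> A'" "c \<in> C'"
    and k: "\<And>b. b \<in> B' \<Longrightarrow> (\<Sum>v\<in>insert a B'. k v * gam v b) = 0"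
  shows "(\<Sum>v\<in>insert a B'. k v * gam v c) = 0"
proof (rule gaussian_cond_indep[OF _ _ _ path_law_char ci sub fin ac k])
  show "prob_space (path_law d M S)"
    unfolding path_law_def by (rule prob_space_distr[OF path_measurable])
  show "sets (path_law d M S) = sets (\<Pi>\<^sub>M v\<in>UNIV \<times> {..<d}. borel)"
    by (simp add: path_law_def)
qed (auto intro: autocov_sym)

end

subsection \<open>Minors of the covariance matrix as polynomials\<close>

text \<open>The state covariance \<open>P\<close> solves the Lyapunov equation \<open>P = F P F\<^sup>T + Q\<close>, a linear system whose
  solution by Cramer's rule has numerators polynomial in the parameters.\<close>

definition lyapunov ::
  "nat \<Rightarrow> nat \<Rightarrow> nat \<Rightarrow> (nat \<Rightarrow> real mat) \<Rightarrow> (nat \<Rightarrow> real mat) \<Rightarrow>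
   (nat \<times> nat) \<times> (nat \<times> nat) \<Rightarrow> (nat \<times> nat) \<times> (nat \<times> nat) \<Rightarrow> real" where
  "lyapunov d p q A B x y = (if x = y then 1 else 0) -
     companion d p q A B (fst x) (fst y) * companion d p q A B (snd x) (snd y)"

definition lyapunov_det :: "nat \<Rightarrow> nat \<Rightarrow> nat \<Rightarrow> (nat \<Rightarrow> real mat) \<Rightarrow> (nat \<Rightarrow> real mat) \<Rightarrow> real" where
  "lyapunov_det d p q A B = det_on (states d p q \<times> states d p q) (lyapunov d p q A B)"

text \<open>Lagged covariances of the state times \<open>lyapunov_det\<close>. Only lag 0 needs
  Cramer's rule; one more lag is one more multiplication by the companion matrix.\<close>

fun cov_num ::
  "nat \<Rightarrow> nat \<Rightarrow> nat \<Rightarrow> (nat \<Rightarrow> real mat) \<Rightarrow> (nat \<Rightarrow> real mat) \<Rightarrow> (nat \<Rightarrow> real) \<Rightarrow>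
   nat \<Rightarrow> nat \<times> nat \<Rightarrow> nat \<times> nat \<Rightarrow> real" where
  "cov_num d p q A B s2 0 z z' = det_on (states d p q \<times> states d p q)
     (\<lambda>x y. if y = (z, z') then \<Sum>m<d. s2 m * input d p A (fst x) m * input d p A (snd x) m
            else lyapunov d p q A B x y)"
| "cov_num d p q A B s2 (Suc h) z z' =
     (\<Sum>y\<in>states d p q. companion d p q A B z y * cov_num d p q A B s2 h y z')"

definition autocov_num ::
  "nat \<Rightarrow> nat \<Rightarrow> nat \<Rightarrow> (nat \<Rightarrow> real mat) \<Rightarrow> (nat \<Rightarrow> real mat) \<Rightarrow> (nat \<Rightarrow> real) \<Rightarrow>
   int \<times> nat \<Rightarrow> int \<times> nat \<Rightarrow> real" where
  "autocov_num d p q A B s2 v w =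
     (if fst w \<le> fst v then cov_num d p q A B s2 (nat (fst v - fst w)) (0, snd v) (0, snd w)
      else cov_num d p q A B s2 (nat (fst w - fst v)) (0, snd w) (0, snd v))"

text \<open>Up to the factor \<open>lyapunov_det ^ card (insert a D)\<close> this is the minor of the covariance matrix with rows
  \<open>{c} \<union> D\<close> and columns \<open>{a} \<union> D\<close>.\<close>

definition minor_num ::
  "nat \<Rightarrow> nat \<Rightarrow> nat \<Rightarrow> (nat \<Rightarrow> real mat) \<Rightarrow> (nat \<Rightarrow> real mat) \<Rightarrow> (nat \<Rightarrow> real) \<Rightarrow>
   int \<times> nat \<Rightarrow> int \<times> nat \<Rightarrow> (int \<times> nat) set \<Rightarrow> real" where
  "minor_num d p q A B s2 a c D =
     det_on (insert a D) (\<lambda>x y. autocov_num d p q A B s2 y (if x = a then c else x))"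

section \<open>The Lyapunov equation of the state covariance\<close>

context stable_coeffs
begin

abbreviation "G \<equiv> input d p A"

text \<open>The covariance of component \<open>x\<close> of the state with component
  \<open>y\<close> of the state \<open>h\<close> steps earlier.\<close>

definition cov :: "nat \<Rightarrow> nat \<times> nat \<Rightarrow> nat \<times> nat \<Rightarrow> real" where
  "cov h x y = (\<Sum>k. \<Sum>m<d. s2 m * Wr (k + h) x m * Wr k y m)"

lemma cov_summable:
  assumes "x \<in> X" "y \<in> X"
  shows "summable (\<lambda>k. \<Sum>m<d. s2 m * Wr (k + h) x m * Wr k y m)"
proof (rule summable_sum)
  fix m assume m: "m \<in> {..<d}"
  obtain c r where cr: "0 \<le> c" "0 < r" "r < 1"
    "\<And>k x m. x \<in> X \<Longrightarrow> m < d \<Longrightarrow> \<bar>Wr k x m\<bar> \<le> c * r ^ k"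
    using state_response_decay[OF coeffs root] by blast
  show "summable (\<lambda>k. s2 m * Wr (k + h) x m * Wr k y m)"
  proof (rule summable_comparison_test'[of "\<lambda>k. \<bar>s2 m\<bar> * c * c * r ^ k" 0])
    show "summable (\<lambda>k. \<bar>s2 m\<bar> * c * c * r ^ k)"
      using cr by (intro summable_mult summable_geometric) auto
    fix k
    have "\<bar>Wr (k + h) x m\<bar> \<le> c * r ^ (k + h)" using cr(4) assms m by simp
    also have "\<dots> \<le> c * 1" using cr by (intro mult_left_mono power_le_one) auto
    finally have "\<bar>s2 m\<bar> * \<bar>Wr (k + h) x m\<bar> * \<bar>Wr k y m\<bar> \<le> \<bar>s2 m\<bar> * c * (c * r ^ k)"
      using cr(4)[OF assms(2), of m k] m cr by (intro mult_mono) auto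
    then show "norm (s2 m * Wr (k + h) x m * Wr k y m) \<le> \<bar>s2 m\<bar> * c * c * r ^ k"
      by (simp add: abs_mult mult.assoc)
  qed
qed

lemma cov_Suc:
  assumes "x \<in> X" "y \<in> X"
  shows "cov (Suc h) x y = (\<Sum>z\<in>X. F x z * cov h z y)"
proof -
  have "(\<Sum>z\<in>X. F x z * cov h z y) = (\<Sum>z\<in>X. \<Sum>k. F x z * (\<Sum>m<d. s2 m * Wr (k + h) z m * Wr k y m))"
    unfolding cov_def by (intro sum.cong refl suminf_mult[symmetric] cov_summable assms)
  also have "\<dots> = (\<Sum>k. \<Sum>z\<in>X. F x z * (\<Sum>m<d. s2 m * Wr (k + h) z m * Wr k y m))"
    by (rule suminf_sum[symmetric]) (intro summable_mult cov_summable assms)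
  also have "\<dots> = cov (Suc h) x y"
    unfolding cov_def
  proof (rule arg_cong[where f = suminf], rule ext)
    fix k
    have "(\<Sum>z\<in>X. F x z * (\<Sum>m<d. s2 m * Wr (k + h) z m * Wr k y m)) =
        (\<Sum>m<d. \<Sum>z\<in>X. F x z * (s2 m * Wr (k + h) z m * Wr k y m))"
      by (simp only: sum_distrib_left) (rule sum.swap)
    also have "\<dots> = (\<Sum>m<d. s2 m * Wr (k + Suc h) x m * Wr k y m)"
      by (intro sum.cong refl)
        (simp add: state_response_Suc[OF assms(1)] sum_distrib_left sum_distrib_right mult_ac)
    finally show "(\<Sum>z\<in>X. F x z * (\<Sum>m<d. s2 m * Wr (k + h) z m * Wr k y m)) =
        (\<Sum>m<d. s2 m * Wr (k + Suc h) x m * Wr k y m)" .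
  qed
  finally show ?thesis by simp
qed

text \<open>The first term of the series is the contribution of the newest innovation; in the others
  each response is one step older, which is one multiplication by \<open>F\<close> on either
  side.\<close>

lemma cov_lyapunov:
  assumes "x \<in> X" "y \<in> X"
  shows "cov 0 x y = (\<Sum>m<d. s2 m * G x m * G y m) + (\<Sum>x'\<in>X. \<Sum>y'\<in>X. F x x' * F y y' * cov 0 x' y')"
proof -
  let ?t = "\<lambda>x y k. \<Sum>m<d. s2 m * Wr k x m * Wr k y m"
  have sm: "summable (?t x' y')" if "x' \<in> X" "y' \<in> X" for x' y'
    using cov_summable[OF that, of 0] by simp
  have "cov 0 x y = ?t x y 0 + (\<Sum>k. ?t x y (Suc k))"
    unfolding cov_def using suminf_split_head[OF sm[OF assms]] by simp
  also have "?t x y 0 = (\<Sum>m<d. s2 m * G x m * G y m)"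
    using assms by (simp add: state_response_0)
  also have "(\<Sum>k. ?t x y (Suc k)) = (\<Sum>k. \<Sum>x'\<in>X. \<Sum>y'\<in>X. F x x' * F y y' * ?t x' y' k)"
  proof (rule arg_cong[where f = suminf], rule ext)
    fix k
    have "?t x y (Suc k) = (\<Sum>m<d. \<Sum>x'\<in>X. \<Sum>y'\<in>X. F x x' * F y y' * (s2 m * Wr k x' m * Wr k y' m))"
    proof (rule sum.cong[OF refl])
      fix m
      have "s2 m * Wr (Suc k) x m * Wr (Suc k) y m =
          s2 m * ((\<Sum>x'\<in>X. F x x' * Wr k x' m) * (\<Sum>y'\<in>X. F y y' * Wr k y' m))"
        using assms by (simp add: state_response_Suc)
      also have "\<dots> = (\<Sum>x'\<in>X. \<Sum>y'\<in>X. F x x' * F y y' * (s2 m * Wr k x' m * Wr k y' m))"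
        unfolding sum_product unfolding sum_distrib_left by (intro sum.cong refl) (simp add: mult_ac)
      finally show "s2 m * Wr (Suc k) x m * Wr (Suc k) y m =
          (\<Sum>x'\<in>X. \<Sum>y'\<in>X. F x x' * F y y' * (s2 m * Wr k x' m * Wr k y' m))" .
    qed
    also have "\<dots> = (\<Sum>x'\<in>X. \<Sum>y'\<in>X. \<Sum>m<d. F x x' * F y y' * (s2 m * Wr k x' m * Wr k y' m))"
      by (subst sum.swap, intro sum.cong refl, rule sum.swap)
    finally show "?t x y (Suc k) = (\<Sum>x'\<in>X. \<Sum>y'\<in>X. F x x' * F y y' * ?t x' y' k)"
      by (simp add: sum_distrib_left)
  qed
  also have "\<dots> = (\<Sum>x'\<in>X. \<Sum>k. \<Sum>y'\<in>X. F x x' * F y y' * ?t x' y' k)"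
    by (rule suminf_sum) (intro summable_sum summable_mult sm)
  also have "\<dots> = (\<Sum>x'\<in>X. \<Sum>y'\<in>X. \<Sum>k. F x x' * F y y' * ?t x' y' k)"
    by (intro sum.cong refl suminf_sum summable_mult sm)
  also have "\<dots> = (\<Sum>x'\<in>X. \<Sum>y'\<in>X. F x x' * F y y' * cov 0 x' y')"
    unfolding cov_def by (intro sum.cong refl) (simp add: suminf_mult[OF sm])
  finally show ?thesis .
qed

lemma lyapunov_apply:
  assumes "x \<in> X" "y \<in> X"
  shows "(\<Sum>z\<in>X \<times> X. lyapunov d p q A B (x, y) z * V z) = V (x, y) - (\<Sum>x'\<in>X. \<Sum>y'\<in>X. F x x' * F y y' * V (x', y'))"
proof -
  have "(\<Sum>z\<in>X \<times> X. lyapunov d p q A B (x, y) z * V z) =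
      (\<Sum>z\<in>X \<times> X. (if (x, y) = z then 1 else 0) * V z) - (\<Sum>z\<in>X \<times> X. F x (fst z) * F y (snd z) * V z)"
    by (simp add: lyapunov_def left_diff_distrib sum_subtractf)
  also have "(\<Sum>z\<in>X \<times> X. (if (x, y) = z then 1 else 0) * V z) = V (x, y)"
    using assms by (simp add: if_distrib[of "\<lambda>u. u * _"] cong: if_cong)
  finally show ?thesis by (simp add: sum.cartesian_product case_prod_beta)
qed

text \<open>A kernel vector is a matrix with V = F V F^T. Iteration gives the same identity with the
  \<open>k\<close>-th powers of F, which tend to zero.\<close>

lemma lyapunov_det_nonzero: "lyapunov_det d p q A B \<noteq> 0"
proof
  assume "lyapunov_det d p q A B = 0"
  then obtain V where nz: "\<exists>z\<in>X \<times> X. V z \<noteq> 0"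
    and V: "\<forall>z\<in>X \<times> X. (\<Sum>y\<in>X \<times> X. lyapunov d p q A B z y * V y) = 0"
    unfolding lyapunov_det_def by (subst (asm) det_on_eq_0_iff) auto
  have fixV: "V (x, y) = (\<Sum>x'\<in>X. \<Sum>y'\<in>X. F x x' * F y y' * V (x', y'))" if "x \<in> X" "y \<in> X" for x y
    using V lyapunov_apply[OF that, of V] that by auto
  have iter: "V (x, y) = (\<Sum>x'\<in>X. \<Sum>y'\<in>X. fpow X F k x x' * fpow X F k y y' * V (x', y'))"
    if xy: "x \<in> X" "y \<in> X" for x y k
  proof (induction k)
    case 0
    have "(\<Sum>y'\<in>X. fpow X F 0 x x' * fpow X F 0 y y' * V (x', y')) = (if x = x' then V (x', y) else 0)" for x'
      using xy by (cases "x = x'") (simp_all add: if_distrib[of "\<lambda>u. u * _"] cong: if_cong)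
    then show ?case using xy by simp
  next
    case (Suc k)
    let ?P = "fpow X F k"
    have "V (x, y) = (\<Sum>x'\<in>X. \<Sum>y'\<in>X. ?P x x' * ?P y y' * (\<Sum>u\<in>X. \<Sum>w\<in>X. F x' u * F y' w * V (u, w)))"
      by (subst Suc) (intro sum.cong refl, simp only: fixV)
    also have "\<dots> = (\<Sum>x'\<in>X. \<Sum>y'\<in>X. \<Sum>u\<in>X. \<Sum>w\<in>X. (?P x x' * F x' u) * (?P y y' * F y' w) * V (u, w))"
      by (simp add: sum_distrib_left mult_ac)
    also have "\<dots> = (\<Sum>x'\<in>X. \<Sum>u\<in>X. \<Sum>y'\<in>X. \<Sum>w\<in>X. (?P x x' * F x' u) * (?P y y' * F y' w) * V (u, w))"
      by (rule sum.cong[OF refl], rule sum.swap)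
    also have "\<dots> = (\<Sum>u\<in>X. \<Sum>x'\<in>X. \<Sum>y'\<in>X. \<Sum>w\<in>X. (?P x x' * F x' u) * (?P y y' * F y' w) * V (u, w))"
      by (rule sum.swap)
    also have "\<dots> = (\<Sum>u\<in>X. \<Sum>x'\<in>X. \<Sum>w\<in>X. \<Sum>y'\<in>X. (?P x x' * F x' u) * (?P y y' * F y' w) * V (u, w))"
      by (rule sum.cong[OF refl], rule sum.cong[OF refl], rule sum.swap)
    also have "\<dots> = (\<Sum>u\<in>X. \<Sum>w\<in>X. \<Sum>x'\<in>X. \<Sum>y'\<in>X. (?P x x' * F x' u) * (?P y y' * F y' w) * V (u, w))"
      by (rule sum.cong[OF refl], rule sum.swap)
    also have "\<dots> = (\<Sum>u\<in>X. \<Sum>w\<in>X. fpow X F (Suc k) x u * fpow X F (Suc k) y w * V (u, w))"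
      by (simp only: fpow.simps sum_product) (simp only: sum_distrib_right)
    finally show ?case .
  qed
  obtain c r where cr: "0 \<le> c" "0 < r" "r < 1"
    "\<And>k x y. x \<in> X \<Longrightarrow> y \<in> X \<Longrightarrow> \<bar>fpow X F k x y\<bar> \<le> c * r ^ k"
    using fpow_companion_decay[OF coeffs root] by blast
  have P0: "(\<lambda>k. fpow X F k x y) \<longlonglongrightarrow> 0" if "x \<in> X" "y \<in> X" for x y
  proof (rule Lim_null_comparison)
    show "(\<lambda>k. c * r ^ k) \<longlonglongrightarrow> 0"
      by (rule tendsto_mult_right_zero) (use cr in \<open>auto intro!: LIMSEQ_realpow_zero\<close>)
  qed (use cr(4)[OF that] in auto)
  have "V (x, y) = 0" if xy: "x \<in> X" "y \<in> X" for x y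
  proof -
    have "(\<lambda>k. \<Sum>x'\<in>X. \<Sum>y'\<in>X. fpow X F k x x' * fpow X F k y y' * V (x', y')) \<longlonglongrightarrow>
        (\<Sum>x'\<in>X. \<Sum>y'\<in>X. 0 * 0 * V (x', y'))"
      by (intro tendsto_sum tendsto_mult tendsto_const P0 xy)
    then have "(\<lambda>k. V (x, y)) \<longlonglongrightarrow> 0" unfolding iter[OF xy, symmetric] by simp
    then show ?thesis by (simp add: LIMSEQ_const_iff)
  qed
  then show False using nz by auto
qed

lemma cov_num:
  assumes "x \<in> X" "y \<in> X"
  shows "cov_num d p q A B s2 h x y = cov h x y * lyapunov_det d p q A B"
  using assms
proof (induction h arbitrary: x)
  case 0
  have "(\<Sum>y\<in>X \<times> X. lyapunov d p q A B z y * (\<lambda>(x, y). cov 0 x y) y) = (\<Sum>m<d. s2 m * G (fst z) m * G (snd z) m)"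
    if z: "z \<in> X \<times> X" for z
  proof -
    obtain u w where uw: "z = (u, w)" "u \<in> X" "w \<in> X" using z by auto
    show ?thesis
      unfolding uw(1) lyapunov_apply[OF uw(2,3)] prod.case fst_conv snd_conv
      using cov_lyapunov[OF uw(2,3)] by simp
  qed
  from det_on_cramer[OF _ _ this, of "(x, y)"] 0 show ?case
    by (simp add: lyapunov_det_def)
next
  case (Suc h)
  then show ?case by (simp add: cov_Suc sum_distrib_right mult.assoc)
qed

lemma autocov_eq_cov:
  assumes "snd v < d" "snd w < d" "fst w \<le> fst v"
  shows "gam v w = cov (nat (fst v - fst w)) (0, snd v) (0, snd w)"
proof -
  define h where "h = nat (fst v - fst w)"
  have fv: "fst v = fst w + int h" using assms by (simp add: h_def)
  have "(\<lambda>k. \<Sum>m<d. s2 m * rsp w (fst w - int k) m * rsp v (fst w - int k) m) sums gam v w"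
    using autocov_sums[of w v "fst w"] assms autocov_sym[of v w] by simp
  also have "(\<lambda>k. \<Sum>m<d. s2 m * rsp w (fst w - int k) m * rsp v (fst w - int k) m) =
      (\<lambda>k. \<Sum>m<d. s2 m * Wr (k + h) (0, snd v) m * Wr k (0, snd w) m)"
    by (rule ext, intro sum.cong refl) (simp add: response_def psi_def fv nat_add_distrib add.commute mult_ac)
  finally show ?thesis unfolding cov_def h_def[symmetric] by (rule sums_unique)
qed

lemma autocov_num:
  assumes "snd v < d" "snd w < d"
  shows "autocov_num d p q A B s2 v w = gam v w * lyapunov_det d p q A B"
proof (cases "fst w \<le> fst v")
  case True
  then show ?thesis
    using assms autocov_eq_cov[OF assms True] by (simp add: autocov_num_def cov_num states_def)
next
  case False
  then show ?thesis
    using assms autocov_eq_cov[OF assms(2,1)] autocov_sym[OF assms] by (simp add: autocov_num_def cov_num states_def)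
qed

text \<open>Reduces the search for witnesses to a linear system with unknowns on
  \<open>insert a D\<close> and equations on \<open>insert c D\<close>, the form to which the
  maximum principle applies.\<close>

lemma minor_num_nonzero:
  assumes D: "finite D" "D \<subseteq> UNIV \<times> {..<d}" and ac: "snd a < d" "snd c < d" "a \<notin> D"
    and nondeg: "\<And>k. (\<And>x. x \<in> insert c D \<Longrightarrow> (\<Sum>y\<in>insert a D. k y * gam y x) = 0) \<Longrightarrow> (\<forall>y\<in>insert a D. k y = 0)"
  shows "minor_num d p q A B s2 a c D \<noteq> 0"
proof
  let ?\<Delta> = "lyapunov_det d p q A B"
  assume "minor_num d p q A B s2 a c D = 0"
  then obtain k where nz: "\<exists>y\<in>insert a D. k y \<noteq> 0"
    and k: "\<forall>x\<in>insert a D. (\<Sum>y\<in>insert a D. autocov_num d p q A B s2 y (if x = a then c else x) * k y) = 0"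
    unfolding minor_num_def by (subst (asm) det_on_eq_0_iff) (use D in auto)
  have "(\<Sum>y\<in>insert a D. k y * gam y x) = 0" if x: "x \<in> insert c D" for x
  proof -
    have xd: "snd x < d" using x D ac by auto
    have "(\<Sum>y\<in>insert a D. autocov_num d p q A B s2 y x * k y) = 0"
    proof (cases "x = c")
      case True
      then show ?thesis using k by auto
    next
      case False
      then have "x \<in> D" "x \<noteq> a" using x ac(3) by auto
      then show ?thesis using bspec[OF k, of x] by auto
    qed
    also have "(\<Sum>y\<in>insert a D. autocov_num d p q A B s2 y x * k y) = (\<Sum>y\<in>insert a D. k y * gam y x) * ?\<Delta>"
      unfolding sum_distrib_right
      by (intro sum.cong refl, subst autocov_num) (use D ac xd in auto)
    finally show ?thesis using lyapunov_det_nonzero by simp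
  qed
  then show False using nondeg nz by blast
qed

end

text \<open>With a nonzero minor the linear system could be solved for a combination of
  \<open>insert a D\<close> that is uncorrelated with \<open>D\<close> but not with
  \<open>c\<close>, against the orthogonality that conditional independence enforces.\<close>

lemma (in stationary_solution) cond_indep_imp_minor_num_0:
  assumes ci: "cond_indep (path_law d M S) A' C' D"
    and sub: "A' \<subseteq> UNIV \<times> {..<d}" "D \<subseteq> UNIV \<times> {..<d}" "C' \<subseteq> UNIV \<times> {..<d}" and fin: "finite D"
    and ac: "a \<in> A'" "c \<in> C'" "a \<notin> D"
  shows "minor_num d p q A B s2 a c D = 0"
proof (rule ccontr)
  let ?\<Delta> = "lyapunov_det d p q A B"
  assume "minor_num d p q A B s2 a c D \<noteq> 0"
  then obtain k where k: "\<forall>x\<in>insert a D. (\<Sum>y\<in>insert a D. autocov_num d p q A B s2 y (if x = a then c else x) * k y) =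
      (if x = a then 1 else 0)"
    unfolding minor_num_def
    using det_on_solvable[of "insert a D" _ "\<lambda>x. if x = a then 1 else 0"] fin by blast
  have scale: "(\<Sum>y\<in>insert a D. autocov_num d p q A B s2 y x * k y) = (\<Sum>y\<in>insert a D. k y * gam y x) * ?\<Delta>"
    if "snd x < d" for x
    unfolding sum_distrib_right
    by (intro sum.cong refl, subst autocov_num) (use sub ac that in auto)
  have "(\<Sum>y\<in>insert a D. k y * gam y b) = 0" if b: "b \<in> D" for b
  proof -
    have "(\<Sum>y\<in>insert a D. autocov_num d p q A B s2 y b * k y) = 0"
    proof -
      have "b \<noteq> a" using b ac(3) by auto
      then show ?thesis using bspec[OF k, of b] b by simp
    qed
    then show ?thesis using scale[of b] b sub lyapunov_det_nonzero by auto
  qed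
  from cond_indep_imp_orthogonal[OF ci sub fin ac(1,2) this]
  have "(\<Sum>y\<in>insert a D. k y * gam y c) = 0" .
  moreover have "(\<Sum>y\<in>insert a D. autocov_num d p q A B s2 y c * k y) = 1"
    using bspec[OF k, of a] by simp
  ultimately show False using scale[of c] ac sub by auto
qed

text \<open>Nothing is ever divided: the adjugate stands for the inverse of \<open>1 - A 0\<close>,
  and Cramer numerators stand for the solution of the Lyapunov equation.\<close>

lemma polyfun_minor_num:
  assumes A: "\<And>k x. A x k \<in> carrier_mat d d"
    and polA: "\<And>k i j. k \<le> p \<Longrightarrow> i < d \<Longrightarrow> j < d \<Longrightarrow> polyfun (\<lambda>x. A x k $$ (i, j))"
    and polB: "\<And>l i j. 1 \<le> l \<Longrightarrow> l \<le> q \<Longrightarrow> i < d \<Longrightarrow> j < d \<Longrightarrow> polyfun (\<lambda>x. B x l $$ (i, j))"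
    and pols: "\<And>m. m < d \<Longrightarrow> polyfun (\<lambda>x. s2 x m)"
    and D: "finite D" "D \<subseteq> UNIV \<times> {..<d}" and ac: "snd a < d" "snd c < d"
  shows "polyfun (\<lambda>x. minor_num d p q (A x) (B x) (s2 x) a c D)"
proof -
  have inv: "polyfun (\<lambda>x. inv_A0 d (A x) i j)" if ij: "i < d" "j < d" for i j
  proof -
    have dims: "dim_row (1\<^sub>m d - A x 0) = d" "dim_col (1\<^sub>m d - A x 0) = d" for x
      using A[of x 0] by auto
    have "inv_A0 d (A x) i j = (-1) ^ (j + i) * Determinant.det (Matrix.mat (d - 1) (d - 1)
        (\<lambda>(i', j'). (1\<^sub>m d - A x 0) $$ (if i' < j then i' else Suc i', if j' < i then j' else Suc j')))" for x
      unfolding inv_A0_def adj_mat_def cofactor_def mat_delete_def dims using ij by simp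
    moreover have "polyfun (\<lambda>x. (-1) ^ (j + i) * Determinant.det (Matrix.mat (d - 1) (d - 1)
        (\<lambda>(i', j'). (1\<^sub>m d - A x 0) $$ (if i' < j then i' else Suc i', if j' < i then j' else Suc j'))))"
    proof (intro polyfun.mult polyfun.const polyfun_det)
      fix i' j' assume "i' < d - 1" "j' < d - 1"
      then have lt: "(if i' < j then i' else Suc i') < d" "(if j' < i then j' else Suc j') < d" by auto
      have "(1\<^sub>m d - A x 0) $$ (if i' < j then i' else Suc i', if j' < i then j' else Suc j') =
        1\<^sub>m d $$ (if i' < j then i' else Suc i', if j' < i then j' else Suc j') -
        A x 0 $$ (if i' < j then i' else Suc i', if j' < i then j' else Suc j')" for x
        using A[of x 0] lt by (intro index_minus_mat) auto
      then show "polyfun (\<lambda>x. (1\<^sub>m d - A x 0) $$ (if i' < j then i' else Suc i', if j' < i then j' else Suc j'))"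
        using polyfun_diff[OF polyfun.const polA[OF _ lt]] by simp
    qed
    ultimately show ?thesis by simp
  qed
  have comp: "polyfun (\<lambda>x. companion d p q (A x) (B x) y z)"
    if mem: "y \<in> states d p q" "z \<in> states d p q" for y z
  proof -
    obtain b i b' j where yz: "y = (b, i)" "z = (b', j)" "i < d" "j < d" using mem by (auto simp: states_def)
    show ?thesis
      unfolding companion_def yz(1,2) prod.case
    proof (cases "b = 0")
      case True
      consider "b' < p" | "\<not> b' < p" "p < b' \<and> b' \<le> p + q" | "\<not> b' < p" "\<not> (p < b' \<and> b' \<le> p + q)" by blast
      then show "polyfun (\<lambda>x. if b = 0
           then if b' < p then \<Sum>m<d. inv_A0 d (A x) i m * A x (Suc b') $$ (m, j)
                else if p < b' \<and> b' \<le> p + q then \<Sum>m<d. inv_A0 d (A x) i m * B x (b' - p) $$ (m, j) else 0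
           else if b = Suc p then 0 else if Suc b' = b \<and> i = j then 1 else 0)"
      proof cases
        case 1
        then show ?thesis using True yz by (simp, intro polyfun_sum polyfun.mult inv polA) auto
      next
        case 2
        then show ?thesis using True yz by (simp, intro polyfun_sum polyfun.mult inv polB) auto
      next
        case 3
        then have "(\<lambda>x. if b = 0
           then if b' < p then \<Sum>m<d. inv_A0 d (A x) i m * A x (Suc b') $$ (m, j)
                else if p < b' \<and> b' \<le> p + q then \<Sum>m<d. inv_A0 d (A x) i m * B x (b' - p) $$ (m, j) else 0
           else if b = Suc p then 0 else if Suc b' = b \<and> i = j then 1 else 0) = (\<lambda>x. 0)"
          using True by auto
        then show ?thesis by (simp only: polyfun.const)
      qed
    qed (simp add: polyfun.const)
  qed
  have inp: "polyfun (\<lambda>x. input d p (A x) y m)" if "y \<in> states d p q" "m < d" for y m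
    using that by (cases y; cases "fst y = 0") (auto simp: input_def states_def polyfun.const inv)
  have lyap: "polyfun (\<lambda>x. lyapunov d p q (A x) (B x) y z)"
    if "y \<in> states d p q \<times> states d p q" "z \<in> states d p q \<times> states d p q" for y z
    unfolding lyapunov_def using that
    by (intro polyfun_diff polyfun.const polyfun.mult comp) auto
  have cn: "polyfun (\<lambda>x. cov_num d p q (A x) (B x) (s2 x) h y z)"
    if "y \<in> states d p q" "z \<in> states d p q" for h y z
    using that
  proof (induction h arbitrary: y)
    case 0
    show ?case unfolding cov_num.simps
    proof (rule polyfun_det_on)
      fix u w assume uw: "u \<in> states d p q \<times> states d p q" "w \<in> states d p q \<times> states d p q"
      show "polyfun (\<lambda>x. if w = (y, z) then \<Sum>m<d. s2 x m * input d p (A x) (fst u) m * input d p (A x) (snd u) m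
            else lyapunov d p q (A x) (B x) u w)"
      proof (cases "w = (y, z)")
        case True
        then show ?thesis using uw by (simp, intro polyfun_sum polyfun.mult inp pols) auto
      next
        case False
        then show ?thesis using lyap[OF uw] by simp
      qed
    qed simp
  next
    case (Suc h)
    then show ?case unfolding cov_num.simps by (intro polyfun_sum polyfun.mult comp) auto
  qed
  have an: "polyfun (\<lambda>x. autocov_num d p q (A x) (B x) (s2 x) v w)" if "snd v < d" "snd w < d" for v w
    unfolding autocov_num_def using that by (cases "fst w \<le> fst v") (auto simp: states_def intro!: cn)
  show ?thesis
    unfolding minor_num_def
    by (rule polyfun_det_on) (use D ac in \<open>auto intro!: an\<close>)
qed

subsection \<open>Open paths\<close>

fun reverse_kind :: "edge_kind \<Rightarrow> edge_kind" where
  "reverse_kind Fwd = Bwd"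
| "reverse_kind Bwd = Fwd"
| "reverse_kind Bi = Bi"

lemma joined_reverse:
  "sym (bidirected G) \<Longrightarrow> joined G v (reverse_kind k) w \<longleftrightarrow> joined G w k v"
  by (cases k) (auto dest: symD)

lemma head_reverse [simp]:
  "head_at_target (reverse_kind k) \<longleftrightarrow> head_at_source k"
  "head_at_source (reverse_kind k) \<longleftrightarrow> head_at_target k"
  by (cases k; simp add: head_at_target_def head_at_source_def)+

text \<open>Lets an open path be read from its earlier end, since \<open>linked\<close> orders the
  two end nodes by time.\<close>

lemma is_path_reverse:
  assumes "sym (bidirected G)" "is_path G vs ks"
  shows "is_path G (rev vs) (rev (map reverse_kind ks))"
  unfolding is_path_def
proof (intro conjI allI impI)
  have len: "length vs = Suc (length ks)" using assms(2) by (simp add: is_path_def)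
  show "length (rev vs) = Suc (length (rev (map reverse_kind ks)))" using len by simp
  show "distinct (rev vs)" "set (rev vs) \<subseteq> nodes G" using assms(2) by (simp_all add: is_path_def)
  fix n assume n: "n < length (rev (map reverse_kind ks))"
  define m where "m = length ks - Suc n"
  have m: "m < length ks" "length ks - n = Suc m" using n by (auto simp: m_def)
  have "joined G (vs ! m) (ks ! m) (vs ! Suc m)" using assms(2) m by (simp add: is_path_def)
  then have "joined G (vs ! Suc m) (reverse_kind (ks ! m)) (vs ! m)" by (simp add: joined_reverse[OF assms(1)])
  then show "joined G (rev vs ! n) (rev (map reverse_kind ks) ! n) (rev vs ! Suc n)"
    using n m len by (simp add: rev_nth m_def)
qed

lemma blocked_reverse:
  assumes len: "length vs = Suc (length ks)" and "blocked G (rev vs) (rev (map reverse_kind ks)) B"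
  shows "blocked G vs ks B"
proof -
  obtain n where n: "0 < n" "n < length ks"
    and bl: "(\<not> collider_at (rev (map reverse_kind ks)) n \<and> rev vs ! n \<in> B) \<or>
         (collider_at (rev (map reverse_kind ks)) n \<and> DE G (rev vs ! n) \<inter> B = {})"
    using assms(2) by (auto simp: blocked_def)
  define m where "m = length ks - n"
  have m: "0 < m" "m < length ks" using n by (auto simp: m_def)
  have "rev vs ! n = vs ! m" using n len by (simp add: rev_nth m_def)
  moreover have "rev (map reverse_kind ks) ! n = reverse_kind (ks ! (m - 1))"
    using n by (simp add: rev_nth m_def)
  moreover have "rev (map reverse_kind ks) ! (n - 1) = reverse_kind (ks ! m)"
    using n by (simp add: rev_nth m_def)
  ultimately have "collider_at (rev (map reverse_kind ks)) n \<longleftrightarrow> collider_at ks m"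
    "rev vs ! n = vs ! m"
    by (auto simp: collider_at_def)
  then show ?thesis using bl m unfolding blocked_def by auto
qed

lemma path_ends: "length vs = Suc n \<Longrightarrow> hd vs = vs ! 0 \<and> last vs = vs ! n"
  using hd_conv_nth[of vs] last_conv_nth[of vs] by (cases "vs = []") auto

text \<open>The last visit of a path to the half line up to \<open>x\<close>. From then on all
  vertices are later than \<open>x\<close>, which restricts the kind of edge used for the
  crossing.\<close>

lemma last_index_below:
  fixes f :: "nat \<Rightarrow> int"
  assumes "f 0 \<le> x" "x < f N"
  obtains m where "m < N" "f m \<le> x" "\<And>j. m < j \<Longrightarrow> j \<le> N \<Longrightarrow> x < f j"
proof -
  define m where "m = Max {j. j \<le> N \<and> f j \<le> x}"
  have fin: "finite {j. j \<le> N \<and> f j \<le> x}" by simp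
  have "m \<in> {j. j \<le> N \<and> f j \<le> x}" unfolding m_def using assms by (intro Max_in fin) auto
  moreover have "x < f j" if "m < j" "j \<le> N" for j
    using Max_ge[OF fin, of j] that unfolding m_def[symmetric] by force
  ultimately show ?thesis using assms by (intro that[of m]) (auto simp: le_less)
qed

lemma directed_full_time_iff:
  "(v, w) \<in> directed (full_time_admg d p q A B) \<longleftrightarrow>
     (\<exists>k\<le>p. fst v = fst w - int k \<and> snd w < d \<and> snd v < d \<and> A k $$ (snd w, snd v) \<noteq> 0)"
  by (cases v; cases w) (auto simp: full_time_admg_def full_edges_def)

lemma nodes_full_time [simp]: "nodes (full_time_admg d p q A B) = UNIV \<times> {..<d}"
  by (simp add: full_time_admg_def)

lemma sym_bidirected_full_time: "sym (bidirected (full_time_admg d p q A B))"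
  by (auto simp: sym_def full_time_admg_def)

lemma innov_edge_time:
  "(Innov r m, Endo t i) \<in> full_edges d p q A B \<Longrightarrow> r \<le> t \<and> t \<le> r + int q"
  by (auto simp: full_edges_def)

lemma bidirected_time:
  "(v, w) \<in> bidirected (full_time_admg d p q A B) \<Longrightarrow> \<bar>fst v - fst w\<bar> \<le> int q"
  by (cases v; cases w) (auto simp: full_time_admg_def dest!: innov_edge_time)

lemma no_bidirected_without_ma:
  "bidirected (full_time_admg d p 0 A B) = {}"
  by (auto simp: full_time_admg_def full_edges_def)

lemma joined_time:
  assumes "joined (full_time_admg d p q A B) v k w"
  shows "k = Fwd \<Longrightarrow> fst v \<le> fst w \<and> fst w \<le> fst v + int p"
    "k = Bwd \<Longrightarrow> fst w \<le> fst v \<and> fst v \<le> fst w + int p"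
    "k = Bi \<Longrightarrow> \<bar>fst v - fst w\<bar> \<le> int q"
proof -
  show "fst v \<le> fst w \<and> fst w \<le> fst v + int p" if "k = Fwd"
    using assms that directed_full_time_iff[of v w d p q A B] by auto
  show "fst w \<le> fst v \<and> fst v \<le> fst w + int p" if "k = Bwd"
    using assms that directed_full_time_iff[of w v d p q A B] by auto
  show "\<bar>fst v - fst w\<bar> \<le> int q" if "k = Bi"
    using assms that bidirected_time[of v w d p q A B] by simp
qed

text \<open>A path open given \<open>B\<close> that leaves the half line up to time \<open>x\<close> for good enters the window
  \<open>(x, x + p]\<close> along a forward edge; if all nodes of that window were in \<open>B\<close>, the entrance would be a
  collider whose next vertex is a non-collider in \<open>B\<close>.\<close>

lemma open_path_gap_ar:
  assumes path: "is_path (full_time_admg d p 0 A B) vs ks"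
    and open': "\<not> blocked (full_time_admg d p 0 A B) vs ks D"
    and x: "fst (hd vs) \<le> x" "x < fst (last vs)"
  shows "fst (last vs) \<le> x + int p \<or> (\<exists>v. snd v < d \<and> v \<notin> D \<and> x < fst v \<and> fst v \<le> x + int p)"
proof (rule ccontr)
  let ?G = "full_time_admg d p 0 A B"
  assume "\<not> ?thesis"
  then have far: "x + int p < fst (last vs)"
    and inD: "\<And>v. snd v < d \<Longrightarrow> x < fst v \<Longrightarrow> fst v \<le> x + int p \<Longrightarrow> v \<in> D" by auto
  define N where "N = length ks"
  have len: "length vs = Suc N"
    and joined: "\<And>n. n < N \<Longrightarrow> joined ?G (vs ! n) (ks ! n) (vs ! Suc n)"
    using path by (auto simp: is_path_def N_def)
  have nodes: "snd (vs ! n) < d" if "n \<le> N" for n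
  proof -
    have "vs ! n \<in> set vs" using that len by simp
    then show ?thesis using path by (auto simp: is_path_def mem_Times_iff)
  qed
  have ends: "hd vs = vs ! 0" "last vs = vs ! N"
    using path_ends[OF len] by simp_all
  have noBi: "ks ! n \<noteq> Bi" if "n < N" for n
    using joined[OF that] no_bidirected_without_ma[of d p A B] by auto
  obtain m where m: "m < N" "fst (vs ! m) \<le> x" "\<And>j. m < j \<Longrightarrow> j \<le> N \<Longrightarrow> x < fst (vs ! j)"
    using last_index_below[of "\<lambda>n. fst (vs ! n)" x N] x ends by auto
  have m1: "x < fst (vs ! Suc m)" using m by simp
  have k1: "ks ! m = Fwd"
    using joined_time(2)[OF joined[OF m(1)]] noBi[OF m(1)] m m1 by (cases "ks ! m") auto
  have t1: "fst (vs ! Suc m) \<le> x + int p" using joined_time(1)[OF joined[OF m(1)] k1] m by simp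
  have ne: "Suc m \<noteq> N" using t1 far ends by auto
  then have lt: "Suc m < N" using m by simp
  have "vs ! Suc m \<in> D" using inD m1 t1 nodes lt by simp
  then have "collider_at ks (Suc m)" using open' lt unfolding blocked_def N_def by auto
  then have k2: "ks ! Suc m = Bwd" using noBi[OF lt] by (auto simp: collider_at_def head_at_source_def)
  have t2: "fst (vs ! Suc (Suc m)) \<le> x + int p" using joined_time(2)[OF joined[OF lt] k2] t1 by simp
  have ne2: "Suc (Suc m) \<noteq> N" using t2 far ends by auto
  then have lt2: "Suc (Suc m) < N" using lt by simp
  have "vs ! Suc (Suc m) \<in> D" using inD[OF nodes _ t2] m(3)[of "Suc (Suc m)"] lt2 by simp
  moreover have "\<not> collider_at ks (Suc (Suc m))" using k2 by (simp add: collider_at_def head_at_target_def)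
  ultimately show False using open' lt2 unfolding blocked_def N_def by auto
qed

text \<open>For \<open>p = 0\<close> all directed edges come from \<open>A 0\<close>. Descendants of
  a collider therefore stay in its time slice, and a window free of \<open>D\<close> blocks every
  collider in it.\<close>

lemma DE_same_time:
  "w \<in> DE (full_time_admg d 0 q A B) v \<Longrightarrow> fst w = fst v"
proof -
  assume "w \<in> DE (full_time_admg d 0 q A B) v"
  then have "(v, w) \<in> (directed (full_time_admg d 0 q A B))\<^sup>*" by (simp add: DE_def)
  then show ?thesis
  proof (induction rule: rtrancl_induct)
    case (step y z)
    then show ?case using directed_full_time_iff[of y z d 0 q A B] by auto
  qed simp
qed

text \<open>Without autoregressive edges between different times, an open path that enters a window free of \<open>B\<close>
  does so along a bi-directed edge, and from then on can only follow directed edges within one time slice.\<close>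

lemma open_path_gap_ma:
  assumes path: "is_path (full_time_admg d 0 q A B) vs ks"
    and open': "\<not> blocked (full_time_admg d 0 q A B) vs ks D"
    and x: "fst (hd vs) \<le> x" "x < fst (last vs)"
  shows "fst (last vs) \<le> x + int q \<or> (\<exists>v\<in>D. x < fst v \<and> fst v \<le> x + int q)"
proof (rule ccontr)
  let ?G = "full_time_admg d 0 q A B"
  assume "\<not> ?thesis"
  then have far: "x + int q < fst (last vs)"
    and notD: "\<And>v. x < fst v \<Longrightarrow> fst v \<le> x + int q \<Longrightarrow> v \<notin> D" by auto
  define N where "N = length ks"
  have len: "length vs = Suc N"
    and joined: "\<And>n. n < N \<Longrightarrow> joined ?G (vs ! n) (ks ! n) (vs ! Suc n)"
    using path by (auto simp: is_path_def N_def)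
  have ends: "hd vs = vs ! 0" "last vs = vs ! N"
    using path_ends[OF len] by simp_all
  obtain m where m: "m < N" "fst (vs ! m) \<le> x" "\<And>j. m < j \<Longrightarrow> j \<le> N \<Longrightarrow> x < fst (vs ! j)"
    using last_index_below[of "\<lambda>n. fst (vs ! n)" x N] x ends by auto
  have m1: "x < fst (vs ! Suc m)" using m by simp
  have k1: "ks ! m = Bi"
    using joined_time(1,2)[OF joined[OF m(1)]] m m1 by (cases "ks ! m") auto
  have t1: "fst (vs ! Suc m) \<le> x + int q" using joined_time(3)[OF joined[OF m(1)] k1] m by simp
  have "fst (vs ! (Suc m + j)) = fst (vs ! Suc m) \<and> head_at_target (ks ! (m + j))" if "Suc m + j \<le> N" for j
    using that
  proof (induction j)
    case 0
    then show ?case using k1 by (simp add: head_at_target_def)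
  next
    case (Suc j)
    let ?n = "Suc m + j"
    have n: "?n < N" and IH: "fst (vs ! ?n) = fst (vs ! Suc m)" "head_at_target (ks ! (m + j))"
      using Suc by auto
    have "DE ?G (vs ! ?n) \<inter> D = {}"
      using DE_same_time[of _ d q A B "vs ! ?n"] notD m1 t1 IH(1) by force
    then have "\<not> collider_at ks ?n" using open' n unfolding blocked_def N_def by auto
    then have "ks ! ?n = Fwd"
      using IH(2) by (cases "ks ! ?n") (auto simp: collider_at_def head_at_source_def)
    then show ?case using joined_time(1)[OF joined[OF n]] IH by (simp add: head_at_target_def)
  qed
  from this[of "N - Suc m"] have "fst (vs ! N) = fst (vs ! Suc m)" using m by simp
  then show False using t1 far ends by simp
qed

section \<open>The maximum principle for Z-matrices\<close>

text \<open>Off-diagonal entries are nonpositive, so putting the minimum \<open>u x\<close> in place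
  of every \<open>u z\<close> can only increase the sum; what results is the positive row sum times
  a negative number.\<close>

lemma zmatrix_row_neg:
  fixes K u :: "'a \<Rightarrow> real"
  assumes Z: "finite Z" "x \<in> Z" and off: "\<And>z. z \<in> Z \<Longrightarrow> z \<noteq> x \<Longrightarrow> K z \<le> 0" and row: "0 < sum K Z"
    and min: "\<And>z. z \<in> Z \<Longrightarrow> u x \<le> u z" and neg: "u x < 0"
  shows "(\<Sum>z\<in>Z. K z * u z) < 0"
proof -
  have "(\<Sum>z\<in>Z. K z * u z) \<le> (\<Sum>z\<in>Z. K z * u x)"
  proof (rule sum_mono)
    fix z assume z: "z \<in> Z"
    show "K z * u z \<le> K z * u x"
      using off[OF z] min[OF z] by (cases "z = x") (auto intro: mult_left_mono_neg)
  qed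
  also have "\<dots> = sum K Z * u x" by (simp add: sum_distrib_right)
  also have "\<dots> < 0" using row neg by (rule mult_pos_neg)
  finally show ?thesis .
qed

text \<open>Propagation of positivity from \<open>y\<close> to \<open>x\<close>: at a zero of a
  nonnegative \<open>u\<close> the positive neighbour contributes a negative term, and no other term
  can compensate it.\<close>

lemma zmatrix_row_pos:
  fixes K u :: "'a \<Rightarrow> real"
  assumes Z: "finite Z" "y \<in> Z" and off: "\<And>z. z \<in> Z \<Longrightarrow> z \<noteq> x \<Longrightarrow> K z \<le> 0"
    and nn: "\<And>z. z \<in> Z \<Longrightarrow> 0 \<le> u z" and y: "y \<noteq> x" "K y < 0" "0 < u y"
    and eq: "0 \<le> (\<Sum>z\<in>Z. K z * u z)"
  shows "u x \<noteq> 0"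
proof
  assume x: "u x = 0"
  have "(\<Sum>z\<in>Z. K z * u z) \<le> (\<Sum>z\<in>Z. if z = y then K y * u y else 0)"
  proof (rule sum_mono)
    fix z assume z: "z \<in> Z"
    show "K z * u z \<le> (if z = y then K y * u y else 0)"
      using off[OF z] nn[OF z] x by (cases "z = x") (auto intro: mult_nonpos_nonneg)
  qed
  also have "\<dots> = K y * u y" using Z by simp
  also have "\<dots> < 0" using y by (intro mult_neg_pos)
  finally show False using eq by simp
qed

text \<open>By the minimum principle on the rows \<open>D\<close>, a solution that is nonnegative at
  \<open>a\<close> is nonnegative everywhere. If it is positive at \<open>a\<close>, positivity
  spreads through \<open>D\<close> along negative entries until it meets a neighbour of
  \<open>c\<close>, where the equation at \<open>c\<close> fails. The assumption
  \<open>chain\<close> expresses the way from \<open>a\<close> to \<open>c\<close> by closed sets,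
  so that no path has to be constructed.\<close>

lemma zmatrix_kernel_trivial:
  fixes g :: "'a \<Rightarrow> 'a \<Rightarrow> real"
  assumes D: "finite D" and c: "c \<notin> insert a D"
    and off: "\<And>x y. x \<in> insert a D \<Longrightarrow> y \<in> insert c D \<Longrightarrow> x \<noteq> y \<Longrightarrow> g x y \<le> 0"
    and row: "\<And>x. x \<in> D \<Longrightarrow> 0 < (\<Sum>y\<in>insert a D. g y x)"
    and chain: "\<And>P. a \<in> P \<Longrightarrow> P \<subseteq> insert a D \<Longrightarrow>
      (\<And>x b. x \<in> P \<Longrightarrow> b \<in> D \<Longrightarrow> x \<noteq> b \<Longrightarrow> g x b < 0 \<Longrightarrow> b \<in> P) \<Longrightarrow> \<exists>x\<in>P. g x c < 0"
    and k: "\<And>x. x \<in> insert c D \<Longrightarrow> (\<Sum>y\<in>insert a D. k y * g y x) = 0"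
  shows "\<forall>y\<in>insert a D. k y = 0"
proof -
  have nonneg: "\<forall>y\<in>insert a D. 0 \<le> l y"
    if l: "\<And>x. x \<in> D \<Longrightarrow> (\<Sum>y\<in>insert a D. l y * g y x) = 0" and la: "0 \<le> l a" for l
  proof (rule ccontr)
    assume "\<not> (\<forall>y\<in>insert a D. 0 \<le> l y)"
    then obtain y where y: "y \<in> insert a D" "l y < 0" by force
    have fin: "finite (l ` insert a D)" using D by simp
    have "Min (l ` insert a D) \<in> l ` insert a D" using fin by (intro Min_in) auto
    then obtain x where x: "Min (l ` insert a D) = l x" "x \<in> insert a D" by (rule imageE)
    have le: "l x \<le> l z" if "z \<in> insert a D" for z
      unfolding x(1)[symmetric] by (intro Min_le[OF fin] imageI that)
    then have neg: "l x < 0" using y by force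
    then have xD: "x \<in> D" using x la by auto
    have "(\<Sum>y\<in>insert a D. g y x * l y) < 0"
      by (rule zmatrix_row_neg[where x = x]) (use D x xD off row le neg in auto)
    then show False using l[OF xD] by (simp only: mult.commute)
  qed
  have not_pos: "\<not> 0 < l a" if l: "\<And>x. x \<in> insert c D \<Longrightarrow> (\<Sum>y\<in>insert a D. l y * g y x) = 0" for l
  proof
    assume la: "0 < l a"
    have nn: "\<forall>y\<in>insert a D. 0 \<le> l y" by (rule nonneg) (use l la in auto)
    have "\<exists>x\<in>{x \<in> insert a D. 0 < l x}. g x c < 0"
    proof (rule chain)
      fix x b assume x: "x \<in> {x \<in> insert a D. 0 < l x}" and b: "b \<in> D" "x \<noteq> b" "g x b < 0"
      have "l b \<noteq> 0"
      proof (rule zmatrix_row_pos[where Z = "insert a D" and K = "\<lambda>y. g y b" and y = x])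
        show "0 \<le> (\<Sum>y\<in>insert a D. g y b * l y)" using l[of b] b by (simp add: mult.commute)
      qed (use D x b off nn in auto)
      then show "b \<in> {x \<in> insert a D. 0 < l x}" using nn b by force
    qed (use la in auto)
    then obtain x where x: "x \<in> insert a D" "0 < l x" "g x c < 0" by blast
    have "(\<Sum>y\<in>insert a D. l y * g y c) \<le> (\<Sum>y\<in>insert a D. if y = x then l x * g x c else 0)"
    proof (rule sum_mono)
      fix y assume y: "y \<in> insert a D"
      then show "l y * g y c \<le> (if y = x then l x * g x c else 0)"
        using off[of y c] nn c by (auto intro: mult_nonneg_nonpos)
    qed
    also have "\<dots> = l x * g x c" using x D by simp
    also have "\<dots> < 0" using x by (intro mult_pos_neg)
    finally show False using l[of c] by simp
  qed
  \<comment> \<open>The argument for \<open>- k\<close> excludes a negative value at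
    \<open>a\<close>; with value zero, nonnegativity of both \<open>k\<close> and \<open>- k\<close>
    leaves only zero.\<close>
  have mk: "(\<Sum>y\<in>insert a D. - k y * g y x) = 0" if "x \<in> insert c D" for x
    using k[OF that] by (simp only: mult_minus_left sum_negf neg_equal_0_iff_equal)
  have "k a = 0" using not_pos[OF k] not_pos[OF mk] by force
  then have "\<forall>y\<in>insert a D. 0 \<le> k y" "\<forall>y\<in>insert a D. 0 \<le> - k y"
    using nonneg[of k] nonneg[of "\<lambda>y. - k y"] k mk by auto
  then show ?thesis by force
qed

lemma diag_imp_row_pos:
  fixes g :: "'a \<Rightarrow> real"
  assumes Z: "finite Z" "x \<in> Z" and diag: "1 \<le> g x" and off: "\<And>y. y \<in> Z \<Longrightarrow> y \<noteq> x \<Longrightarrow> - \<eta> \<le> g y"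
    and small: "\<eta> * real (card Z) < 1" "0 \<le> \<eta>"
  shows "0 < sum g Z"
proof -
  have "real (card (Z - {x})) * - \<eta> \<le> sum g (Z - {x})"
    using off by (intro sum_bounded_below) auto
  moreover have "real (card (Z - {x})) * \<eta> \<le> real (card Z) * \<eta>"
    using small(2) Z by (intro mult_right_mono) (auto intro: card_mono)
  moreover have "sum g Z = g x + sum g (Z - {x})" using Z by (rule sum.remove)
  ultimately show ?thesis using diag small by (simp add: mult.commute)
qed

section \<open>Responses determined by their recursion\<close>

context stable_coeffs
begin

lemma response_recursion:
  assumes "i < d" "j < d"
  shows "rsp (t, i) u j = (\<Sum>l\<le>p. \<Sum>m<d. A l $$ (i, m) * rsp (t - int l, m) u j) +
    (if u = t then if i = j then 1 else 0 else if u < t \<and> t \<le> u + int q then B (nat (t - u)) $$ (i, j) else 0)"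
proof (cases "u \<le> t")
  case False
  then show ?thesis by (simp add: response_def)
next
  case True
  define k where "k = nat (t - u)"
  have t: "t = u + int k" using True by (simp add: k_def)
  have split: "{..p} = insert 0 {1..p}" by auto
  have "(\<Sum>l\<le>p. \<Sum>m<d. A l $$ (i, m) * rsp (t - int l, m) u j) =
      (\<Sum>m<d. A 0 $$ (i, m) * psi d p q A B k m j) +
      (\<Sum>l=1..p. if l \<le> k then \<Sum>m<d. A l $$ (i, m) * psi d p q A B (k - l) m j else 0)"
    unfolding split
    by (subst sum.insert) (auto simp: response_def t nat_minus_as_int[symmetric] of_nat_diff[symmetric] simp del: of_nat_diff intro!: sum.cong)
  then show ?thesis
    using psi_recursion[OF coeffs assms, of k] by (auto simp: response_def t)
qed

text \<open>The witnesses prescribe their responses, and checking a recursion is easier than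
  inverting. The values are determined by induction on the lag and, within one lag, on the
  component, because \<open>A 0\<close> is strictly lower triangular.\<close>

lemma response_unique:
  assumes late: "\<And>t i u j. i < d \<Longrightarrow> j < d \<Longrightarrow> t < u \<Longrightarrow> g (t, i) u j = 0"
    and rec: "\<And>t i u j. i < d \<Longrightarrow> j < d \<Longrightarrow> u \<le> t \<Longrightarrow> g (t, i) u j =
      (\<Sum>l\<le>p. \<Sum>m<d. A l $$ (i, m) * g (t - int l, m) u j) +
      (if u = t then if i = j then 1 else 0 else if u < t \<and> t \<le> u + int q then B (nat (t - u)) $$ (i, j) else 0)"
    and ij: "i < d" "j < d"
  shows "rsp (t, i) u j = g (t, i) u j"
proof (cases "u \<le> t")
  case False
  then show ?thesis using late[OF ij, of t u] by (simp add: response_def)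
next
  case True
  have "rsp (u + int k, i) u j = g (u + int k, i) u j" if "i < d" for k i
    using that
  proof (induction k arbitrary: i rule: less_induct)
    case outer: (less k)
    from outer.prems show ?case
    proof (induction i rule: less_induct)
      case (less i)
      have "A l $$ (i, m) * rsp (u + int k - int l, m) u j = A l $$ (i, m) * g (u + int k - int l, m) u j"
        if l: "l \<le> p" and m: "m < d" for l m
      proof (cases "l = 0")
        case True
        show ?thesis
        proof (cases "m < i")
          case True
          then show ?thesis using less.IH[OF True m] \<open>l = 0\<close> by simp
        next
          case False
          then have "A 0 $$ (i, m) = 0" using coeffs less.prems m by (auto simp: varma_coeffs_def)
          then show ?thesis using \<open>l = 0\<close> by simp
        qed
      next
        case l0: False
        show ?thesis
        proof (cases "l \<le> k")
          case True
          then have ul: "u + int k - int l = u + int (k - l)" by simp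
          show ?thesis unfolding ul using outer.IH[of "k - l" m] l0 True m by simp
        next
          case False
          then show ?thesis using late[OF m ij(2), of "u + int k - int l" u] by (simp add: response_def)
        qed
      qed
      then have "(\<Sum>l\<le>p. \<Sum>m<d. A l $$ (i, m) * rsp (u + int k - int l, m) u j) =
          (\<Sum>l\<le>p. \<Sum>m<d. A l $$ (i, m) * g (u + int k - int l, m) u j)"
        by (intro sum.cong refl) auto
      then show ?case
        by (subst response_recursion[OF less.prems ij(2)], subst rec[OF less.prems ij(2)]) simp_all
    qed
  qed
  from this[OF ij(1), of "nat (t - u)"] show ?thesis using True by simp
qed

lemma autocov_finite:
  assumes x: "snd x < d" and y: "snd y < d" and T: "fst x \<le> T"
    and early: "\<And>u m. m < d \<Longrightarrow> u < t0 \<Longrightarrow> rsp x u m = 0"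
  shows "gam x y = (\<Sum>u\<in>{t0..T}. \<Sum>m<d. s2 m * rsp x u m * rsp y u m)"
proof -
  define f where "f = (\<lambda>k. \<Sum>m<d. s2 m * rsp x (T - int k) m * rsp y (T - int k) m)"
  have "f sums (\<Sum>k\<in>{..<nat (T + 1 - t0)}. f k)"
  proof (rule sums_finite)
    fix k assume "k \<notin> {..<nat (T + 1 - t0)}"
    then have "T - int k < t0" by auto
    then show "f k = 0" unfolding f_def by (intro sum.neutral) (simp add: early)
  qed simp
  then have "gam x y = (\<Sum>k\<in>{..<nat (T + 1 - t0)}. f k)"
    using autocov_sums[OF x y T] unfolding f_def by (rule sums_unique2[symmetric])
  also have "\<dots> = (\<Sum>u\<in>{t0..T}. \<Sum>m<d. s2 m * rsp x u m * rsp y u m)"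
    unfolding f_def
    by (rule sum.reindex_bij_witness[of _ "\<lambda>u. nat (T - u)" "\<lambda>k. T - int k"]) auto
  finally show ?thesis .
qed

end

subsection \<open>Lexicographic precedence within a time window\<close>

text \<open>All edges that lags up to \<open>r\<close> and the order of the components admit. Of two
  distinct nodes at time distance at most \<open>r\<close> exactly one precedes the other, so every
  such pair is adjacent.\<close>

definition prec :: "nat \<Rightarrow> int \<times> nat \<Rightarrow> int \<times> nat \<Rightarrow> real" where
  "prec r x y = (if (fst x < fst y \<and> fst y \<le> fst x + int r) \<or> (fst x = fst y \<and> snd x < snd y) then 1 else 0)"

lemma prec_bounds: "0 \<le> prec r x y" "prec r x y \<le> 1"
  by (auto simp: prec_def)

lemma prec_nonzero_time: "prec r x y \<noteq> 0 \<Longrightarrow> fst x \<le> fst y \<and> fst y \<le> fst x + int r"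
  by (auto simp: prec_def split: if_splits)

lemma prec_sum:
  assumes "x \<noteq> y"
  shows "prec r x y + prec r y x = (if \<bar>fst x - fst y\<bar> \<le> int r then 1 else 0)"
  using assms by (cases x; cases y) (auto simp: prec_def)

lemma prec_refl [simp]: "prec r x x = 0"
  by (simp add: prec_def)

text \<open>Common parents or children lie in a window of \<open>r + 1\<close> times with
  \<open>d\<close> nodes each. The constant \<open>(r + 1) * d\<close> in the choices of
  \<open>\<eta>\<close> comes from here.\<close>

lemma common_neighbours_bound:
  fixes f g :: "int \<times> nat \<Rightarrow> real"
  assumes "finite Z" "\<And>n. n \<in> Z \<Longrightarrow> snd n < d"
    and f: "\<And>n. f n \<noteq> 0 \<Longrightarrow> t \<le> fst n \<and> fst n \<le> t + int r"
    and "\<And>n. 0 \<le> f n \<and> f n \<le> 1" "\<And>n. 0 \<le> g n \<and> g n \<le> 1"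
  shows "(\<Sum>n\<in>Z. f n * g n) \<le> real ((r + 1) * d)"
proof -
  have "(\<Sum>n\<in>Z. f n * g n) = (\<Sum>n\<in>Z \<inter> {t..t + int r} \<times> {..<d}. f n * g n)"
    using assms(1,2) f by (intro sum.mono_neutral_right) (auto simp: mem_Times_iff)
  also have "\<dots> \<le> (\<Sum>n\<in>Z \<inter> {t..t + int r} \<times> {..<d}. 1)"
    using assms(4,5) by (intro sum_mono) (simp add: mult_le_one)
  also have "\<dots> = real (card (Z \<inter> {t..t + int r} \<times> {..<d}))" by simp
  also have "\<dots> \<le> real (card ({t..t + int r} \<times> {..<d}))"
    by (intro of_nat_mono card_mono) auto
  also have "card ({t..t + int r} \<times> {..<d}) = (r + 1) * d"
    by (simp add: card_cartesian_product nat_add_distrib)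
  finally show ?thesis .
qed

text \<open>The entries of \<open>(I - \<eta> N) (I - \<eta> N)\<^sup>T\<close> when \<open>N\<close> is the adjacency matrix of \<open>prec\<close>
  (columns to rows), or of \<open>(I - \<eta> N)\<^sup>T (I - \<eta> N)\<close> with \<open>f\<close> read along children.\<close>

lemma gram_entries:
  fixes f :: "int \<times> nat \<Rightarrow> int \<times> nat \<Rightarrow> real"
  assumes Z: "finite Z" "x \<in> Z" "y \<in> Z" "\<And>n. n \<in> Z \<Longrightarrow> snd n < d"
    and f: "f = (\<lambda>x n. prec r n x) \<or> f = (\<lambda>x n. prec r x n)"
    and \<eta>: "0 < \<eta>" "\<eta> * real ((r + 1) * d) \<le> 1 / 2"
    and g: "g = (\<Sum>n\<in>Z. ((if x = n then 1 else 0) - \<eta> * f x n) * ((if y = n then 1 else 0) - \<eta> * f y n))"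
  shows "x = y \<Longrightarrow> 1 \<le> g" "x \<noteq> y \<Longrightarrow> - \<eta> \<le> g"
    "x \<noteq> y \<Longrightarrow> g \<le> 0" "x \<noteq> y \<Longrightarrow> \<bar>fst x - fst y\<bar> \<le> int r \<Longrightarrow> g < 0"
proof -
  have fb: "0 \<le> f v n \<and> f v n \<le> 1" and frefl: "f v v = 0" for v n
    using f by (auto simp: prec_bounds)
  have kron: "(\<Sum>n\<in>Z. (if v = n then 1 else 0) * h n) = h v" if "v \<in> Z" for v and h :: "_ \<Rightarrow> real"
    using Z(1) that by (simp add: if_distrib[of "\<lambda>u. u * _"] cong: if_cong)
  have "g = (\<Sum>n\<in>Z. (if x = n then 1 else 0) * (if y = n then 1 else 0) - \<eta> * ((if x = n then 1 else 0) * f y n)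
      - \<eta> * ((if y = n then 1 else 0) * f x n) + \<eta>\<^sup>2 * (f x n * f y n))"
    unfolding g by (intro sum.cong refl) (simp add: algebra_simps power2_eq_square)
  also have "\<dots> = (if y = x then 1 else 0) - \<eta> * f y x - \<eta> * f x y + \<eta>\<^sup>2 * (\<Sum>n\<in>Z. f x n * f y n)"
    by (simp only: sum.distrib sum_subtractf sum_distrib_left[symmetric] kron[OF Z(2)] kron[OF Z(3)])
  finally have g_eq: "g = (if y = x then 1 else 0) - \<eta> * f y x - \<eta> * f x y + \<eta>\<^sup>2 * (\<Sum>n\<in>Z. f x n * f y n)" .
  have nn: "0 \<le> (\<Sum>n\<in>Z. f x n * f y n)" using fb by (intro sum_nonneg) auto
  then have nn2: "0 \<le> \<eta>\<^sup>2 * (\<Sum>n\<in>Z. f x n * f y n)" by simp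
  show "1 \<le> g" if "x = y" using g_eq nn2 frefl that by simp
  have adj: "f y x + f x y = (if \<bar>fst x - fst y\<bar> \<le> int r then 1 else 0)" if "x \<noteq> y"
    using f prec_sum[OF that, of r] by (auto simp: add.commute)
  have g_eq': "g = - \<eta> * (if \<bar>fst x - fst y\<bar> \<le> int r then 1 else 0) + \<eta>\<^sup>2 * (\<Sum>n\<in>Z. f x n * f y n)" if "x \<noteq> y"
    unfolding g_eq adj[OF that, symmetric] using that by (simp add: algebra_simps)
  show "- \<eta> \<le> g" if "x \<noteq> y" using g_eq'[OF that] nn2 \<eta> by (auto split: if_splits)
  have "(\<Sum>n\<in>Z. f x n * f y n) \<le> real ((r + 1) * d)"
  proof -
    from f show ?thesis
    proof
      assume f1: "f = (\<lambda>x n. prec r n x)"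
      have "fst x - int r \<le> fst n \<and> fst n \<le> fst x - int r + int r" if "f x n \<noteq> 0" for n
        using prec_nonzero_time[of r n x] that f1 by auto
      then show ?thesis
        using fb by (intro common_neighbours_bound[OF Z(1) Z(4), where t = "fst x - int r"]) auto
    next
      assume f2: "f = (\<lambda>x n. prec r x n)"
      have "fst x \<le> fst n \<and> fst n \<le> fst x + int r" if "f x n \<noteq> 0" for n
        using prec_nonzero_time[of r x n] that f2 by auto
      then show ?thesis
        using fb by (intro common_neighbours_bound[OF Z(1) Z(4), where t = "fst x"]) auto
    qed
  qed
  then have "\<eta>\<^sup>2 * (\<Sum>n\<in>Z. f x n * f y n) \<le> \<eta> * (\<eta> * real ((r + 1) * d))"
    using \<eta>(1) by (simp add: power2_eq_square mult.assoc)
  also have "\<dots> \<le> \<eta> * (1 / 2)" using \<eta> by (intro mult_left_mono) auto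
  \<comment> \<open>The quadratic term is at most half of the linear one, so it cannot reverse the
    sign of an entry between neighbours.\<close>
  finally have half: "\<eta>\<^sup>2 * (\<Sum>n\<in>Z. f x n * f y n) \<le> \<eta> / 2" by simp
  show lt: "g < 0" if "x \<noteq> y" "\<bar>fst x - fst y\<bar> \<le> int r"
    using g_eq'[OF that(1)] half that(2) \<eta> by simp
  show "g \<le> 0" if "x \<noteq> y"
  proof (cases "\<bar>fst x - fst y\<bar> \<le> int r")
    case True
    then show ?thesis using lt that by simp
  next
    case False
    \<comment> \<open>A common neighbour has both nodes within \<open>r\<close> time steps on the
      same side, so their distance is at most \<open>r\<close>.\<close>
    have "f x n * f y n = 0" for n
    proof (rule ccontr)
      assume "f x n * f y n \<noteq> 0"
      then have "f x n \<noteq> 0" "f y n \<noteq> 0" by auto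
      from f show False
      proof
        assume "f = (\<lambda>x n. prec r n x)"
        then show False
          using prec_nonzero_time[of r n x] prec_nonzero_time[of r n y] \<open>f x n \<noteq> 0\<close> \<open>f y n \<noteq> 0\<close> False
          by (auto simp: abs_if split: if_splits)
      next
        assume "f = (\<lambda>x n. prec r x n)"
        then show False
          using prec_nonzero_time[of r x n] prec_nonzero_time[of r y n] \<open>f x n \<noteq> 0\<close> \<open>f y n \<noteq> 0\<close> False
          by (auto simp: abs_if split: if_splits)
      qed
    qed
    then show ?thesis using g_eq'[OF that] False by simp
  qed
qed

subsection \<open>Parameters with a nonzero minor\<close>

text \<open>The matrix is lower triangular with diagonal entries
  \<open>z ^ p - \<alpha> * z ^ (p - 1)\<close>, whose only roots are \<open>0\<close> and
  \<open>\<alpha>\<close>; for \<open>p = 0\<close> the diagonal entries are 1.\<close>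

lemma root_condition_triangular:
  assumes A0: "A 0 \<in> carrier_mat d d" "\<And>i j. i < d \<Longrightarrow> j < d \<Longrightarrow> i \<le> j \<Longrightarrow> A 0 $$ (i, j) = 0"
    and A: "\<And>k i j. 1 \<le> k \<Longrightarrow> k \<le> p \<Longrightarrow> i < d \<Longrightarrow> j < d \<Longrightarrow> A k $$ (i, j) = (if k = 1 \<and> i = j then \<alpha> else 0)"
    and \<alpha>: "0 \<le> \<alpha>" "\<alpha> < 1"
  shows "root_condition d p A"
  unfolding root_condition_def
proof (intro allI impI)
  fix z :: complex
  let ?N = "\<lambda>i j. complex_of_real ((1\<^sub>m d - A 0) $$ (i, j)) * z ^ p
          - (\<Sum>k=1..p. complex_of_real (A k $$ (i, j)) * z ^ (p - k))"
  let ?M = "Matrix.mat d d (\<lambda>(i, j). ?N i j)"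
  assume "Determinant.det ?M = 0"
  moreover have "Determinant.det ?M = prod_list (diag_mat ?M)"
  proof (rule det_lower_triangular)
    fix i j assume ij: "i < j" "j < d"
    have "(\<Sum>k=1..p. complex_of_real (A k $$ (i, j)) * z ^ (p - k)) = 0"
      using ij by (intro sum.neutral) (simp add: A)
    then show "?M $$ (i, j) = 0" using ij A0 by simp
  qed simp
  ultimately have "\<exists>i<d. ?M $$ (i, i) = 0"
    by (auto simp: prod_list_zero_iff diag_mat_def)
  then obtain i where i: "i < d" "?N i i = 0" by auto
  have "(\<Sum>k=1..p. complex_of_real (A k $$ (i, i)) * z ^ (p - k)) =
      (\<Sum>k=1..p. if k = 1 then of_real \<alpha> * z ^ (p - 1) else 0)"
    using i by (intro sum.cong refl) (auto simp: A)
  then have eq: "z ^ p = (if 1 \<le> p then of_real \<alpha> * z ^ (p - 1) else 0)"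
    using i A0 by simp
  show "cmod z < 1"
  proof (cases p)
    case 0
    then show ?thesis using eq by simp
  next
    case (Suc p')
    then have "z ^ p' * (z - of_real \<alpha>) = 0" using eq by (simp add: algebra_simps)
    then have "z = 0 \<or> z = of_real \<alpha>" by auto
    then show ?thesis using \<alpha> by auto
  qed
qed

text \<open>At the largest component of a kernel vector, and for \<open>1 \<le> cmod z\<close>, the
  leading term \<open>z ^ p\<close> outweighs all \<open>(p + 1) * d\<close> other terms
  together.\<close>

lemma root_condition_small:
  assumes A0: "A 0 \<in> carrier_mat d d"
    and A: "\<And>k i j. k \<le> p \<Longrightarrow> i < d \<Longrightarrow> j < d \<Longrightarrow> \<bar>A k $$ (i, j)\<bar> \<le> \<eta>"
    and \<eta>: "\<eta> * real ((p + 1) * d) < 1" "0 \<le> \<eta>"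
  shows "root_condition d p A"
  unfolding root_condition_def
proof (intro allI impI)
  fix z :: complex
  let ?N = "\<lambda>i j. complex_of_real ((1\<^sub>m d - A 0) $$ (i, j)) * z ^ p
          - (\<Sum>k=1..p. complex_of_real (A k $$ (i, j)) * z ^ (p - k))"
  let ?M = "Matrix.mat d d (\<lambda>(i, j). ?N i j)"
  assume "Determinant.det ?M = 0"
  then obtain v where v: "v \<in> carrier_vec d" "v \<noteq> 0\<^sub>v d" "?M *\<^sub>v v = 0\<^sub>v d"
    using det_0_iff_vec_prod_zero[of ?M d] by auto
  have d: "0 < d" using v by (cases d) auto
  define w where "w = (\<lambda>i. v $ i)"
  have N: "(\<Sum>j<d. ?N i j * w j) = 0" if "i < d" for i
    using arg_cong[OF v(3), of "\<lambda>u. u $ i"] that v(1)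
    by (simp add: scalar_prod_def w_def atLeast0LessThan)
  define W where "W = Max ((\<lambda>i. cmod (w i)) ` {..<d})"
  have Wle: "cmod (w j) \<le> W" if "j < d" for j unfolding W_def using that by (intro Max_ge) auto
  have "W \<in> (\<lambda>i. cmod (w i)) ` {..<d}" unfolding W_def using d by (intro Max_in) auto
  then obtain i where i: "i < d" "cmod (w i) = W" by auto
  have "W > 0"
  proof -
    obtain j where "j < d" "v $ j \<noteq> 0"
      using v(1,2) by (metis carrier_vecD eq_vecI index_zero_vec(1) index_zero_vec(2))
    then have "0 < cmod (w j)" by (simp add: w_def)
    then show ?thesis using Wle[OF \<open>j < d\<close>] by linarith
  qed
  show "cmod z < 1"
  proof (rule ccontr)
    assume "\<not> cmod z < 1"
    then have z: "1 \<le> cmod z" by simp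
    have expand: "?N i j * w j = (if i = j then 1 else 0) * (z ^ p * w j) -
        (\<Sum>k\<le>p. of_real (A k $$ (i, j)) * z ^ (p - k)) * w j" if "j < d" for j
    proof -
      have "{..p} = insert 0 {1..p}" by auto
      then show ?thesis using i that A0 by (simp add: algebra_simps)
    qed
    have "(\<Sum>j<d. ?N i j * w j) = (\<Sum>j<d. (if i = j then 1 else 0) * (z ^ p * w j) -
        (\<Sum>k\<le>p. of_real (A k $$ (i, j)) * z ^ (p - k)) * w j)"
      by (intro sum.cong refl expand) simp
    also have "\<dots> = z ^ p * w i - (\<Sum>j<d. (\<Sum>k\<le>p. of_real (A k $$ (i, j)) * z ^ (p - k)) * w j)"
      using i by (simp only: sum_subtractf sum_kronecker)
    finally have "z ^ p * w i = (\<Sum>j<d. (\<Sum>k\<le>p. of_real (A k $$ (i, j)) * z ^ (p - k)) * w j)"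
      using N[OF i(1)] by simp
    then have "cmod z ^ p * W = cmod (\<Sum>j<d. (\<Sum>k\<le>p. of_real (A k $$ (i, j)) * z ^ (p - k)) * w j)"
      by (metis i(2) norm_mult norm_power)
    also have "\<dots> \<le> (\<Sum>j<d. (\<Sum>k\<le>p. \<eta> * cmod z ^ p) * W)"
    proof (rule order_trans[OF norm_sum], rule sum_mono)
      fix j assume j: "j \<in> {..<d}"
      have "cmod (\<Sum>k\<le>p. of_real (A k $$ (i, j)) * z ^ (p - k)) \<le> (\<Sum>k\<le>p. \<eta> * cmod z ^ p)"
      proof (rule order_trans[OF norm_sum], rule sum_mono)
        fix k assume k: "k \<in> {..p}"
        show "cmod (of_real (A k $$ (i, j)) * z ^ (p - k)) \<le> \<eta> * cmod z ^ p"
          unfolding norm_mult norm_power norm_of_real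
          using A[of k i j] i j k z \<eta>(2) by (intro mult_mono power_increasing) auto
      qed
      then show "cmod ((\<Sum>k\<le>p. of_real (A k $$ (i, j)) * z ^ (p - k)) * w j) \<le> (\<Sum>k\<le>p. \<eta> * cmod z ^ p) * W"
        unfolding norm_mult using Wle[of j] j \<eta>(2) z by (intro mult_mono sum_nonneg) auto
    qed
    also have "\<dots> = (\<eta> * real ((p + 1) * d)) * (cmod z ^ p * W)" by (simp add: algebra_simps)
    also have "\<dots> < 1 * (cmod z ^ p * W)"
      using \<eta>(1) z \<open>W > 0\<close> by (intro mult_strict_right_mono mult_pos_pos zero_less_power) auto
    finally show False by simp
  qed
qed

lemma reciprocal_bounds:
  fixes N Y :: real
  assumes "0 < N"
  shows "Y < N \<Longrightarrow> 1 / N * Y < 1" "2 * Y \<le> N \<Longrightarrow> 1 / N * Y \<le> 1 / 2" "Y \<le> N \<Longrightarrow> 1 / N * Y \<le> 1"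
    "N = 4 * Y \<Longrightarrow> 1 / N * Y = 1 / 4"
  using assms by (simp_all add: field_simps)

lemma ex_latest:
  assumes "finite P" "P \<noteq> {}"
  shows "\<exists>v\<in>P. \<forall>w\<in>P. fst w \<le> (fst v :: int)"
proof -
  have "Max (fst ` P) \<in> fst ` P" using assms by (intro Max_in) auto
  then obtain v where "Max (fst ` P) = fst v" "v \<in> P" by (rule imageE)
  then show ?thesis using assms(1) by (metis Max_ge finite_imageI imageI)
qed

text \<open>The entries of the inverse of I - \<eta> N, where N has ones strictly below the diagonal
  and zeros elsewhere; the powers of \<open>1 + \<eta>\<close> are the binomial sums in the Neumann
  series.\<close>

definition unit_lower_inv :: "real \<Rightarrow> nat \<Rightarrow> nat \<Rightarrow> real" where
  "unit_lower_inv \<eta> i j = (if j = i then 1 else if j < i then \<eta> * (1 + \<eta>) ^ (i - j - 1) else 0)"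

lemma unit_lower_inv_tail:
  "n < i \<Longrightarrow> (\<Sum>m\<in>{i - Suc n<..i}. unit_lower_inv \<eta> i m) = (1 + \<eta>) ^ n"
proof (induction n)
  case 0
  then have "{i - Suc 0<..i} = {i}" by auto
  then show ?case by (simp add: unit_lower_inv_def)
next
  case (Suc n)
  have "{i - Suc (Suc n)<..i} = insert (i - Suc n) {i - Suc n<..i}" using Suc.prems by auto
  then have "(\<Sum>m\<in>{i - Suc (Suc n)<..i}. unit_lower_inv \<eta> i m) = unit_lower_inv \<eta> i (i - Suc n) + (1 + \<eta>) ^ n"
    using Suc by simp
  also have "unit_lower_inv \<eta> i (i - Suc n) = \<eta> * (1 + \<eta>) ^ n"
    using Suc.prems by (simp add: unit_lower_inv_def)
  finally show ?case by (simp add: algebra_simps)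
qed

lemma unit_lower_inv:
  assumes "i < d" "j < d"
  shows "(\<Sum>m<d. unit_lower_inv \<eta> i m * ((if m = j then 1 else 0) - \<eta> * (if j < m then 1 else 0))) = (if i = j then 1 else 0)"
proof -
  have "(\<Sum>m<d. unit_lower_inv \<eta> i m * ((if m = j then 1 else 0) - \<eta> * (if j < m then 1 else 0))) =
      unit_lower_inv \<eta> i j - \<eta> * (\<Sum>m<d. unit_lower_inv \<eta> i m * (if j < m then 1 else 0))"
    using assms by (simp add: right_diff_distrib sum_subtractf sum_kronecker sum_distrib_left mult.left_commute)
  also have "(\<Sum>m<d. unit_lower_inv \<eta> i m * (if j < m then 1 else 0)) = (\<Sum>m\<in>{j<..i}. unit_lower_inv \<eta> i m)"
    using assms by (intro sum.mono_neutral_cong_right) (auto simp: unit_lower_inv_def)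
  also have "unit_lower_inv \<eta> i j - \<eta> * (\<Sum>m\<in>{j<..i}. unit_lower_inv \<eta> i m) = (if i = j then 1 else 0)"
  proof (cases "j < i")
    case True
    then show ?thesis
      using unit_lower_inv_tail[of "i - j - 1" i \<eta>] by (simp add: unit_lower_inv_def)
  qed (auto simp: unit_lower_inv_def)
  finally show ?thesis .
qed

text \<open>The responses are made equal to I - \<eta> N with N the adjacency matrix of
  \<open>prec r\<close>. The covariance is then the Gram matrix of \<open>gram_entries\<close>, with
  a negative entry for every pair within lag \<open>r\<close>. A separate \<open>r\<close> allows
  two uses: \<open>r = q\<close> for pure moving averages, and \<open>r = 0\<close> for simultaneous
  nodes with arbitrary \<open>p\<close> and \<open>q\<close>.\<close>

lemma ma_witness:
  assumes r: "r \<le> q" and D: "finite D" "D \<subseteq> UNIV \<times> {..<d}" and ac: "snd a < d" "snd c < d" "a \<notin> D" "c \<notin> insert a D"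
    and gap: "fst a = fst c \<or> (fst a \<le> fst c \<and>
      (\<forall>x. fst a \<le> x \<and> x < fst c \<longrightarrow> fst c \<le> x + int r \<or> (\<exists>b\<in>D. x < fst b \<and> fst b \<le> x + int r)))"
  shows "\<exists>A B. varma_coeffs d p q A B \<and> root_condition d p A \<and> minor_num d p q A B (\<lambda>_. 1) a c D \<noteq> 0"
proof -
  \<comment> \<open>The first summand keeps the quadratic part of the Gram entries below half of the
    linear part, the second makes the row sums over \<open>insert a D\<close> positive.\<close>
  define \<eta> where "\<eta> = 1 / real (2 * ((r + 1) * d) + 2 * (card D + 1))"
  have pos: "0 < real (2 * ((r + 1) * d) + 2 * (card D + 1))" by (simp only: of_nat_0_less_iff) simp
  have \<eta>: "0 < \<eta>" unfolding \<eta>_def using pos by simp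
  have \<eta>1: "\<eta> * real ((r + 1) * d) \<le> 1 / 2"
    unfolding \<eta>_def by (rule reciprocal_bounds(2)[OF pos]) simp
  have \<eta>2: "\<eta> * real (card (insert a D)) < 1"
    unfolding \<eta>_def by (rule reciprocal_bounds(1)[OF pos]) (use D ac in \<open>simp only: of_nat_less_iff, simp\<close>)
  let ?L = "unit_lower_inv \<eta>"
  \<comment> \<open>\<open>1 - A 0\<close> is \<open>?L\<close>, the inverse of the wanted
    instantaneous response. The factor \<open>?L\<close> in \<open>B\<close> compensates it, so that
    each lag from 1 to \<open>r\<close> responds with the constant \<open>- \<eta>\<close>.\<close>
  define A :: "nat \<Rightarrow> real mat" where "A = (\<lambda>k. Matrix.mat d d (\<lambda>(i, j). if k = 0 then (if i = j then 1 else 0) - ?L i j else 0))"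
  define B :: "nat \<Rightarrow> real mat" where "B = (\<lambda>l. Matrix.mat d d (\<lambda>(i, j). if 1 \<le> l \<and> l \<le> r then - \<eta> * (\<Sum>m<d. ?L i m) else 0))"
  have coeffs: "varma_coeffs d p q A B"
    by (auto simp: varma_coeffs_def A_def B_def unit_lower_inv_def)
  have root: "root_condition d p A"
    by (rule root_condition_triangular[where \<alpha> = 0]) (auto simp: A_def unit_lower_inv_def)
  interpret stable_coeffs d p q A B "\<lambda>_. 1" by unfold_locales (fact coeffs, fact root)
  define g where "g = (\<lambda>(v :: int \<times> nat) u j. (if v = (u, j) then 1 else 0) - \<eta> * prec r (u, j) v)"
  have rsp: "rsp (t, i) u j = g (t, i) u j" if "i < d" "j < d" for t i u j
  proof (rule response_unique[OF _ _ that])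
    show "g (t, i) u j = 0" if "t < u" for t i u j
      using that by (auto simp: g_def prec_def)
    fix t :: int and i and u :: int and j assume ij: "i < d" "j < d" and u: "u \<le> t"
    have "(\<Sum>l\<le>p. \<Sum>m<d. A l $$ (i, m) * g (t - int l, m) u j) = (\<Sum>l\<in>{0}. \<Sum>m<d. A l $$ (i, m) * g (t - int l, m) u j)"
      using ij by (intro sum.mono_neutral_right) (auto simp: A_def)
    also have "\<dots> = (\<Sum>m<d. (if i = m then 1 else 0) * g (t, m) u j) - (\<Sum>m<d. ?L i m * g (t, m) u j)"
      using ij by (simp add: A_def left_diff_distrib sum_subtractf)
    finally have s: "(\<Sum>l\<le>p. \<Sum>m<d. A l $$ (i, m) * g (t - int l, m) u j) = g (t, i) u j - (\<Sum>m<d. ?L i m * g (t, m) u j)"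
      using ij by (simp only: sum_kronecker)
    have "(\<Sum>m<d. ?L i m * g (t, m) u j) =
      (if u = t then if i = j then 1 else 0 else if u < t \<and> t \<le> u + int q then B (nat (t - u)) $$ (i, j) else 0)"
    proof (cases "u = t")
      case True
      have "(\<Sum>m<d. ?L i m * g (t, m) u j) = (\<Sum>m<d. ?L i m * ((if m = j then 1 else 0) - \<eta> * (if j < m then 1 else 0)))"
        using True by (intro sum.cong refl) (simp add: g_def prec_def)
      then show ?thesis using True unit_lower_inv[OF ij, of \<eta>] by simp
    next
      case False
      then have ut: "u < t" using u by simp
      have "(\<Sum>m<d. ?L i m * g (t, m) u j) = (\<Sum>m<d. ?L i m * (- \<eta> * (if t \<le> u + int r then 1 else 0)))"
        using ut by (intro sum.cong refl) (simp add: g_def prec_def)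
      also have "\<dots> = (if t \<le> u + int r then - \<eta> * (\<Sum>m<d. ?L i m) else 0)"
        by (simp add: sum_distrib_left sum_negf mult.commute)
      also have "\<dots> = (if u < t \<and> t \<le> u + int q then B (nat (t - u)) $$ (i, j) else 0)"
        using ut r ij by (auto simp: B_def nat_le_iff)
      finally show ?thesis using False by simp
    qed
    then show "g (t, i) u j = (\<Sum>l\<le>p. \<Sum>m<d. A l $$ (i, m) * g (t - int l, m) u j) +
      (if u = t then if i = j then 1 else 0 else if u < t \<and> t \<le> u + int q then B (nat (t - u)) $$ (i, j) else 0)"
      using s by simp
  qed
  have entries: "(x = y \<longrightarrow> 1 \<le> gam x y) \<and> (x \<noteq> y \<longrightarrow> - \<eta> \<le> gam x y \<and> gam x y \<le> 0 \<and> (\<bar>fst x - fst y\<bar> \<le> int r \<longrightarrow> gam x y < 0))"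
    if xy: "snd x < d" "snd y < d" for x y
  proof -
    define t0 where "t0 = min (fst x) (fst y) - int r"
    define T where "T = max (fst x) (fst y)"
    define Z where "Z = {t0..T} \<times> {..<d}"
    have Z: "finite Z" "x \<in> Z" "y \<in> Z" "\<And>n. n \<in> Z \<Longrightarrow> snd n < d"
      using xy by (auto simp: Z_def t0_def T_def mem_Times_iff)
    have rv: "rsp v (fst n) (snd n) = (if v = n then 1 else 0) - \<eta> * prec r n v" if "snd v < d" "snd n < d" for v n
      using rsp[OF that, of "fst v" "fst n"] by (simp add: g_def)
    have "gam x y = (\<Sum>u\<in>{t0..T}. \<Sum>m<d. 1 * rsp x u m * rsp y u m)"
    proof (rule autocov_finite[OF xy])
      show "fst x \<le> T" by (simp add: T_def)
      show "rsp x u m = 0" if "m < d" "u < t0" for u m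
        using rv[OF xy(1), of "(u, m)"] that by (auto simp: prec_def t0_def)
    qed
    also have "\<dots> = (\<Sum>n\<in>Z. rsp x (fst n) (snd n) * rsp y (fst n) (snd n))"
      by (simp add: Z_def sum.cartesian_product case_prod_beta)
    also have "\<dots> = (\<Sum>n\<in>Z. ((if x = n then 1 else 0) - \<eta> * prec r n x) * ((if y = n then 1 else 0) - \<eta> * prec r n y))"
      using Z(4) xy by (intro sum.cong refl) (simp add: rv)
    finally show ?thesis
      using gram_entries[OF Z, where f = "\<lambda>x n. prec r n x" and r = r and \<eta> = \<eta>] \<eta> \<eta>1 by blast
  qed
  have sndD: "snd x < d" if "x \<in> insert c (insert a D)" for x using that D ac by auto
  have "minor_num d p q A B (\<lambda>_. 1) a c D \<noteq> 0"
  proof (rule minor_num_nonzero[OF D ac(1,2,3)])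
    fix k assume k: "\<And>x. x \<in> insert c D \<Longrightarrow> (\<Sum>y\<in>insert a D. k y * gam y x) = 0"
    show "\<forall>y\<in>insert a D. k y = 0"
    proof (rule zmatrix_kernel_trivial[OF D(1) ac(4) _ _ _ k])
      show "gam x y \<le> 0" if "x \<in> insert a D" "y \<in> insert c D" "x \<noteq> y" for x y
      proof -
        have "snd x < d" "snd y < d" using that(1,2) by (auto intro!: sndD)
        then show ?thesis using entries[of x y] that(3) by blast
      qed
      show "0 < (\<Sum>y\<in>insert a D. gam y x)" if x: "x \<in> D" for x
      proof (rule diag_imp_row_pos[of _ x _ \<eta>])
        have xd: "snd x < d" using x by (auto intro!: sndD)
        show "1 \<le> gam x x" using entries[of x x] xd by blast
        show "- \<eta> \<le> gam y x" if "y \<in> insert a D" "y \<noteq> x" for y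
        proof -
          have "snd y < d" using that(1) by (auto intro!: sndD)
          then show ?thesis using entries[of y x] xd that(2) by blast
        qed
      qed (use x D \<eta> \<eta>2 in auto)
      fix P assume P: "a \<in> P" "P \<subseteq> insert a D"
        and closed: "\<And>x b. x \<in> P \<Longrightarrow> b \<in> D \<Longrightarrow> x \<noteq> b \<Longrightarrow> gam x b < 0 \<Longrightarrow> b \<in> P"
      have ne: "x \<noteq> c" if "x \<in> P" for x using that P ac by auto
      show "\<exists>x\<in>P. gam x c < 0"
      proof (cases "fst a = fst c")
        case True
        then show ?thesis using entries[of a c] ac P by auto
      next
        case False
        have finP: "finite {v \<in> P. fst v < fst c}" using P D by (auto intro: finite_subset)
        have "a \<in> {v \<in> P. fst v < fst c}" using P gap False by auto
        \<comment> \<open>The latest node of \<open>P\<close> before \<open>c\<close>. By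
          \<open>gap\<close> it is within lag \<open>r\<close> of \<open>c\<close>, or some later
          node of \<open>D\<close> before \<open>c\<close> is within lag \<open>r\<close> of it;
          that node would also belong to \<open>P\<close>.\<close>
        then obtain v where v: "v \<in> P" "fst v < fst c" "\<And>w. w \<in> P \<Longrightarrow> fst w < fst c \<Longrightarrow> fst w \<le> fst v"
          using ex_latest[OF finP] by blast
        have "fst a \<le> fst v" using v(3)[OF P(1)] gap False by auto
        then have "fst c \<le> fst v + int r \<or> (\<exists>b\<in>D. fst v < fst b \<and> fst b \<le> fst v + int r)"
          using gap False v(2) by blast
        moreover have False if b: "b \<in> D" "fst v < fst b" "fst b \<le> fst v + int r" "\<not> fst c \<le> fst v + int r" for b
        proof -
          have "v \<noteq> b" using b by auto
          moreover have "snd v < d" "snd b < d" using P v(1) b(1) by (auto intro!: sndD)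
          ultimately have "gam v b < 0" using entries[of v b] b by auto
          then have "b \<in> P" using closed[OF v(1) b(1) \<open>v \<noteq> b\<close>] by blast
          then show False using v(3)[of b] b by auto
        qed
        ultimately have "fst c \<le> fst v + int r" by blast
        moreover have "snd v < d" "snd c < d" using P v(1) by (auto intro!: sndD)
        ultimately have "gam v c < 0" using entries[of v c] v(2) ne[OF v(1)] by auto
        then show ?thesis using v(1) by blast
      qed
    qed
  qed
  then show ?thesis using coeffs root by blast
qed

text \<open>The autoregressive coefficient 1/2 and the moving average coefficient -1/2 cancel except
  in the component of \<open>c\<close>. All other components are white noise, while this one
  collects all past innovations with geometrically decaying negative weights. So \<open>c\<close> is
  negatively correlated with \<open>a\<close> at any distance, and no chain through \<open>D\<close>
  is required.\<close>

lemma arma_witness: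
  assumes pq: "1 \<le> p" "1 \<le> q" and D: "finite D" "D \<subseteq> UNIV \<times> {..<d}"
    and ac: "snd a < d" "snd c < d" "a \<notin> D" "c \<notin> insert a D" and t: "fst a < fst c"
  shows "\<exists>A B. varma_coeffs d p q A B \<and> root_condition d p A \<and> minor_num d p q A B (\<lambda>_. 1) a c D \<noteq> 0"
proof -
  \<comment> \<open>The first summand gives \<open>\<beta> * d \<le> 1\<close>, which controls the
    overlap of two tails below; the second makes the row sums over \<open>insert a D\<close>
    positive.\<close>
  define \<beta> where "\<beta> = 1 / real (2 * d + 2 * (card D + 1))"
  have pos: "0 < real (2 * d + 2 * (card D + 1))" by (simp only: of_nat_0_less_iff) simp
  have \<beta>: "0 < \<beta>" unfolding \<beta>_def using pos by simp
  have \<beta>1: "\<beta> * real d \<le> 1" unfolding \<beta>_def by (rule reciprocal_bounds(3)[OF pos]) simp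
  have \<beta>2: "\<beta> * real (card (insert a D)) < 1"
    unfolding \<beta>_def by (rule reciprocal_bounds(1)[OF pos]) (use D ac in \<open>simp only: of_nat_less_iff, simp\<close>)
  define i0 where "i0 = snd c"
  define A :: "nat \<Rightarrow> real mat" where "A = (\<lambda>k. Matrix.mat d d (\<lambda>(i, j). if k = 1 \<and> i = j then 1 / 2 else 0))"
  define B :: "nat \<Rightarrow> real mat" where
    "B = (\<lambda>l. Matrix.mat d d (\<lambda>(i, j). if l = 1 then - (if i = j then 1 / 2 else 0) - (if i = i0 then \<beta> else 0) else 0))"
  have coeffs: "varma_coeffs d p q A B" by (auto simp: varma_coeffs_def A_def B_def)
  have root: "root_condition d p A"
    by (rule root_condition_triangular[where \<alpha> = "1 / 2"]) (auto simp: A_def)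
  interpret stable_coeffs d p q A B "\<lambda>_. 1" by unfold_locales (fact coeffs, fact root)
  define g where "g = (\<lambda>(v :: int \<times> nat) u j. if u = fst v then (if snd v = j then 1 else 0)
     else if u < fst v \<and> snd v = i0 then - \<beta> * (1 / 2) ^ nat (fst v - u - 1) else 0 :: real)"
  have rsp: "rsp (t, i) u j = g (t, i) u j" if "i < d" "j < d" for t i u j
  proof (rule response_unique[OF _ _ that])
    show "g (t, i) u j = 0" if "t < u" for t i u j
      using that by (auto simp: g_def)
    fix t :: int and i and u :: int and j assume ij: "i < d" "j < d" and u: "u \<le> t"
    have "(\<Sum>l\<le>p. \<Sum>m<d. A l $$ (i, m) * g (t - int l, m) u j) = (\<Sum>l\<in>{1}. \<Sum>m<d. A l $$ (i, m) * g (t - int l, m) u j)"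
      using ij pq by (intro sum.mono_neutral_right) (auto simp: A_def)
    also have "\<dots> = (\<Sum>m<d. A 1 $$ (i, m) * g (t - 1, m) u j)" by simp
    also have "\<dots> = (\<Sum>m<d. (if i = m then 1 else 0) * (g (t - 1, m) u j / 2))"
      using ij by (intro sum.cong refl) (simp add: A_def)
    finally have s: "(\<Sum>l\<le>p. \<Sum>m<d. A l $$ (i, m) * g (t - int l, m) u j) = g (t - 1, i) u j / 2"
      using ij by (simp only: sum_kronecker)
    consider "u = t" | "t = u + 1" | "u + 1 < t" using u by linarith
    then have "g (t, i) u j = g (t - 1, i) u j / 2 +
      (if u = t then if i = j then 1 else 0 else if u < t \<and> t \<le> u + int q then B (nat (t - u)) $$ (i, j) else 0)"
    proof cases
      case 1
      then show ?thesis by (simp add: g_def)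
    next
      case 2
      then show ?thesis using ij pq by (simp add: g_def B_def)
    next
      case 3
      then have "nat (t - u - 1) = Suc (nat (t - 1 - u - 1))" by simp
      moreover have "nat (t - u) \<noteq> 1" using 3 by simp
      then have "B (nat (t - u)) $$ (i, j) = 0" using ij by (simp add: B_def)
      ultimately show ?thesis using 3 by (simp add: g_def)
    qed
    then show "g (t, i) u j = (\<Sum>l\<le>p. \<Sum>m<d. A l $$ (i, m) * g (t - int l, m) u j) +
      (if u = t then if i = j then 1 else 0 else if u < t \<and> t \<le> u + int q then B (nat (t - u)) $$ (i, j) else 0)"
      using s by simp
  qed
  have sums: "(\<lambda>k. \<Sum>m<d. g x (fst y - int k) m * g y (fst y - int k) m) sums gam x y"
    if xy: "snd x < d" "snd y < d" for x y
  proof -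
    have "(\<lambda>k. \<Sum>m<d. 1 * rsp y (fst y - int k) m * rsp x (fst y - int k) m) sums gam x y"
      using autocov_sums[OF xy(2,1) order_refl] autocov_sym[OF xy] by simp
    moreover have "rsp v u m = g v u m" if "snd v < d" "m < d" for v u m
      using rsp[OF that, of "fst v" u] by simp
    ultimately show ?thesis using xy by (simp add: mult.commute)
  qed
  have diag: "1 \<le> gam x x" if x: "snd x < d" for x
  proof -
    let ?f = "\<lambda>k. \<Sum>m<d. g x (fst x - int k) m * g x (fst x - int k) m"
    have "sum ?f {0} \<le> suminf ?f"
      by (rule sum_le_suminf[OF sums_summable[OF sums[OF x x]]]) (auto intro!: sum_nonneg)
    moreover have "?f 0 = 1" using x by (simp add: g_def if_distrib[of "\<lambda>u. u * _"] cong: if_cong)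
    ultimately show ?thesis using sums_unique[OF sums[OF x x]] by simp
  qed
  have later: "- \<beta> \<le> gam x y \<and> gam x y \<le> 0 \<and> (snd x = i0 \<longrightarrow> gam x y < 0)"
    if xy: "snd x < d" "snd y < d" "fst y < fst x" for x y
  proof -
    define h where "h = nat (fst x - fst y)"
    have fx: "fst x = fst y + int h" "1 \<le> h" using xy by (auto simp: h_def)
    define f where "f = (\<lambda>k. \<Sum>m<d. g x (fst y - int k) m * g y (fst y - int k) m)"
    have f: "f sums gam x y" unfolding f_def by (rule sums[OF xy(1,2)])
    show ?thesis
    proof (cases "snd x = i0")
      case False
      then have "f = (\<lambda>k. 0)" using fx by (auto simp: f_def g_def)
      then have "gam x y = 0" using f sums_unique2[OF sums_zero, of "gam x y"] by simp
      then show ?thesis using \<beta> False by simp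
    next
      case True
      have gx: "g x (fst y - int k) m = - \<beta> * (1 / 2) ^ (k + h - 1)" for k m
      proof -
        have "nat (fst x - (fst y - int k) - 1) = k + h - 1" using fx by (simp add: nat_diff_distrib)
        then show ?thesis using True fx by (simp add: g_def)
      qed
      have f0: "f 0 = - \<beta> * (1 / 2) ^ (h - 1)"
      proof -
        have "f 0 = (\<Sum>m<d. - \<beta> * (1 / 2) ^ (h - 1) * (if snd y = m then 1 else 0))"
          unfolding f_def gx by (intro sum.cong refl) (simp add: g_def)
        then show ?thesis by (simp only: sum_kronecker(3)[OF xy(2)])
      qed
      \<comment> \<open>The overlap of tails: \<open>y\<close> depends on innovations before its own
        time only if it lies in component \<open>i0\<close>, and then on all \<open>d\<close> of
        them with equal weight.\<close>
      define \<kappa> where "\<kappa> = (if snd y = i0 then real d * \<beta>\<^sup>2 else 0)"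
      have \<kappa>: "0 \<le> \<kappa>" "\<kappa> \<le> \<beta>"
      proof -
        show "0 \<le> \<kappa>" by (simp add: \<kappa>_def)
        have "\<beta> * (\<beta> * real d) \<le> \<beta> * 1" using \<beta> \<beta>1 by (intro mult_left_mono) auto
        then show "\<kappa> \<le> \<beta>" using \<beta> by (simp add: \<kappa>_def power2_eq_square mult_ac)
      qed
      have fS: "f (Suc k) = \<kappa> * (1 / 2) ^ h * (1 / 4) ^ k" for k
      proof -
        have "g y (fst y - int (Suc k)) m = (if snd y = i0 then - \<beta> * (1 / 2) ^ k else 0)" for m
          by (simp add: g_def nat_diff_distrib)
        then have "f (Suc k) = (if snd y = i0 then real d * (\<beta> * \<beta> * ((1 / 2) ^ (k + h) * (1 / 2) ^ k)) else 0)"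
          unfolding f_def gx by simp
        also have "(1 / 2 :: real) ^ (k + h) * (1 / 2) ^ k = (1 / 2) ^ h * (1 / 4) ^ k"
          by (simp add: power_add power_mult_distrib[symmetric] mult_ac)
        finally show ?thesis by (simp add: \<kappa>_def power2_eq_square)
      qed
      have "(\<lambda>k. \<kappa> * (1 / 2) ^ h * (1 / 4) ^ k) sums (\<kappa> * (1 / 2) ^ h * (1 / (1 - 1 / 4)))"
        by (intro sums_mult geometric_sums) simp
      then have "(\<lambda>k. f (Suc k)) sums (\<kappa> * (1 / 2) ^ h * (4 / 3))" unfolding fS by simp
      then have "f sums (\<kappa> * (1 / 2) ^ h * (4 / 3) + f 0)" by (simp add: sums_Suc_iff)
      then have "gam x y = \<kappa> * (1 / 2) ^ h * (4 / 3) + f 0" using f sums_unique2 by blast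
      also have "(1 / 2 :: real) ^ (h - 1) = 2 * (1 / 2) ^ h" using fx(2) by (cases h) auto
      then have "f 0 = - 2 * \<beta> * (1 / 2) ^ h" using f0 by simp
      \<comment> \<open>The factor 4/3 sums the geometric series of ratio 1/4. As
        \<open>\<kappa> \<le> \<beta>\<close>, the bracket is negative; as
        \<open>(1 / 2) ^ h \<le> 1 / 2\<close>, the product is at least
        \<open>- \<beta>\<close>.\<close>
      finally have gam: "gam x y = (1 / 2) ^ h * (\<kappa> * (4 / 3) - 2 * \<beta>)" by (simp add: algebra_simps)
      have h2: "0 < (1 / 2 :: real) ^ h" "(1 / 2 :: real) ^ h \<le> 1 / 2"
        using fx(2) power_decreasing[of 1 h "1 / 2 :: real"] by auto
      have "gam x y < 0" unfolding gam using h2(1) \<kappa> \<beta> by (intro mult_pos_neg) auto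
      moreover have "(1 / 2) ^ h * (2 * \<beta>) \<le> 1 / 2 * (2 * \<beta>)" using h2 \<beta> by (intro mult_right_mono) auto
      moreover have "0 \<le> (1 / 2) ^ h * (\<kappa> * (4 / 3))" using \<kappa> by simp
      ultimately have "gam x y < 0" "- \<beta> \<le> gam x y" unfolding gam right_diff_distrib by linarith+
      then show ?thesis by simp
    qed
  qed
  have off: "- \<beta> \<le> gam x y \<and> gam x y \<le> 0" if xy: "snd x < d" "snd y < d" "x \<noteq> y" for x y
  proof -
    consider "fst y < fst x" | "fst x < fst y" | "fst x = fst y" by linarith
    then show ?thesis
    proof cases
      case 1
      then show ?thesis using later[OF xy(1,2)] by simp
    next
      case 2
      then show ?thesis using later[OF xy(2,1)] autocov_sym[OF xy(1,2)] by simp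
    next
      case 3
      then have ne: "snd x \<noteq> snd y" using xy(3) by (auto simp: prod_eq_iff)
      have "g x (fst y - int k) m * g y (fst y - int k) m = 0" for k m
        using ne 3 by (auto simp: g_def)
      then have "(\<lambda>k. 0) sums gam x y" using sums[OF xy(1,2)] by simp
      then have "gam x y = 0" using sums_unique2[OF sums_zero, of "gam x y"] by simp
      then show ?thesis using \<beta> by simp
    qed
  qed
  have sndD: "snd x < d" if "x \<in> insert c (insert a D)" for x using that D ac by auto
  have "minor_num d p q A B (\<lambda>_. 1) a c D \<noteq> 0"
  proof (rule minor_num_nonzero[OF D ac(1,2,3)])
    fix k assume k: "\<And>x. x \<in> insert c D \<Longrightarrow> (\<Sum>y\<in>insert a D. k y * gam y x) = 0"
    show "\<forall>y\<in>insert a D. k y = 0"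
    proof (rule zmatrix_kernel_trivial[OF D(1) ac(4) _ _ _ k])
      show "gam x y \<le> 0" if "x \<in> insert a D" "y \<in> insert c D" "x \<noteq> y" for x y
      proof -
        have "snd x < d" "snd y < d" using that(1,2) by (auto intro!: sndD)
        then show ?thesis using off[of x y] that(3) by blast
      qed
      show "0 < (\<Sum>y\<in>insert a D. gam y x)" if x: "x \<in> D" for x
      proof (rule diag_imp_row_pos[of _ x _ \<beta>])
        have xd: "snd x < d" using x by (auto intro!: sndD)
        show "1 \<le> gam x x" by (rule diag[OF xd])
        show "- \<beta> \<le> gam y x" if "y \<in> insert a D" "y \<noteq> x" for y
        proof -
          have "snd y < d" using that(1) by (auto intro!: sndD)
          then show ?thesis using off[of y x] xd that(2) by blast
        qed
      qed (use x D \<beta> \<beta>2 in auto)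
      have "gam a c < 0"
        using later[OF ac(2,1) t] autocov_sym[OF ac(1,2)] by (simp add: i0_def)
      then show "\<exists>x\<in>P. gam x c < 0" if "a \<in> P" for P using that by blast
    qed
  qed
  then show ?thesis using coeffs root by blast
qed

lemma ar_witness:
  assumes D: "finite D" "D \<subseteq> UNIV \<times> {..<d}" and ac: "snd a < d" "snd c < d" "a \<notin> D" "c \<notin> insert a D"
    and t: "fst a < fst c"
    and gap: "\<And>x. fst a \<le> x \<Longrightarrow> x < fst c \<Longrightarrow>
      fst c \<le> x + int p \<or> (\<exists>v. snd v < d \<and> v \<notin> D \<and> x < fst v \<and> fst v \<le> x + int p)"
  shows "\<exists>A B. varma_coeffs d p 0 A B \<and> root_condition d p A \<and> minor_num d p 0 A B (\<lambda>_. 1) a c D \<noteq> 0"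
proof -
  \<comment> \<open>A row of the precision matrix reaches \<open>p\<close> times in both directions,
    which is less than \<open>2 * ((p + 1) * d)\<close> nodes. With the factor 4 its off-diagonal
    entries sum to at least -1/2.\<close>
  define \<eta> where "\<eta> = 1 / real (4 * ((p + 1) * d))"
  have d: "0 < d" using ac by simp
  have pos: "0 < real (4 * ((p + 1) * d))" using d by (simp only: of_nat_0_less_iff) simp
  have \<eta>: "0 < \<eta>" unfolding \<eta>_def using pos by simp
  have \<eta>_eq: "\<eta> * real ((p + 1) * d) = 1 / 4"
    unfolding \<eta>_def by (rule reciprocal_bounds(4)[OF pos]) simp
  define A :: "nat \<Rightarrow> real mat" where "A = (\<lambda>k. Matrix.mat d d (\<lambda>(i, j). if k = 0 \<and> i \<le> j then 0 else \<eta>))"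
  define B :: "nat \<Rightarrow> real mat" where "B = (\<lambda>l. 0\<^sub>m d d)"
  have coeffs: "varma_coeffs d p 0 A B" by (auto simp: varma_coeffs_def A_def B_def)
  have root: "root_condition d p A"
    by (rule root_condition_small[of _ _ _ \<eta>]) (use \<eta> \<eta>_eq in \<open>auto simp: A_def\<close>)
  interpret stable_coeffs d p 0 A B "\<lambda>_. 1" by unfold_locales (fact coeffs, fact root)
  let ?V = "UNIV \<times> {..<d} :: (int \<times> nat) set"
  let ?r = "\<lambda>v n. rsp v (fst n) (snd n)"
  define win where "win = (\<lambda>s t :: int. {s..t} \<times> {..<d})"
  have fin_win [simp]: "finite (win s t)" for s t by (simp add: win_def)
  have mem_win: "n \<in> win s t \<longleftrightarrow> s \<le> fst n \<and> fst n \<le> t \<and> snd n < d" for n s t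
    by (auto simp: win_def mem_Times_iff)
  have kron: "(\<Sum>n\<in>Z. (if v = n then 1 else 0) * h n) = h v" if "finite Z" "v \<in> Z" for Z v and h :: "int \<times> nat \<Rightarrow> real"
    using that by (simp add: if_distrib[of "\<lambda>u. u * _"] cong: if_cong)
  \<comment> \<open>The sum over lags as a sum over preceding nodes. Any finite set around the
    window of lags will do, because \<open>prec\<close> vanishes outside it; later steps choose this
    set to suit several nodes at once.\<close>
  have lags: "(\<Sum>l\<le>p. \<Sum>m<d. A l $$ (snd x, m) * h (fst x - int l, m)) = (\<Sum>y\<in>Z. \<eta> * prec p y x * h y)"
    if x: "snd x < d" and Z: "finite Z" "Z \<subseteq> ?V" "win (fst x - int p) (fst x) \<subseteq> Z" for x Z and h :: "int \<times> nat \<Rightarrow> real"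
  proof -
    have "(\<Sum>y\<in>Z. \<eta> * prec p y x * h y) = (\<Sum>y\<in>win (fst x - int p) (fst x). \<eta> * prec p y x * h y)"
      using Z prec_nonzero_time[of p _ x] by (intro sum.mono_neutral_right) (fastforce simp: mem_win)+
    also have "\<dots> = (\<Sum>s\<in>{fst x - int p..fst x}. \<Sum>m<d. \<eta> * prec p (s, m) x * h (s, m))"
      by (simp add: win_def sum.cartesian_product case_prod_beta)
    also have "\<dots> = (\<Sum>l\<le>p. \<Sum>m<d. \<eta> * prec p (fst x - int l, m) x * h (fst x - int l, m))"
      by (rule sum.reindex_bij_witness[of _ "\<lambda>l. fst x - int l" "\<lambda>s. nat (fst x - s)"]) auto
    also have "\<dots> = (\<Sum>l\<le>p. \<Sum>m<d. A l $$ (snd x, m) * h (fst x - int l, m))"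
      using x by (intro sum.cong refl) (auto simp: A_def prec_def)
    finally show ?thesis by simp
  qed
  have r_rec: "?r x n = (\<Sum>y\<in>Z. \<eta> * prec p y x * ?r y n) + (if x = n then 1 else 0)"
    if "snd x < d" "snd n < d" "finite Z" "Z \<subseteq> ?V" "win (fst x - int p) (fst x) \<subseteq> Z" for x n Z
    using response_recursion[OF that(1,2), of "fst x" "fst n"] lags[OF that(1,3,4,5), of "\<lambda>y. ?r y n"]
    by (auto simp: prod_eq_iff)
  have r_late: "?r v n = 0" if "fst v < fst n" for v n using that by (simp add: response_def)

  \<comment> \<open>\<open>(I - \<eta> N) \<Sigma> = \<Psi>\<^sup>T\<close>\<close>
  have filter: "gam x v - (\<Sum>y\<in>Z. \<eta> * prec p y x * gam y v) = ?r v x"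
    if xv: "snd x < d" "snd v < d" and Z: "finite Z" "Z \<subseteq> ?V" "win (fst x - int p) (fst x) \<subseteq> Z" for x v Z
  proof -
    obtain T where T: "\<And>y. y \<in> insert x Z \<Longrightarrow> fst y \<le> T"
      using Z(1) by (metis Max_ge finite.insertI finite_imageI imageI)
    let ?f = "\<lambda>y k. \<Sum>m<d. rsp y (T - int k) m * rsp v (T - int k) m"
    have s: "?f y sums gam y v" if "y \<in> insert x Z" for y
      using autocov_sums[of y v T] that Z(2) xv T by auto
    have "(\<lambda>k. ?f x k - (\<Sum>y\<in>Z. \<eta> * prec p y x * ?f y k)) sums (gam x v - (\<Sum>y\<in>Z. \<eta> * prec p y x * gam y v))"
      by (intro sums_diff sums_sum sums_mult s) auto
    moreover have "?f x k - (\<Sum>y\<in>Z. \<eta> * prec p y x * ?f y k) = (if k = nat (T - fst x) then ?r v x else 0)" for k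
    proof -
      have "?f x k - (\<Sum>y\<in>Z. \<eta> * prec p y x * ?f y k) =
          (\<Sum>m<d. rsp x (T - int k) m * rsp v (T - int k) m) -
          (\<Sum>m<d. (\<Sum>y\<in>Z. \<eta> * prec p y x * rsp y (T - int k) m) * rsp v (T - int k) m)"
        by (simp only: sum_distrib_left sum_distrib_right mult.assoc) (subst sum.swap, rule refl)
      also have "\<dots> = (\<Sum>m<d. (if x = (T - int k, m) then 1 else 0) * rsp v (T - int k) m)"
        unfolding sum_subtractf[symmetric] left_diff_distrib[symmetric]
      proof (rule sum.cong[OF refl])
        fix m assume "m \<in> {..<d}"
        then show "(rsp x (T - int k) m - (\<Sum>y\<in>Z. \<eta> * prec p y x * rsp y (T - int k) m)) * rsp v (T - int k) m =
            (if x = (T - int k, m) then 1 else 0) * rsp v (T - int k) m"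
          using r_rec[OF xv(1) _ Z, of "(T - int k, m)"] by simp
      qed
      also have "\<dots> = (if k = nat (T - fst x) then ?r v x else 0)"
      proof (cases "k = nat (T - fst x)")
        case True
        then have Tk: "T - int k = fst x" using T[of x] by simp
        have "(\<Sum>m<d. (if x = (T - int k, m) then 1 else 0) * rsp v (T - int k) m) =
            (\<Sum>m<d. (if snd x = m then 1 else 0) * rsp v (fst x) m)"
          unfolding Tk by (intro sum.cong refl) (auto simp: prod_eq_iff)
        then show ?thesis using True xv by (simp only: sum_kronecker) simp
      next
        case False
        then have "T - int k \<noteq> fst x" by auto
        then show ?thesis using False by (intro trans[OF sum.neutral]) auto
      qed
      finally show ?thesis .
    qed
    ultimately have "(\<lambda>k. if k = nat (T - fst x) then ?r v x else 0) sums (gam x v - (\<Sum>y\<in>Z. \<eta> * prec p y x * gam y v))"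
      by simp
    then show ?thesis using sums_single[of "nat (T - fst x)" "\<lambda>_. ?r v x"] sums_unique2 by blast
  qed

  \<comment> \<open>\<open>\<Psi> (I - \<eta> N) = I\<close>\<close>
  have right_inv: "?r v y - (\<Sum>x\<in>Z. ?r v x * (\<eta> * prec p y x)) = (if v = y then 1 else 0)"
    if vy: "snd v < d" "snd y < d" and Z: "finite Z" "Z \<subseteq> ?V" "win (fst y) (fst y + int p) \<subseteq> Z" for v y Z
  proof (cases "fst v < fst y")
    case True
    have "?r v x * (\<eta> * prec p y x) = 0" for x
      using r_late[of v x] True prec_nonzero_time[of p y x] by (cases "prec p y x = 0") auto
    then show ?thesis using True r_late[OF True] by auto
  next
    case False
    \<comment> \<open>Nodes before \<open>fst y\<close> or after \<open>fst v\<close> contribute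
      nothing, by causality. On the finite window in between the matrices are square, so that a
      one-sided inverse is two-sided.\<close>
    define U where "U = win (fst y) (fst v)"
    have U: "finite U" "v \<in> U" "y \<in> U" using vy False by (auto simp: U_def mem_win)
    have "(\<Sum>x\<in>U. ?r v x * ((if x = y then 1 else 0) - \<eta> * prec p y x)) = (if v = y then 1 else 0)"
    proof (rule left_inverse_imp_right_inverse_on[where N = ?r and
          M = "\<lambda>a b. (if a = b then 1 else 0) - \<eta> * prec p b a", OF U(1) _ U(2,3)])
      fix x z assume xz: "x \<in> U" "z \<in> U"
      let ?Z = "U \<union> win (fst x - int p) (fst x)"
      have "(\<Sum>w\<in>U. ((if x = w then 1 else 0) - \<eta> * prec p w x) * ?r w z) =
          (\<Sum>w\<in>U. (if x = w then 1 else 0) * ?r w z) - (\<Sum>w\<in>U. \<eta> * prec p w x * ?r w z)"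
        unfolding sum_subtractf[symmetric] by (intro sum.cong refl) (auto simp: algebra_simps)
      also have "(\<Sum>w\<in>U. (if x = w then 1 else 0) * ?r w z) = ?r x z" by (rule kron[OF U(1) xz(1)])
      also have "(\<Sum>w\<in>U. \<eta> * prec p w x * ?r w z) = (\<Sum>w\<in>?Z. \<eta> * prec p w x * ?r w z)"
      proof (rule sum.mono_neutral_left)
        show "\<forall>w\<in>?Z - U. \<eta> * prec p w x * ?r w z = 0"
        proof
          fix w assume "w \<in> ?Z - U"
          then have "fst w < fst z" using xz by (auto simp: U_def mem_win)
          then show "\<eta> * prec p w x * ?r w z = 0" using r_late by simp
        qed
      qed (use U in auto)
      also have "?r x z - \<dots> = (if x = z then 1 else 0)"
      proof -
        have "snd x < d" "snd z < d" using xz by (auto simp: U_def mem_win)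
        moreover have "finite ?Z" "?Z \<subseteq> ?V" "win (fst x - int p) (fst x) \<subseteq> ?Z"
          using U(1) by (auto simp: U_def win_def)
        ultimately show ?thesis by (subst r_rec[of x z ?Z]) simp_all
      qed
      finally show "(\<Sum>w\<in>U. ((if x = w then 1 else 0) - \<eta> * prec p w x) * ?r w z) = (if x = z then 1 else 0)" .
    qed
    also have "(\<Sum>x\<in>U. ?r v x * ((if x = y then 1 else 0) - \<eta> * prec p y x)) =
        (\<Sum>x\<in>U. (if y = x then 1 else 0) * ?r v x) - (\<Sum>x\<in>U. ?r v x * (\<eta> * prec p y x))"
      unfolding sum_subtractf[symmetric] by (intro sum.cong refl) (auto simp: algebra_simps)
    also have "(\<Sum>x\<in>U. (if y = x then 1 else 0) * ?r v x) = ?r v y" by (rule kron[OF U(1,3)])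
    also have "(\<Sum>x\<in>U. ?r v x * (\<eta> * prec p y x)) = (\<Sum>x\<in>U \<union> Z. ?r v x * (\<eta> * prec p y x))"
    proof (rule sum.mono_neutral_left)
      show "\<forall>x\<in>(U \<union> Z) - U. ?r v x * (\<eta> * prec p y x) = 0"
      proof
        fix x assume "x \<in> (U \<union> Z) - U"
        then have "fst x < fst y \<or> fst v < fst x" using Z(2) by (auto simp: U_def mem_win)
        then show "?r v x * (\<eta> * prec p y x) = 0"
          using r_late[of v x] prec_nonzero_time[of p y x] by auto
      qed
    qed (use U Z in auto)
    also have "\<dots> = (\<Sum>x\<in>Z. ?r v x * (\<eta> * prec p y x))"
    proof (rule sum.mono_neutral_right)
      show "\<forall>x\<in>(U \<union> Z) - Z. ?r v x * (\<eta> * prec p y x) = 0"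
      proof
        fix x assume x: "x \<in> (U \<union> Z) - Z"
        then have "x \<notin> win (fst y) (fst y + int p)" "snd x < d" using Z(3) by (auto simp: U_def mem_win)
        then show "?r v x * (\<eta> * prec p y x) = 0"
          using prec_nonzero_time[of p y x] by (auto simp: mem_win)
      qed
    qed (use U Z in auto)
    finally show ?thesis .
  qed

  \<comment> \<open>Times up to \<open>p\<close> before and after \<open>y\<close>: the window
    contains the children of \<open>y\<close> and their parents, hence all columns with a nonzero
    entry in row \<open>y\<close> of the precision matrix.\<close>
  define Z where "Z = (\<lambda>y :: int \<times> nat. win (fst y - int p) (fst y + int p))"
  define K where "K = (\<lambda>y z. \<Sum>n\<in>Z y. ((if y = n then 1 else 0) - \<eta> * prec p y n) * ((if z = n then 1 else 0) - \<eta> * prec p z n))"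
  have Z: "finite (Z y)" "Z y \<subseteq> ?V" for y by (auto simp: Z_def mem_win)
  have \<eta>_half: "\<eta> * real ((p + 1) * d) \<le> 1 / 2" using \<eta>_eq by simp
  have K_entries: "(y = z \<longrightarrow> 1 \<le> K y z) \<and> (y \<noteq> z \<longrightarrow> - \<eta> \<le> K y z \<and> K y z < 0)"
    if y: "snd y < d" and z: "z \<in> Z y" for y z
  proof -
    have mem: "y \<in> Z y" "\<And>n. n \<in> Z y \<Longrightarrow> snd n < d" using y by (auto simp: Z_def mem_win)
    have adj: "\<bar>fst y - fst z\<bar> \<le> int p" using z by (auto simp: Z_def mem_win)
    show ?thesis
      using gram_entries[OF Z(1) mem(1) z _ disjI2[OF refl] \<eta> \<eta>_half K_def[THEN fun_cong, THEN fun_cong, of y z]]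
        mem(2) adj by blast
  qed
  have K_row: "0 < (\<Sum>z\<in>Z y. K y z)" if y: "snd y < d" for y
  proof (rule diag_imp_row_pos[OF Z(1), of y _ _ \<eta>])
    have "card (Z y) = (2 * p + 1) * d"
      by (simp add: Z_def win_def card_cartesian_product nat_add_distrib nat_mult_distrib)
    then have "\<eta> * real (card (Z y)) \<le> 2 * (\<eta> * real ((p + 1) * d))"
      using \<eta> by (simp add: algebra_simps)
    then show "\<eta> * real (card (Z y)) < 1" using \<eta>_eq by simp
  qed (use K_entries[OF y] y \<eta> in \<open>auto simp: Z_def mem_win\<close>)

  have sndD: "snd x < d" if "x \<in> insert c (insert a D)" for x using that D ac by auto
  have "minor_num d p 0 A B (\<lambda>_. 1) a c D \<noteq> 0"
  proof (rule minor_num_nonzero[OF D ac(1,2,3)])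
    fix k0 assume k0: "\<And>x. x \<in> insert c D \<Longrightarrow> (\<Sum>y\<in>insert a D. k0 y * gam y x) = 0"
    define u where "u = (\<lambda>k x. \<Sum>v\<in>insert a D. k v * gam x v)"
    have fin: "finite (insert a D)" using D by simp
    \<comment> \<open>K u = k in two steps: I - \<eta> N turns the potential into the transposed
      responses applied to the charge, by \<open>filter\<close>; the transposed factor then recovers
      the charge, by \<open>right_inv\<close>.\<close>
    have Ku: "(\<Sum>z\<in>Z y. K y z * u k z) = (if y \<in> insert a D then k y else 0)" if y: "snd y < d" for y k
    proof -
      define w where "w = (\<lambda>n. \<Sum>v\<in>insert a D. k v * ?r v n)"
      have w: "(\<Sum>z\<in>Z y. ((if z = n then 1 else 0) - \<eta> * prec p z n) * u k z) = w n"
        if n: "n \<in> win (fst y) (fst y + int p)" for n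
      proof -
        have nZ: "n \<in> Z y" "snd n < d" "win (fst n - int p) (fst n) \<subseteq> Z y"
          using n by (auto simp: Z_def mem_win)
        have "(\<Sum>z\<in>Z y. ((if z = n then 1 else 0) - \<eta> * prec p z n) * u k z) =
            (\<Sum>z\<in>Z y. (if n = z then 1 else 0) * u k z) - (\<Sum>z\<in>Z y. \<eta> * prec p z n * u k z)"
          unfolding sum_subtractf[symmetric] by (intro sum.cong refl) (auto simp: algebra_simps)
        also have "\<dots> = u k n - (\<Sum>z\<in>Z y. \<eta> * prec p z n * u k z)"
          by (simp only: kron[OF Z(1) nZ(1)])
        also have "(\<Sum>z\<in>Z y. \<eta> * prec p z n * u k z) = (\<Sum>v\<in>insert a D. k v * (\<Sum>z\<in>Z y. \<eta> * prec p z n * gam z v))"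
          unfolding u_def sum_distrib_left by (subst sum.swap) (simp add: mult_ac)
        also have "u k n - \<dots> = (\<Sum>v\<in>insert a D. k v * (gam n v - (\<Sum>z\<in>Z y. \<eta> * prec p z n * gam z v)))"
          unfolding u_def by (simp only: right_diff_distrib sum_subtractf)
        also have "\<dots> = w n"
          unfolding w_def using sndD nZ(2)
          by (intro sum.cong refl, subst filter[OF _ _ Z nZ(3)]) auto
        finally show ?thesis .
      qed
      have nbr: "win (fst y) (fst y + int p) \<subseteq> Z y" by (auto simp: Z_def mem_win)
      have yZ: "y \<in> Z y" using y by (auto simp: Z_def mem_win)
      have zero: "(if y = n then 1 else 0) - \<eta> * prec p y n = 0" if "n \<in> Z y - win (fst y) (fst y + int p)" for n
        using that prec_nonzero_time[of p y n] by (auto simp: Z_def mem_win)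
      have "(\<Sum>z\<in>Z y. K y z * u k z) = (\<Sum>n\<in>Z y. ((if y = n then 1 else 0) - \<eta> * prec p y n) *
          (\<Sum>z\<in>Z y. ((if z = n then 1 else 0) - \<eta> * prec p z n) * u k z))"
        unfolding K_def sum_distrib_left sum_distrib_right by (subst sum.swap) (simp only: mult.assoc)
      also have "\<dots> = (\<Sum>n\<in>Z y. ((if y = n then 1 else 0) - \<eta> * prec p y n) * w n)"
      proof (rule sum.cong[OF refl])
        fix n assume "n \<in> Z y"
        then show "((if y = n then 1 else 0) - \<eta> * prec p y n) *
            (\<Sum>z\<in>Z y. ((if z = n then 1 else 0) - \<eta> * prec p z n) * u k z) =
            ((if y = n then 1 else 0) - \<eta> * prec p y n) * w n"
          using zero[of n] w[of n] by (cases "n \<in> win (fst y) (fst y + int p)") auto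
      qed
      also have "\<dots> = (\<Sum>n\<in>Z y. (if y = n then 1 else 0) * w n) - (\<Sum>n\<in>Z y. \<eta> * prec p y n * w n)"
        by (simp only: left_diff_distrib sum_subtractf)
      also have "\<dots> = w y - (\<Sum>n\<in>Z y. \<eta> * prec p y n * w n)"
        by (simp only: kron[OF Z(1) yZ])
      also have "(\<Sum>n\<in>Z y. \<eta> * prec p y n * w n) = (\<Sum>v\<in>insert a D. k v * (\<Sum>n\<in>Z y. ?r v n * (\<eta> * prec p y n)))"
        unfolding w_def sum_distrib_left by (subst sum.swap) (simp add: mult_ac)
      also have "w y - \<dots> = (\<Sum>v\<in>insert a D. k v * (?r v y - (\<Sum>n\<in>Z y. ?r v n * (\<eta> * prec p y n))))"
        unfolding w_def by (simp only: right_diff_distrib sum_subtractf)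
      also have "\<dots> = (\<Sum>v\<in>insert a D. k v * (if v = y then 1 else 0))"
        using sndD y by (intro sum.cong refl, subst right_inv[OF _ _ Z nbr]) auto
      also have "\<dots> = (if y \<in> insert a D then k y else 0)"
        using fin by (simp add: if_distrib[of "times _"] cong: if_cong)
      finally show ?thesis .
    qed
    \<comment> \<open>Covariances decay in time, so \<open>u\<close> is small outside a finite set.
      This is what makes a negative minimum over infinitely many nodes attained.\<close>
    have lim: "finite {x. snd x < d \<and> e \<le> \<bar>u k x\<bar>}" if e: "0 < e" for e k
    proof -
      obtain C r where C: "0 \<le> C" "0 < r" "r < 1"
        "\<And>v w. snd v < d \<Longrightarrow> snd w < d \<Longrightarrow> \<bar>gam v w\<bar> \<le> C * r ^ nat \<bar>fst v - fst w\<bar>"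
        using autocov_decay by blast
      define Q where "Q = (\<Sum>v\<in>insert a D. \<bar>k v\<bar>) * C"
      have Q: "0 \<le> Q" unfolding Q_def using C(1) by (intro mult_nonneg_nonneg sum_nonneg) auto
      have "(\<lambda>n. Q * r ^ n) \<longlonglongrightarrow> 0"
        by (rule tendsto_mult_right_zero) (use C in \<open>auto intro!: LIMSEQ_realpow_zero\<close>)
      then have "\<forall>\<^sub>F n in sequentially. Q * r ^ n < e" using e by (rule order_tendstoD(2))
      then obtain n0 where n0: "\<And>n. n0 \<le> n \<Longrightarrow> Q * r ^ n < e" by (auto simp: eventually_sequentially)
      obtain t1 where t1: "\<And>v. v \<in> insert a D \<Longrightarrow> fst v \<le> t1"
        using fin by (metis Max_ge finite_imageI imageI)
      obtain t0 where t0: "\<And>v. v \<in> insert a D \<Longrightarrow> t0 \<le> fst v"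
        using fin by (metis Min_le finite_imageI imageI)
      have "{x. snd x < d \<and> e \<le> \<bar>u k x\<bar>} \<subseteq> win (t0 - int n0) (t1 + int n0)"
      proof
        fix x assume "x \<in> {x. snd x < d \<and> e \<le> \<bar>u k x\<bar>}"
        then have x: "snd x < d" "e \<le> \<bar>u k x\<bar>" by auto
        show "x \<in> win (t0 - int n0) (t1 + int n0)"
        proof (rule ccontr)
          assume "x \<notin> win (t0 - int n0) (t1 + int n0)"
          then have far: "fst x < t0 - int n0 \<or> t1 + int n0 < fst x" using x by (auto simp: mem_win)
          have "\<bar>u k x\<bar> \<le> (\<Sum>v\<in>insert a D. \<bar>k v\<bar> * \<bar>gam x v\<bar>)"
            unfolding u_def abs_mult[symmetric] by (rule sum_abs)
          also have "\<dots> \<le> (\<Sum>v\<in>insert a D. \<bar>k v\<bar> * (C * r ^ n0))"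
          proof (rule sum_mono)
            fix v assume v: "v \<in> insert a D"
            have "n0 \<le> nat \<bar>fst x - fst v\<bar>" using far t0[OF v] t1[OF v] by auto
            then have "C * r ^ nat \<bar>fst x - fst v\<bar> \<le> C * r ^ n0"
              using C by (intro mult_left_mono power_decreasing) auto
            then show "\<bar>k v\<bar> * \<bar>gam x v\<bar> \<le> \<bar>k v\<bar> * (C * r ^ n0)"
              using C(4)[of x v] x(1) sndD[of v] v by (intro mult_left_mono) auto
          qed
          also have "\<dots> = Q * r ^ n0" by (simp add: Q_def sum_distrib_right mult.assoc)
          also have "\<dots> < e" by (rule n0) simp
          finally show False using x by simp
        qed
      qed
      then show ?thesis using finite_subset fin_win by blast
    qed
    have nonneg: "0 \<le> u k x"
      if k: "\<And>x. x \<in> insert c D \<Longrightarrow> u k x = 0" and ka: "0 \<le> k a" and x: "snd x < d" for k x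
    proof (rule ccontr)
      assume "\<not> 0 \<le> u k x"
      then have neg: "u k x < 0" by simp
      define P where "P = {y. snd y < d \<and> - u k x \<le> \<bar>u k y\<bar>}"
      have P: "finite P" unfolding P_def by (rule lim) (use neg in simp)
      have xP: "x \<in> P" using x neg by (simp add: P_def)
      have "Min (u k ` P) \<in> u k ` P" using P xP by (intro Min_in) auto
      then obtain y where y: "Min (u k ` P) = u k y" "y \<in> P" by (rule imageE)
      have yle: "u k y \<le> u k z" if "z \<in> P" for z
        unfolding y(1)[symmetric] using P that by (intro Min_le) auto
      have yneg: "u k y < 0" using yle[OF xP] neg by simp
      have min: "u k y \<le> u k z" if z: "snd z < d" for z
      proof (cases "z \<in> P")
        case False
        then have "\<bar>u k z\<bar> < - u k x" using z by (auto simp: P_def)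
        then show ?thesis using yle[OF xP] by linarith
      qed (rule yle)
      have ys: "snd y < d" using y by (simp add: P_def)
      have "(\<Sum>z\<in>Z y. K y z * u k z) < 0"
      proof (rule zmatrix_row_neg[where x = y])
        show "K y z \<le> 0" if "z \<in> Z y" "z \<noteq> y" for z using K_entries[OF ys that(1)] that(2) by auto
        show "u k y \<le> u k z" if "z \<in> Z y" for z using that by (intro min) (auto simp: Z_def mem_win)
      qed (use Z ys yneg K_row[OF ys] in \<open>auto simp: Z_def mem_win\<close>)
      then have "(if y \<in> insert a D then k y else 0) < 0" using Ku[OF ys] by simp
      moreover have "y \<notin> D" using k[of y] yneg by auto
      ultimately show False using ka by (auto split: if_splits)
    qed
    have not_pos: "\<not> 0 < k a" if k: "\<And>x. x \<in> insert c D \<Longrightarrow> u k x = 0" for k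
    proof
      assume ka: "0 < k a"
      have nn: "0 \<le> u k x" if "snd x < d" for x
        by (rule nonneg) (use k ka that in auto)
      have spread: "0 < u k x" if x: "snd x < d" "x \<notin> insert a D" and y: "y \<in> Z x" "y \<noteq> x" "0 < u k y" for x y
      proof -
        have "u k x \<noteq> 0"
        proof (rule zmatrix_row_pos[OF Z(1) y(1)])
          show "K x z \<le> 0" if "z \<in> Z x" "z \<noteq> x" for z using K_entries[OF x(1) that(1)] that(2) by auto
          show "0 \<le> u k z" if "z \<in> Z x" for z using that by (intro nn) (auto simp: Z_def mem_win)
          show "0 \<le> (\<Sum>z\<in>Z x. K x z * u k z)" using Ku[OF x(1)] x(2) by simp
          show "K x y < 0" using K_entries[OF x(1) y(1)] y(2) by auto
        qed (use y in auto)
        then show ?thesis using nn[OF x(1)] by simp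
      qed
      have ua: "0 < u k a"
      proof -
        have "u k a \<noteq> 0"
        proof
          assume u0: "u k a = 0"
          have "(\<Sum>z\<in>Z a. K a z * u k z) \<le> 0"
          proof (rule sum_nonpos)
            fix z assume z: "z \<in> Z a"
            show "K a z * u k z \<le> 0"
            proof (cases "z = a")
              case False
              have "0 \<le> u k z" using z by (intro nn) (auto simp: Z_def mem_win)
              then show ?thesis using K_entries[OF ac(1) z] False by (intro mult_nonpos_nonneg) auto
            qed (simp add: u0)
          qed
          then show False using Ku[OF ac(1), of k] ka by simp
        qed
        then show ?thesis using nn[OF ac(1)] by simp
      qed
      \<comment> \<open>Nodes outside \<open>D\<close> and before \<open>c\<close> that positivity
        has reached. By \<open>gap\<close> the latest of them is within \<open>p\<close> of
        \<open>c\<close>, or of a later node outside \<open>D\<close> and before \<open>c\<close>;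
        either way a contradiction follows.\<close>
      define P where "P = {v. snd v < d \<and> v \<notin> D \<and> 0 < u k v \<and> fst a \<le> fst v \<and> fst v < fst c}"
      have "P \<subseteq> win (fst a) (fst c)" by (auto simp: P_def mem_win)
      then have finP: "finite P" using finite_subset fin_win by blast
      have aP: "a \<in> P" using ac ua t by (simp add: P_def)
      then obtain v where v: "v \<in> P" "\<And>w. w \<in> P \<Longrightarrow> fst w \<le> fst v"
        using ex_latest[OF finP] by blast
      have vP: "snd v < d" "v \<notin> D" "0 < u k v" "fst a \<le> fst v" "fst v < fst c" using v(1) by (auto simp: P_def)
      show False
      proof (cases "fst c \<le> fst v + int p")
        case True
        have "0 < u k c"
          by (rule spread[of c v]) (use ac vP True in \<open>auto simp: Z_def mem_win\<close>)
        then show False using k[of c] by simp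
      next
        case False
        then obtain w where w: "snd w < d" "w \<notin> D" "fst v < fst w" "fst w \<le> fst v + int p"
          using gap[of "fst v"] vP by blast
        have "0 < u k w"
          by (rule spread[of w v]) (use w vP in \<open>auto simp: Z_def mem_win\<close>)
        then have "w \<in> P" using w vP False by (auto simp: P_def)
        then show False using v(2)[of w] w by simp
      qed
    qed
    have u0: "u k0 x = 0" if x: "x \<in> insert c D" for x
    proof -
      have "u k0 x = (\<Sum>y\<in>insert a D. k0 y * gam y x)"
        unfolding u_def by (intro sum.cong refl arg_cong2[where f = times] autocov_sym sndD) (use x in auto)
      then show ?thesis using k0[OF x] by simp
    qed
    have u_minus: "u (\<lambda>v. - k0 v) x = - u k0 x" for x
      by (simp only: u_def mult_minus_left sum_negf)
    have "k0 a = 0" using not_pos[of k0] not_pos[of "\<lambda>v. - k0 v"] u0 u_minus by force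
    \<comment> \<open>Without charge at \<open>a\<close> the minimum principle applies to both
      signs, so the potential vanishes, and with it the charge K u.\<close>
    then have zero: "u k0 x = 0" if "snd x < d" for x
    proof -
      have "0 \<le> u k0 x" by (rule nonneg) (use u0 \<open>k0 a = 0\<close> that in auto)
      moreover have "0 \<le> u (\<lambda>v. - k0 v) x"
        by (rule nonneg) (use u0 u_minus \<open>k0 a = 0\<close> that in auto)
      ultimately show ?thesis using u_minus[of x] by simp
    qed
    show "\<forall>y\<in>insert a D. k0 y = 0"
    proof
      fix y assume y: "y \<in> insert a D"
      have "(\<Sum>z\<in>Z y. K y z * u k0 z) = 0"
        by (intro sum.neutral ballI) (use zero in \<open>auto simp: Z_def mem_win\<close>)
      then show "k0 y = 0" using Ku[of y k0] y sndD by simp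
    qed
  qed
  then show ?thesis using coeffs root by blast
qed

subsection \<open>Decoding the parameter vector\<close>

text \<open>The entries of the parameter vector: \<open>(0, i, j)\<close> is the entry of \<open>A 0\<close>, \<open>(k, i, j)\<close> that of \<open>A k\<close>
  for \<open>1 \<le> k \<le> p\<close>, and \<open>(p + l, i, j)\<close> that of \<open>B l\<close>.\<close>

definition slots :: "nat \<Rightarrow> nat \<Rightarrow> nat \<Rightarrow> (nat \<times> nat \<times> nat) list" where
  "slots d p q = concat (map (\<lambda>j. map (\<lambda>i. (0, i, j)) [Suc j..<d]) [0..<d]) @
     concat (map (\<lambda>j. map (\<lambda>i. (Suc (j div d), i, j mod d)) [0..<d]) [0..<d * (p + q)])"

definition slot_entry :: "nat \<Rightarrow> (nat \<Rightarrow> real mat) \<Rightarrow> (nat \<Rightarrow> real mat) \<Rightarrow> nat \<times> nat \<times> nat \<Rightarrow> real" where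
  "slot_entry p A B s = (case s of (k, i, j) \<Rightarrow> if k \<le> p then A k $$ (i, j) else B (k - p) $$ (i, j))"

definition slot_index :: "nat \<Rightarrow> nat \<Rightarrow> nat \<Rightarrow> nat \<times> nat \<times> nat \<Rightarrow> nat" where
  "slot_index d p q s = (SOME n. n < length (slots d p q) \<and> slots d p q ! n = s)"

text \<open>Decoding reads off coordinates, so the matrix entries are polynomial functions of
  \<open>\<theta>\<close> on the whole space and not only on the coefficient domain.\<close>

definition decode_A :: "nat \<Rightarrow> nat \<Rightarrow> nat \<Rightarrow> (nat \<Rightarrow> real) \<Rightarrow> nat \<Rightarrow> real mat" where
  "decode_A d p q \<theta> k = Matrix.mat d d (\<lambda>(i, j). if k = 0 \<and> i \<le> j then 0 else \<theta> (slot_index d p q (k, i, j)))"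

definition decode_B :: "nat \<Rightarrow> nat \<Rightarrow> nat \<Rightarrow> (nat \<Rightarrow> real) \<Rightarrow> nat \<Rightarrow> real mat" where
  "decode_B d p q \<theta> l = Matrix.mat d d (\<lambda>(i, j). \<theta> (slot_index d p q (p + l, i, j)))"

lemma length_slots: "length (slots d p q) = param_dim d p q"
proof -
  have "(\<Sum>j\<leftarrow>[0..<d]. d - Suc j) = (\<Sum>j<d. d - Suc j)"
    by (simp add: sum_list_distinct_conv_sum_set atLeast0LessThan)
  also have "\<dots> = (\<Sum>j<d. j)" by (rule sum.nat_diff_reindex)
  also have "\<dots> = d * (d - 1) div 2" using Sum_Ico_nat[of 0 d] by (simp add: atLeast0LessThan)
  finally have "(\<Sum>j\<leftarrow>[0..<d]. d - Suc j) = d * (d - 1) div 2" .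
  then show ?thesis
    by (simp add: slots_def param_dim_def length_concat o_def power2_eq_square sum_list_triv mult_ac)
qed

lemma slots_entries:
  assumes "varma_coeffs d p q A B"
  shows "vech_entries (A 0) @ vec_entries (hconcat d (map A [1..<Suc p] @ map B [1..<Suc q])) =
    map (slot_entry p A B) (slots d p q)"
proof -
  have A0: "dim_row (A 0) = d" "dim_col (A 0) = d"
    using assms by (auto simp: varma_coeffs_def)
  let ?Ms = "map A [1..<Suc p] @ map B [1..<Suc q]"
  have Ms: "?Ms ! b $$ (i, j) = slot_entry p A B (Suc b, i, j)" if "b < p + q" for b i j
    using that by (auto simp: nth_append slot_entry_def Suc_diff_le simp del: upt_Suc)
  have "concat (map (\<lambda>j. map (\<lambda>i. hconcat d ?Ms $$ (i, j)) [0..<d]) [0..<d * (p + q)]) =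
      concat (map (\<lambda>j. map (\<lambda>i. slot_entry p A B (Suc (j div d), i, j mod d)) [0..<d]) [0..<d * (p + q)])"
  proof (intro arg_cong[where f = concat] map_cong refl)
    fix j i assume j: "j \<in> set [0..<d * (p + q)]" and i: "i \<in> set [0..<d]"
    then have "j div d < p + q" by (simp add: less_mult_imp_div_less mult.commute)
    moreover have "hconcat d ?Ms $$ (i, j) = ?Ms ! (j div d) $$ (i, j mod d)"
      using i j by (simp add: hconcat_def del: upt_Suc)
    ultimately show "hconcat d ?Ms $$ (i, j) = slot_entry p A B (Suc (j div d), i, j mod d)"
      using Ms by simp
  qed
  moreover have "dim_row (hconcat d ?Ms) = d" "dim_col (hconcat d ?Ms) = d * (p + q)"
    by (simp_all add: hconcat_def)
  moreover have "vech_entries (A 0) = concat (map (\<lambda>j. map (\<lambda>i. slot_entry p A B (0, i, j)) [Suc j..<d]) [0..<d])"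
    by (simp add: vech_entries_def A0 slot_entry_def)
  ultimately show ?thesis
    by (simp add: slots_def vec_entries_def map_concat o_def del: upt_Suc)
qed

lemma slots_memI:
  "j < i \<Longrightarrow> i < d \<Longrightarrow> (0, i, j) \<in> set (slots d p q)"
  "1 \<le> k \<Longrightarrow> k \<le> p + q \<Longrightarrow> i < d \<Longrightarrow> j < d \<Longrightarrow> (k, i, j) \<in> set (slots d p q)"
proof -
  show "(0, i, j) \<in> set (slots d p q)" if "j < i" "i < d"
  proof -
    have "(0, i, j) \<in> set (map (\<lambda>i. (0, i, j)) [Suc j..<d])" "map (\<lambda>i. (0, i, j)) [Suc j..<d] \<in>
        set (map (\<lambda>j. map (\<lambda>i. (0, i, j)) [Suc j..<d]) [0..<d])"
      using that by (auto intro!: image_eqI[of _ _ j])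
    then show ?thesis unfolding slots_def set_append set_concat by (intro UnI1 UN_I)
  qed
  assume k: "1 \<le> k" "k \<le> p + q" "i < d" "j < d"
  \<comment> \<open>The position, in the horizontal concatenation, of column \<open>j\<close> of its
    \<open>k\<close>-th matrix.\<close>
  let ?n = "(k - 1) * d + j"
  have "?n < k * d" using k by (cases k) auto
  also have "\<dots> \<le> d * (p + q)" using k by (simp add: mult.commute)
  finally have "?n < d * (p + q)" .
  moreover have "?n div d = k - 1" "?n mod d = j" using k by auto
  moreover have "map (\<lambda>i. (Suc (?n div d), i, ?n mod d)) [0..<d] \<in>
      set (map (\<lambda>j. map (\<lambda>i. (Suc (j div d), i, j mod d)) [0..<d]) [0..<d * (p + q)])"
    using \<open>?n < d * (p + q)\<close> unfolding set_map by (intro imageI) simp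
  moreover have "(k, i, j) \<in> set (map (\<lambda>i. (Suc (?n div d), i, ?n mod d)) [0..<d])"
    unfolding \<open>?n div d = k - 1\<close> \<open>?n mod d = j\<close> using k by auto
  ultimately show "(k, i, j) \<in> set (slots d p q)"
    unfolding slots_def set_append set_concat by (intro UnI2 UN_I)
qed

lemma coeff_vector_slot:
  assumes "varma_coeffs d p q A B" and s: "s \<in> set (slots d p q)"
  shows "coeff_vector d p q A B (slot_index d p q s) = slot_entry p A B s"
proof -
  have "\<exists>n. n < length (slots d p q) \<and> slots d p q ! n = s" using s by (auto simp: in_set_conv_nth)
  then have n: "slot_index d p q s < length (slots d p q)" "slots d p q ! slot_index d p q s = s"
    unfolding slot_index_def by (metis (mono_tags, lifting) someI_ex)+
  then show ?thesis
    unfolding coeff_vector_def slots_entries[OF assms(1)] by (simp add: length_slots[symmetric])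
qed

text \<open>The parameter vector determines all relevant coefficients. In the theorem this carries
  \<open>root_condition\<close> from one choice of coefficients to any other with the same
  vector.\<close>

lemma decode_coeff_vector:
  assumes "varma_coeffs d p q A B"
  shows "k \<le> p \<Longrightarrow> decode_A d p q (coeff_vector d p q A B) k = A k"
    "1 \<le> l \<Longrightarrow> l \<le> q \<Longrightarrow> decode_B d p q (coeff_vector d p q A B) l = B l"
proof -
  assume k: "k \<le> p"
  have A: "A k \<in> carrier_mat d d" "\<And>i j. i < d \<Longrightarrow> j < d \<Longrightarrow> i \<le> j \<Longrightarrow> A 0 $$ (i, j) = 0"
    using assms k by (auto simp: varma_coeffs_def)
  show "decode_A d p q (coeff_vector d p q A B) k = A k"
  proof (rule eq_matI)
    fix i j assume "i < dim_row (A k)" "j < dim_col (A k)"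
    then have ij: "i < d" "j < d" using A by auto
    show "decode_A d p q (coeff_vector d p q A B) k $$ (i, j) = A k $$ (i, j)"
    proof (cases "k = 0 \<and> i \<le> j")
      case False
      then have "(k, i, j) \<in> set (slots d p q)"
        using slots_memI[of j i d p q] slots_memI(2)[of k p q i d j] ij k by (cases "k = 0") auto
      then show ?thesis
        using False ij k coeff_vector_slot[OF assms] by (auto simp: decode_A_def slot_entry_def)
    qed (use A ij in \<open>auto simp: decode_A_def\<close>)
  qed (use A in \<open>auto simp: decode_A_def\<close>)
next
  assume l: "1 \<le> l" "l \<le> q"
  have B: "B l \<in> carrier_mat d d" using assms l by (auto simp: varma_coeffs_def)
  show "decode_B d p q (coeff_vector d p q A B) l = B l"
  proof (rule eq_matI)
    fix i j assume "i < dim_row (B l)" "j < dim_col (B l)"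
    then have ij: "i < d" "j < d" using B by auto
    then have "(p + l, i, j) \<in> set (slots d p q)" using l by (intro slots_memI(2)) auto
    then show "decode_B d p q (coeff_vector d p q A B) l $$ (i, j) = B l $$ (i, j)"
      using ij l coeff_vector_slot[OF assms] by (simp add: decode_B_def slot_entry_def)
  qed (use B in \<open>auto simp: decode_B_def\<close>)
qed

lemma root_condition_cong:
  assumes "\<And>k. k \<le> p \<Longrightarrow> A k = A' k"
  shows "root_condition d p A \<longleftrightarrow> root_condition d p A'"
proof -
  have "(\<Sum>k=1..p. complex_of_real (A k $$ (i, j)) * z ^ (p - k)) =
      (\<Sum>k=1..p. complex_of_real (A' k $$ (i, j)) * z ^ (p - k))" for i j and z :: complex
    by (intro sum.cong refl) (simp add: assms)
  then show ?thesis using assms[of 0] by (simp add: root_condition_def)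
qed

text \<open>Coefficient families are functions on all indices, but a vector only fixes the relevant
  ones; decoded and original families agree just there.\<close>

lemma minor_num_cong:
  assumes A: "\<And>k. k \<le> p \<Longrightarrow> A k = A' k" and B: "\<And>l. 1 \<le> l \<Longrightarrow> l \<le> q \<Longrightarrow> B l = B' l"
    and s2: "\<And>m. m < d \<Longrightarrow> s2 m = s2' m"
  shows "minor_num d p q A B s2 a c D = minor_num d p q A' B' s2' a c D"
proof -
  have inv: "inv_A0 d A = inv_A0 d A'"
    using A[of 0] by (simp add: inv_A0_def fun_eq_iff)
  have comp: "companion d p q A B = companion d p q A' B'"
  proof (intro ext)
    fix x y :: "nat \<times> nat"
    have 1: "A (Suc (fst y)) = A' (Suc (fst y))" if "fst y < p" using that A by simp
    have 2: "B (fst y - p) = B' (fst y - p)" if "p < fst y \<and> fst y \<le> p + q"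
      using that by (intro B) auto
    show "companion d p q A B x y = companion d p q A' B' x y"
      unfolding companion_def inv case_prod_beta using 1 2 by (auto intro!: sum.cong)
  qed
  have inp: "input d p A = input d p A'"
    unfolding input_def inv ..
  have lyap: "lyapunov d p q A B = lyapunov d p q A' B'"
    unfolding lyapunov_def comp ..
  have cn: "cov_num d p q A B s2 h = cov_num d p q A' B' s2' h" for h
  proof (induction h)
    case 0
    have "(\<Sum>m<d. s2 m * input d p A' x m * input d p A' y m) = (\<Sum>m<d. s2' m * input d p A' x m * input d p A' y m)" for x y
      by (intro sum.cong refl) (simp add: s2)
    then show ?case by (intro ext) (simp only: cov_num.simps inp lyap)
  next
    case (Suc h)
    show ?case by (intro ext) (simp only: cov_num.simps Suc comp)
  qed
  show ?thesis unfolding minor_num_def autocov_num_def cn ..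
qed

section \<open>From one parameter to almost every parameter\<close>

text \<open>The variances are variables of the polynomial like the coefficients, so a witness may
  take them all equal to 1.\<close>

lemma minor_num_AE_nonzero:
  assumes A0: "varma_coeffs d p q A0 B0" and nz: "minor_num d p q A0 B0 (\<lambda>_. 1) a c D \<noteq> 0"
    and D: "finite D" "D \<subseteq> UNIV \<times> {..<d}" and ac: "snd a < d" "snd c < d"
  shows "AE z in (\<Pi>\<^sub>M n\<in>{..<param_dim d p q}. lborel) \<Otimes>\<^sub>M (\<Pi>\<^sub>M i\<in>{..<d}. lborel).
    minor_num d p q (decode_A d p q (fst z)) (decode_B d p q (fst z)) (snd z) a c D \<noteq> 0"
proof -
  define f where "f = (\<lambda>x :: nat + nat \<Rightarrow> real. minor_num d p q (decode_A d p q (\<lambda>n. x (Inl n)))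
    (decode_B d p q (\<lambda>n. x (Inl n))) (\<lambda>m. x (Inr m)) a c D)"
  have pol: "polyfun f"
    unfolding f_def
  proof (rule polyfun_minor_num)
    show "decode_A d p q (\<lambda>n. x (Inl n)) k \<in> carrier_mat d d" for x :: "nat + nat \<Rightarrow> real" and k
      by (simp add: decode_A_def)
    show "polyfun (\<lambda>x :: nat + nat \<Rightarrow> real. decode_A d p q (\<lambda>n. x (Inl n)) k $$ (i, j))" if "i < d" "j < d" for k i j
      using that by (cases "k = 0 \<and> i \<le> j") (auto simp: decode_A_def polyfun.const polyfun.coord)
    show "polyfun (\<lambda>x :: nat + nat \<Rightarrow> real. decode_B d p q (\<lambda>n. x (Inl n)) l $$ (i, j))" if "i < d" "j < d" for l i j
      using that by (auto simp: decode_B_def polyfun.coord)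
  qed (use D ac in \<open>auto simp: polyfun.coord\<close>)
  have f_eq: "f (case_sum x y) = minor_num d p q (decode_A d p q x) (decode_B d p q x) y a c D" for x y
    by (simp add: f_def)
  have "f (case_sum (coeff_vector d p q A0 B0) (\<lambda>m\<in>{..<d}. 1)) = minor_num d p q A0 B0 (\<lambda>_. 1) a c D"
    unfolding f_eq by (rule minor_num_cong) (simp_all add: decode_coeff_vector[OF A0])
  then have "AE z in (\<Pi>\<^sub>M n\<in>{..<param_dim d p q}. lborel) \<Otimes>\<^sub>M (\<Pi>\<^sub>M i\<in>{..<d}. lborel). f (case_sum (fst z) (snd z)) \<noteq> 0"
    using nz
    by (intro polyfun_pair_AE_nonzero[OF _ _ pol, of _ _ "coeff_vector d p q A0 B0" "\<lambda>m\<in>{..<d}. 1"])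
      (simp_all add: coeff_vector_def del: upt_Suc)
  then show ?thesis unfolding f_eq .
qed

text \<open>On all functions over a countable index type, open sets belong to the product
  sigma-algebra. An open set of extensional functions is pulled back there along restriction to
  \<open>I\<close> and brought back by inclusion.\<close>

lemma openin_product_borel:
  assumes "openin (product_topology (\<lambda>_. euclideanreal) I) (U :: ('i :: countable \<Rightarrow> real) set)"
  shows "U \<in> sets (\<Pi>\<^sub>M i\<in>I. lborel)"
proof -
  have sub: "U \<subseteq> extensional I"
    using openin_subset[OF assms] by (auto simp: PiE_def)
  have "continuous_map (product_topology (\<lambda>_. euclideanreal) UNIV) (product_topology (\<lambda>_. euclideanreal) I)
      (\<lambda>x. restrict x I :: 'i \<Rightarrow> real)"
    unfolding continuous_map_componentwise
  proof (intro conjI ballI image_subsetI)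
    fix k assume k: "k \<in> I"
    have "continuous_map (product_topology (\<lambda>_. euclideanreal) UNIV) euclideanreal (\<lambda>x :: 'i \<Rightarrow> real. x k)"
      by (rule continuous_map_product_projection) (rule UNIV_I)
    then show "continuous_map (product_topology (\<lambda>_. euclideanreal) UNIV) euclideanreal
        (\<lambda>x. (restrict x I :: 'i \<Rightarrow> real) k)"
      using k by simp
  qed (rule restrict_extensional)
  from openin_continuous_map_preimage[OF this assms]
  have "openin (product_topology (\<lambda>_. euclideanreal) UNIV) {x. (restrict x I :: 'i \<Rightarrow> real) \<in> U}"
    by (simp add: PiE_UNIV_domain)
  then have "open {x. (restrict x I :: 'i \<Rightarrow> real) \<in> U}"
    unfolding open_fun_def .
  then have V: "{x. (restrict x I :: 'i \<Rightarrow> real) \<in> U} \<in> sets (\<Pi>\<^sub>M i\<in>UNIV. borel)"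
    by (simp add: sets_PiM_equal_borel)
  have "(\<lambda>x i. x i) \<in> (\<Pi>\<^sub>M i\<in>I. lborel) \<rightarrow>\<^sub>M (\<Pi>\<^sub>M i\<in>UNIV. (borel :: real measure))"
    by (rule measurable_abs_UNIV) (rule measurable_coordinate)
  from measurable_sets[OF this V]
  have "(\<lambda>x i. x i) -` {x. (restrict x I :: 'i \<Rightarrow> real) \<in> U} \<inter> space (\<Pi>\<^sub>M i\<in>I. lborel) \<in> sets (\<Pi>\<^sub>M i\<in>I. (lborel :: real measure))" .
  moreover have "(\<lambda>x i. x i) -` {x. (restrict x I :: 'i \<Rightarrow> real) \<in> U} \<inter> space (\<Pi>\<^sub>M i\<in>I. lborel) = U"
  proof -
    have "restrict x I = x" if "x \<in> extensional I" for x :: "'i \<Rightarrow> real"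
      using that by (rule extensional_restrict)
    moreover have "space (\<Pi>\<^sub>M i\<in>I. (lborel :: real measure)) = extensional I"
      by (simp add: space_PiM PiE_def)
    ultimately show ?thesis using sub by auto
  qed
  ultimately show ?thesis by simp
qed

lemma param_set_measurable:
  "coeff_domain_interior d p q \<times> ({..<d} \<rightarrow>\<^sub>E {0<..}) \<in>
     sets ((\<Pi>\<^sub>M n\<in>{..<param_dim d p q}. lborel) \<Otimes>\<^sub>M (\<Pi>\<^sub>M i\<in>{..<d}. (lborel :: real measure)))"
proof (rule pair_measureI)
  show "coeff_domain_interior d p q \<in> sets (\<Pi>\<^sub>M n\<in>{..<param_dim d p q}. lborel)"
    unfolding coeff_domain_interior_def by (intro openin_product_borel openin_interior_of)
  show "({..<d} \<rightarrow>\<^sub>E {0<..}) \<in> sets (\<Pi>\<^sub>M i\<in>{..<d}. (lborel :: real measure))"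
    by (rule sets_PiM_I_finite) auto
qed

lemma cond_indep_sym: "cond_indep \<mu> A C B \<Longrightarrow> cond_indep \<mu> C A B"
  unfolding cond_indep_def cond_indep_algebras_def
proof (intro ballI, elim ballE)
  fix X Y assume "AE \<omega> in \<mu>. real_cond_exp \<mu> (coordinate_algebra \<mu> B) (indicator (Y \<inter> X)) \<omega> =
     real_cond_exp \<mu> (coordinate_algebra \<mu> B) (indicator Y) \<omega> *
     real_cond_exp \<mu> (coordinate_algebra \<mu> B) (indicator X) \<omega>"
  then show "AE \<omega> in \<mu>. real_cond_exp \<mu> (coordinate_algebra \<mu> B) (indicator (X \<inter> Y)) \<omega> =
     real_cond_exp \<mu> (coordinate_algebra \<mu> B) (indicator X) \<omega> *
     real_cond_exp \<mu> (coordinate_algebra \<mu> B) (indicator Y) \<omega>"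
    by (simp only: Int_commute[of Y X] mult.commute)
qed auto

text \<open>The only way in which an open path constrains the position of \<open>B\<close>; see \<open>open_path_gap_ar\<close> and
  \<open>open_path_gap_ma\<close>. If both \<open>p\<close> and \<open>q\<close> are positive there is no constraint at all.\<close>

definition linked :: "nat \<Rightarrow> nat \<Rightarrow> nat \<Rightarrow> int \<times> nat \<Rightarrow> int \<times> nat \<Rightarrow> (int \<times> nat) set \<Rightarrow> bool" where
  "linked d p q a c D \<longleftrightarrow> fst a = fst c \<or> fst a < fst c \<and> (1 \<le> p \<and> 1 \<le> q \<or>
     (p = 0 \<and> (\<forall>x. fst a \<le> x \<and> x < fst c \<longrightarrow> fst c \<le> x + int q \<or> (\<exists>b\<in>D. x < fst b \<and> fst b \<le> x + int q))) \<or>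
     (q = 0 \<and> (\<forall>x. fst a \<le> x \<and> x < fst c \<longrightarrow>
        fst c \<le> x + int p \<or> (\<exists>v. snd v < d \<and> v \<notin> D \<and> x < fst v \<and> fst v \<le> x + int p))))"

lemma open_path_linked:
  assumes "\<not> blocked (full_time_admg d p q A B) vs ks D" and "is_path (full_time_admg d p q A B) vs ks"
    and x: "fst (hd vs) \<le> fst (last vs)"
  shows "linked d p q (hd vs) (last vs) D"
proof (cases "fst (hd vs) = fst (last vs)")
  case False
  then have lt: "fst (hd vs) < fst (last vs)" using x by simp
  consider "1 \<le> p" "1 \<le> q" | "p = 0" | "q = 0" by linarith
  then show ?thesis
  proof cases
    case 2
    show ?thesis
      using lt 2 open_path_gap_ma[OF assms(2,1)[unfolded 2]]
      unfolding linked_def by blast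
  next
    case 3
    show ?thesis
      using lt 3 open_path_gap_ar[OF assms(2,1)[unfolded 3]]
      unfolding linked_def by blast
  qed (use lt in \<open>auto simp: linked_def\<close>)
qed (simp add: linked_def)

subsection \<open>Almost sure faithfulness\<close>

lemma exists_witness:
  assumes "linked d p q a c D" and D: "finite D" "D \<subseteq> UNIV \<times> {..<d}"
    and ac: "snd a < d" "snd c < d" "a \<notin> D" "c \<notin> D" "a \<noteq> c"
  shows "\<exists>A B. varma_coeffs d p q A B \<and> root_condition d p A \<and> minor_num d p q A B (\<lambda>_. 1) a c D \<noteq> 0"
proof -
  have c: "c \<notin> insert a D" using ac by auto
  consider "fst a = fst c" | "1 \<le> p" "1 \<le> q" "fst a < fst c"
    | "p = 0" "fst a < fst c" "\<forall>x. fst a \<le> x \<and> x < fst c \<longrightarrow> fst c \<le> x + int q \<or> (\<exists>b\<in>D. x < fst b \<and> fst b \<le> x + int q)"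
    | "q = 0" "fst a < fst c" "\<forall>x. fst a \<le> x \<and> x < fst c \<longrightarrow>
        fst c \<le> x + int p \<or> (\<exists>v. snd v < d \<and> v \<notin> D \<and> x < fst v \<and> fst v \<le> x + int p)"
    using assms(1) unfolding linked_def by blast
  then show ?thesis
  proof cases
    case 1
    \<comment> \<open>Simultaneous nodes are already linked by instantaneous effects alone, whence
      \<open>r = 0\<close>.\<close>
    then show ?thesis using ma_witness[of 0 q D d a c p] D ac c by simp
  next
    case 2
    then show ?thesis using arma_witness[OF _ _ D ac(1,2,3) c] by blast
  next
    case 3
    then show ?thesis using ma_witness[OF order_refl D ac(1,2,3) c, of q p] by (simp add: less_imp_le)
  next
    case 4
    have "\<exists>A B. varma_coeffs d p 0 A B \<and> root_condition d p A \<and> minor_num d p 0 A B (\<lambda>_. 1) a c D \<noteq> 0"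
      by (rule ar_witness[OF D ac(1,2,3) c 4(2)]) (use 4(3) in blast)
    then show ?thesis using 4(1) by simp
  qed
qed

text \<open>The minors are indexed without reference to the coefficients, yet they settle
  faithfulness for whichever graph the coefficients produce.\<close>

lemma (in stationary_solution) faithful_if_minors_nonzero:
  assumes nz: "\<And>a c D. linked d p q a c D \<Longrightarrow> finite D \<Longrightarrow> D \<subseteq> UNIV \<times> {..<d} \<Longrightarrow> snd a < d \<Longrightarrow> snd c < d \<Longrightarrow>
      a \<notin> D \<Longrightarrow> c \<notin> D \<Longrightarrow> a \<noteq> c \<Longrightarrow> minor_num d p q A B s2 a c D \<noteq> 0"
  shows "faithful (path_law d M S) (full_time_admg d p q A B)"
  unfolding faithful_def nodes_full_time
proof (intro allI impI)
  let ?G = "full_time_admg d p q A B"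
  fix A' D C'
  assume H: "finite A' \<and> finite D \<and> finite C' \<and> A' \<subseteq> UNIV \<times> {..<d} \<and> D \<subseteq> UNIV \<times> {..<d} \<and> C' \<subseteq> UNIV \<times> {..<d} \<and>
    A' \<inter> D = {} \<and> A' \<inter> C' = {} \<and> D \<inter> C' = {} \<and> cond_indep (path_law d M S) A' C' D"
  show "m_separated ?G A' C' D"
    unfolding m_separated_def
  proof (intro allI impI, rule ccontr)
    fix vs ks
    assume path: "is_path ?G vs ks \<and> hd vs \<in> A' \<and> last vs \<in> C'" and open': "\<not> blocked ?G vs ks D"
    define a c where "a = hd vs" and "c = last vs"
    have mem: "a \<in> A'" "c \<in> C'" using path unfolding a_def c_def by blast+
    have disj: "A' \<inter> D = {}" "A' \<inter> C' = {}" "D \<inter> C' = {}" using H by blast+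
    have "a \<in> UNIV \<times> {..<d}" by (rule subsetD[OF _ mem(1)]) (use H in blast)
    then have "snd a < d" by (cases a) simp
    moreover have "c \<in> UNIV \<times> {..<d}" by (rule subsetD[OF _ mem(2)]) (use H in blast)
    then have "snd c < d" by (cases c) simp
    moreover have "a \<notin> D" using mem(1) disj(1) unfolding disjoint_iff by iprover
    moreover have "c \<notin> D" using mem(2) disj(3) unfolding disjoint_iff by iprover
    moreover have "a \<noteq> c" using mem disj(2) unfolding disjoint_iff by metis
    ultimately have ac: "a \<in> A'" "c \<in> C'" "snd a < d" "snd c < d" "a \<notin> D" "c \<notin> D" "a \<noteq> c"
      using mem by - (assumption+)
    have fin: "finite D" and sub: "A' \<subseteq> UNIV \<times> {..<d}" "D \<subseteq> UNIV \<times> {..<d}" "C' \<subseteq> UNIV \<times> {..<d}"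
      and ci: "cond_indep (path_law d M S) A' C' D"
      using H by iprover+
    show False
    proof (cases "fst a \<le> fst c")
      case True
      then have "linked d p q a c D"
        using open_path_linked[OF open'] path by (simp add: a_def c_def)
      then have "minor_num d p q A B s2 a c D \<noteq> 0"
        using fin sub(2) ac(3-7) by (rule nz)
      moreover have "minor_num d p q A B s2 a c D = 0"
        by (rule cond_indep_imp_minor_num_0[of A' C']) (rule ci sub fin ac)+
      ultimately show False by simp
    next
      case False
      let ?ks = "rev (map reverse_kind ks)"
      have len: "length vs = Suc (length ks)" using path by (simp add: is_path_def)
      have "is_path ?G (rev vs) ?ks"
        using is_path_reverse[OF sym_bidirected_full_time] path by blast
      moreover have "\<not> blocked ?G (rev vs) ?ks D" using blocked_reverse[OF len] open' by blast
      moreover have "hd (rev vs) = c" "last (rev vs) = a"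
        using len by (auto simp: a_def c_def hd_rev last_rev)
      ultimately have "linked d p q c a D"
        using open_path_linked[of d p q A B "rev vs" ?ks D] False by simp
      then have "minor_num d p q A B s2 c a D \<noteq> 0"
        using fin sub(2) ac(4,3,6,5) ac(7)[symmetric] by (rule nz)
      moreover have "minor_num d p q A B s2 c a D = 0"
        by (rule cond_indep_imp_minor_num_0[of C' A']) (rule cond_indep_sym[OF ci] sub fin ac)+
      ultimately show False by simp
    qed
  qed
qed

text \<open>The quantifiers over the probability space, the innovations and the solution stand
  inside the almost sure statement, so one null set serves for all stationary solutions.\<close>

theorem theorem5:
  fixes d p q :: nat
    and P :: "((nat \<Rightarrow> real) \<times> (nat \<Rightarrow> real)) measure"
  assumes "prob_space P"
    and "sets P = sets (param_lebesgue d p q)"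
    and "absolutely_continuous (param_lebesgue d p q) P"
  shows "AE (\<theta>, s2) in P.
    \<forall>A B (M :: 'w measure) \<epsilon> S.
      varma_coeffs d p q A B \<and> coeff_vector d p q A B = \<theta> \<and>
      stationary_varma d p q A B s2 M \<epsilon> S \<longrightarrow>
      faithful (path_law d M S) (full_time_admg d p q A B)"
proof -
  let ?L = "(\<Pi>\<^sub>M n\<in>{..<param_dim d p q}. lborel) \<Otimes>\<^sub>M (\<Pi>\<^sub>M i\<in>{..<d}. (lborel :: real measure))"
  let ?\<Omega> = "coeff_domain_interior d p q \<times> ({..<d} \<rightarrow>\<^sub>E {0<..})"
  \<comment> \<open>Depends on \<open>d\<close>, \<open>p\<close> and \<open>q\<close> only, so the
    exceptional set is a single countable union of null sets although the graph varies with the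
    parameter.\<close>
  define T where "T = {(a, c, D). linked d p q a c D \<and> finite D \<and> D \<subseteq> UNIV \<times> {..<d} \<and> snd a < d \<and> snd c < d \<and>
      a \<notin> D \<and> c \<notin> D \<and> a \<noteq> c}"
  have "T \<subseteq> UNIV \<times> UNIV \<times> Collect finite" by (auto simp: T_def)
  moreover have "countable (UNIV \<times> UNIV \<times> Collect finite :: ((int \<times> nat) \<times> (int \<times> nat) \<times> (int \<times> nat) set) set)"
    by (intro countable_SIGMA countable_Collect_finite) auto
  ultimately have "countable T" by (rule countable_subset)
  have "AE z in ?L. case t of (a, c, D) \<Rightarrow>
      minor_num d p q (decode_A d p q (fst z)) (decode_B d p q (fst z)) (snd z) a c D \<noteq> 0" if t: "t \<in> T" for t
  proof -
    obtain a c D where acD: "t = (a, c, D)" by (cases t) auto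
    with t have *: "linked d p q a c D" "finite D" "D \<subseteq> UNIV \<times> {..<d}" "snd a < d" "snd c < d" "a \<notin> D" "c \<notin> D" "a \<noteq> c"
      by (auto simp: T_def)
    obtain A0 B0 where "varma_coeffs d p q A0 B0" "minor_num d p q A0 B0 (\<lambda>_. 1) a c D \<noteq> 0"
      using exists_witness[OF *] by blast
    then show ?thesis unfolding acD prod.case using * by (rule_tac minor_num_AE_nonzero) auto
  qed
  then have "AE z in ?L. \<forall>t\<in>T. case t of (a, c, D) \<Rightarrow>
      minor_num d p q (decode_A d p q (fst z)) (decode_B d p q (fst z)) (snd z) a c D \<noteq> 0"
    by (subst AE_ball_countable[OF \<open>countable T\<close>]) blast
  then have "AE z in param_lebesgue d p q. \<forall>t\<in>T. case t of (a, c, D) \<Rightarrow>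
      minor_num d p q (decode_A d p q (fst z)) (decode_B d p q (fst z)) (snd z) a c D \<noteq> 0"
    unfolding param_lebesgue_def
    by (subst AE_restrict_space_iff) (use param_set_measurable in \<open>auto elim!: eventually_mono intro!: sets.Int\<close>)
  then have AE_P: "AE z in P. \<forall>t\<in>T. case t of (a, c, D) \<Rightarrow>
      minor_num d p q (decode_A d p q (fst z)) (decode_B d p q (fst z)) (snd z) a c D \<noteq> 0"
    by (rule absolutely_continuous_AE[OF assms(2,3)])
  have "space P = space (param_lebesgue d p q)" by (rule sets_eq_imp_space_eq) fact
  then have space: "space P \<subseteq> ?\<Omega>" by (auto simp: param_lebesgue_def space_restrict_space)
  from AE_P AE_space show ?thesis
  proof eventually_elim
    case (elim z)
    obtain \<theta> s2 where z: "z = (\<theta>, s2)" by (cases z)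
    have \<theta>: "\<theta> \<in> coeff_domain d p q" and s2: "\<And>i. i < d \<Longrightarrow> 0 < s2 i"
      using elim(2) space z interior_of_subset
      by (fastforce simp: coeff_domain_interior_def PiE_def Pi_iff)+
    obtain A1 B1 where AB1: "coeff_vector d p q A1 B1 = \<theta>" "varma_coeffs d p q A1 B1" "root_condition d p A1"
      using \<theta> unfolding coeff_domain_def by auto
    show ?case
      unfolding z prod.case
    proof (intro allI impI)
      fix A B and M :: "'w measure" and \<epsilon> S
      assume *: "varma_coeffs d p q A B \<and> coeff_vector d p q A B = \<theta> \<and> stationary_varma d p q A B s2 M \<epsilon> S"
      then have v: "varma_coeffs d p q A B" "coeff_vector d p q A B = \<theta>" by auto
      \<comment> \<open>\<open>root_condition\<close> is known for the coefficients that witness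
        membership in the domain; equality of the vectors carries it over to
        \<open>A\<close>.\<close>
      have "A k = A1 k" if "k \<le> p" for k
        using decode_coeff_vector(1)[OF v(1) that] decode_coeff_vector(1)[OF AB1(2) that] v(2) AB1(1) by simp
      then have root: "root_condition d p A" using AB1(3) root_condition_cong[of p A A1 d] by simp
      interpret stationary_solution d p q A B s2 M \<epsilon> S
        by unfold_locales (use * root s2 in auto)
      show "faithful (path_law d M S) (full_time_admg d p q A B)"
      proof (rule faithful_if_minors_nonzero)
        fix a c D
        assume "linked d p q a c D" "finite D" "D \<subseteq> UNIV \<times> {..<d}" "snd a < d" "snd c < d" "a \<notin> D" "c \<notin> D" "a \<noteq> c"
        then have "(a, c, D) \<in> T" by (simp add: T_def)
        then have "minor_num d p q (decode_A d p q \<theta>) (decode_B d p q \<theta>) s2 a c D \<noteq> 0"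
          using elim(1) z by fastforce
        moreover have "minor_num d p q (decode_A d p q \<theta>) (decode_B d p q \<theta>) s2 a c D = minor_num d p q A B s2 a c D"
          by (rule minor_num_cong) (use decode_coeff_vector[OF v(1)] v(2) in auto)
        ultimately show "minor_num d p q A B s2 a c D \<noteq> 0" by simp
      qed
    qed
  qed
qed

end
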